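(* Let $T,R>0$, let $\mu_0\in\mathcal P_c(\mathbb R^{2d})$ with $\operatorname{supp}(\mu_0)\subset B(R)$, let $\ell\in C^2(\mathbb R^d\times\mathbb R^d)$, let $\psi_T\in C_c^2(\mathbb R^{2d})$ be a terminal condition satisfying $$\operatorname{supp}(\psi_T)=B(R_T)\qquad\text{and}\qquad\psi_T(x,y)=\ell(x,y)\ \text{ for all }(x,y)\in B(R_T),$$ with $R_T$ as in the context, and suppose that $\mathcal F:[0,T]\times\mathbb R^d\times\mathbb R^m\to\mathbb R^d$ satisfies Assumptions (A1) and (A2) of the context. For each $N\ge1$ let $$\mu_0^N:=\frac1N\sum_{i=1}^N\delta_{(X_0^i,Y_0^i)}\in\mathcal P_c^N(\mathbb R^{2d})$$ be an empirical measure with atoms in $B(R)$, such that $\lim_{N\to\infty}W_1(\mu_0^N,\mu_0)=0$. Let $\lambda>0$ be sufficiently large so that $(\mu^*,\theta^*,\psi^* )\in C([0,T];\mathcal P_c(\mathbb R^{2d}))\times\operatorname{Lip}([0,T];\mathbb R^m)\times C^1([0,T];C_c^2(\mathbb R^{2d}))$ and $(\mu^N,\theta^N,\psi^N)\in C([0,T];\mathcal P_c^N(\mathbb R^{2d}))\times\operatorname{Lip}([0,T];\mathbb R^m)\times C^1([0,T];C_c^2(\mathbb R^{2d}))$ are the unique solutions of the system $$\begin{cases}\partial_t\mu_t+\nabla_x\cdot(\mathcal F(t,x,\theta_t)\mu_t)=0,\\ \partial_t\psi+\nabla_x\psi\cdot\mathcal F(t,x,\theta_t)=0,\quad\psi_t|_{t=T}=\psi_T,\\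 \theta_t^{\top}=-\dfrac1{2\lambda}\displaystyle\int_{\mathbb R^{2d}}\nabla_x\psi\cdot\nabla_\theta\mathcal F(t,x,\theta_t)\,d\mu_t(x,y)\end{cases}$$ with initial conditions $\mu_0$ and $\mu_0^N$ respectively. Then for every $p\in[1,\infty]$, $$\max\Big\{\|\theta^N-\theta^*\|_{L^p},\ \sup_{t\in[0,T]}W_1(\mu^N_t,\mu^*_t),\ \|\psi^N-\psi^*\|_{C([0,T]\times B(R_T))}\Big\}\le C\,W_1(\mu_0^N,\mu_0)$$ for a constant $C>0$ which only depends on the parameters of the model and $p$. In particular, writing $\mu^N_T=\frac1N\sum_{i=1}^N\delta_{(X^i_T,Y^i_T)}$ with $(X^i_T,Y^i_T)=(\Phi^{\theta^N}_{(0,T)}(X^i_0),Y_0^i)$, $$\Big|\int_{\mathbb R^{2d}}\ell(x,y)\,d\mu^*_T(x,y)-\frac1N\sum_{i=1}^N\ell(X^i_T,Y^i_T)\Big|\le C\,W_1(\mu_0^N,\mu_0).$$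
   Context: Notation: $B(R)$ is the ball of radius $R$ centred at the origin; $\mathcal P_c(\mathbb R^{2d})$ is the set of compactly supported Borel probability measures and $\mathcal P_c^N(\mathbb R^{2d})$ its subset of empirical (atomic) measures; points of $\mathbb R^{2d}$ are $(x,y)\in\mathbb R^d\times\mathbb R^d$; $W_1$ is the 1-Wasserstein distance. Assumption (A1). (i) For each $\theta\in\mathbb R^m$, $(t,x)\mapsto\mathcal F(t,x,\theta)$ is continuous. (ii) There is $C_{\mathcal F}>0$ (possibly depending on $d,m$) with $|\mathcal F(t,x,\theta)|\le C_{\mathcal F}(1+|x|)$ for all $\theta$, a.e. $t\in[0,T]$ and all $x$. (iii) There is $L_{\mathcal F}>0$ independent of $d,m$ with $|\mathcal F(t,x_1,\theta)-\mathcal F(t,x_2,\theta)|\le L_{\mathcal F}(1+|\theta|)|x_1-x_2|$ for all $\theta$, a.e. $t$ and all $x_1,x_2$. (iv) For all $(t,x)$, $\theta\mapsto\mathcal F(t,x,\theta)$ is twice differentiable, and for each $R>0$ there is $C(d,m,R)>0$ bounding $\|\nabla_\theta\mathcal F\|_{C([0,T]\times B(R)\times\mathbb R^m)}+\|\nabla^2_\theta\mathcal F\|_{C([0,T]\times B(R)\times\mathbb R^m)}$. Assumption (A2). For each $R>0$: (i) $x\mapsto\mathcal F(t,x,\theta)$ is $C^2$ for all $t,\theta$, and for $x\in B(R)$, $|\nabla_x\cdot\nabla_\theta\mathcal F(t,x,\theta)|+|\nabla_x\mathcal F(t,x,\theta)|+|\nabla_x^2\mathcal F(t,x,\theta)|\le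 C(d,m,R,|\theta|)$. (ii) $|\mathcal F(t,x,\theta^1)-\mathcal F(s,x,\theta^2)|\le C(d,m,R)(|t-s|+|\theta^1-\theta^2|)$ for all $\theta^1,\theta^2\in\mathbb R^m$, $s,t\in[0,T]$, $x\in B(R)$. (iii) For all fixed $\theta$, $t$: $|\nabla_\theta\mathcal F(t,x,\theta)-\nabla_\theta\mathcal F(t,y,\theta)|\le C(d,m,R,|\theta|)|x-y|$ for $x,y\in B(R)$. The continuity equation is understood in the sense of distributions on $(0,T)\times\mathbb R^{2d}$; its unique solution for a control $\theta\in L^2([0,T];\mathbb R^m)$ and a datum supported in $B(R)$ is supported in $B(R_T)$ for all $t\in[0,T]$, with $R_T>0$ depending only on $R,T,C_{\mathcal F}$. $\Phi^\theta_{(\tau,t)}$ is the flow on $\mathbb R^d$ of $\dot X_t=\mathcal F(t,X_t,\theta_t)$ from time $\tau$ to $t$. The backward equation is solved by characteristics: $\psi(t,x,y)=\psi_T(\Phi^\theta_{(t,T)}(x),y)$. Uniqueness of the controls is within a fixed ball $\Gamma_C=\{\theta\in L^2([0,T];\mathbb R^m):\|\theta\|_2\le C_\Gamma T^{1/2}\}$, $C_\Gamma>0$ a fixed constant; "$\lambda$ sufficiently large" means above a threshold depending only on the data $T,R,\mathcal F,\psi_T$, $C_\Gamma$ (and an arbitrarily fixed bound on the Lipschitz constant in time of the controls), not on $N$. $\nabla_x\psi\cdot\nabla_\theta\mathcal F$ is the row vector with $j$-th entry $\sum_k\partial_{x_k}\psi\,\partial_{\theta_j}\mathcal F_k$. 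*)

theory Defs
  imports "HOL-Probability.Probability"
begin

primrec C_k :: "nat \<Rightarrow> ('a::euclidean_space \<Rightarrow> 'b::real_normed_vector) \<Rightarrow> bool" where
  "C_k 0 f \<longleftrightarrow> continuous_on UNIV f"
| "C_k (Suc k) f \<longleftrightarrow>
     f differentiable_on UNIV \<and> (\<forall>i\<in>Basis. C_k k (\<lambda>x. frechet_derivative f (at x) i))"

definition fun_supp :: "('a::topological_space \<Rightarrow> 'b::zero) \<Rightarrow> 'a set" where
  "fun_supp f = closure {x. f x \<noteq> 0}"

definition C2c :: "('a::euclidean_space \<Rightarrow> real) \<Rightarrow> bool" where
  "C2c f \<longleftrightarrow> C_k 2 f \<and> compact (fun_supp f)"

text \<open>Test functions on \<open>(0,T) \<times> 'a\<close>, extended by zero to all times.\<close>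

definition test_fun :: "real \<Rightarrow> (real \<times> 'a::euclidean_space \<Rightarrow> real) \<Rightarrow> bool" where
  "test_fun T \<phi> \<longleftrightarrow>
     (\<forall>k. C_k k \<phi>) \<and> compact (fun_supp \<phi>) \<and> fun_supp \<phi> \<subseteq> {0<..<T} \<times> UNIV"

text \<open>The space \<open>C\<^sup>1([0,T]; C\<^sub>c\<^sup>2)\<close>: every slice is in \<open>C\<^sub>c\<^sup>2\<close>, and \<open>t \<mapsto> \<psi>\<^sub>t\<close> is continuously
  differentiable in time for the supremum norm. The time derivative
  \<open>- \<nabla>\<^sub>x\<psi> \<cdot> \<F>\<close> of the solution by characteristics of the backward equation is in
  general only \<open>C\<^sup>1\<close> in space, so differentiability in time is not asked for in the \<open>C\<^sup>2\<close> norm.\<close>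

definition C1_C2c :: "real \<Rightarrow> (real \<Rightarrow> 'a::euclidean_space \<Rightarrow> real) \<Rightarrow> bool" where
  "C1_C2c T \<psi> \<longleftrightarrow>
     (\<forall>t\<in>{0..T}. C2c (\<psi> t)) \<and>
     (\<exists>\<psi>'. \<forall>t\<in>{0..T}.
        uniform_limit UNIV (\<lambda>s z. (\<psi> s z - \<psi> t z) / (s - t)) (\<psi>' t) (at t within {0..T}) \<and>
        uniform_limit UNIV \<psi>' (\<psi>' t) (at t within {0..T}))"

definition Lp_norm :: "real \<Rightarrow> ennreal \<Rightarrow> (real \<Rightarrow> 'a::real_normed_vector) \<Rightarrow> ennreal" where
  "Lp_norm T p f =
     (if p = \<infinity> then esssup (restrict_space lborel {0..T}) (\<lambda>t. ennreal (norm (f t)))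
      else let I = (\<integral>\<^sup>+t\<in>{0..T}. ennreal (norm (f t) powr enn2real p) \<partial>lborel)
           in if I = \<infinity> then \<infinity> else ennreal (enn2real I powr (1 / enn2real p)))"

definition L2_control :: "real \<Rightarrow> (real \<Rightarrow> real ^ 'm) \<Rightarrow> bool" where
  "L2_control T \<theta> \<longleftrightarrow>
     \<theta> \<in> borel_measurable (restrict_space lborel {0..T}) \<and> Lp_norm T 2 \<theta> < \<infinity>"

definition control_ball :: "real \<Rightarrow> real \<Rightarrow> (real \<Rightarrow> real ^ 'm) set" where
  "control_ball T C\<^sub>\<Gamma> =
     {\<theta>. L2_control T \<theta> \<and> Lp_norm T 2 \<theta> \<le> ennreal (C\<^sub>\<Gamma> * T powr (1/2))}"

definition measure_supp :: "'a::topological_space measure \<Rightarrow> 'a set" where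
  "measure_supp \<mu> = {x. \<forall>U. open U \<longrightarrow> x \<in> U \<longrightarrow> emeasure \<mu> U > 0}"

definition P_c :: "'a::euclidean_space measure set" where
  "P_c = {\<mu>. sets \<mu> = sets borel \<and> prob_space \<mu> \<and> compact (measure_supp \<mu>)}"

text \<open>The measure \<open>1/N \<Sum>\<^sub>i\<^sub><\<^sub>N \<delta>\<^bsub>Z i\<^esub>\<close>; see \<open>emeasure_empirical\<close>.\<close>

definition empirical :: "nat \<Rightarrow> (nat \<Rightarrow> 'a::euclidean_space) \<Rightarrow> 'a measure" where
  "empirical N Z = measure_of UNIV (sets borel) (\<lambda>A. (\<Sum>i<N. indicator A (Z i)) / of_nat N)"

lemma sets_empirical [simp]: "sets (empirical N Z) = sets borel"
  unfolding empirical_def by (simp add: sets_measure_of_conv sets.sigma_sets_eq[of borel, simplified])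

lemma emeasure_empirical:
  assumes "A \<in> sets borel"
  shows "emeasure (empirical N Z) A = (\<Sum>i<N. indicator A (Z i)) / of_nat N"
proof (rule emeasure_measure_of[OF empirical_def])
  show "countably_additive (sets (empirical N Z)) (\<lambda>A. (\<Sum>i<N. indicator A (Z i)) / of_nat N :: ennreal)"
    unfolding countably_additive_def
    by (auto simp: divide_ennreal_def suminf_sum suminf_indicator)
qed (use assms in \<open>auto simp: positive_def\<close>)

definition P_c_emp :: "nat \<Rightarrow> 'a::euclidean_space measure set" where
  "P_c_emp N = {empirical N Z | Z. True}"

definition couplings ::
  "'a::euclidean_space measure \<Rightarrow> 'a measure \<Rightarrow> ('a \<times> 'a) measure set" where
  "couplings \<mu> \<nu> =
     {\<gamma>. sets \<gamma> = sets borel \<and> distr \<gamma> borel fst = \<mu> \<and> distr \<gamma> borel snd = \<nu>}"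

definition W1 :: "'a::euclidean_space measure \<Rightarrow> 'a measure \<Rightarrow> ennreal" where
  "W1 \<mu> \<nu> = (INF \<gamma>\<in>couplings \<mu> \<nu>. \<integral>\<^sup>+z. ennreal (dist (fst z) (snd z)) \<partial>\<gamma>)"

text \<open>The space \<open>C([0,T]; P\<^sub>c)\<close>, with the topology of \<open>W1\<close> on \<open>P\<^sub>c\<close>.\<close>

definition P_c_curve :: "real \<Rightarrow> (real \<Rightarrow> 'a::euclidean_space measure) \<Rightarrow> bool" where
  "P_c_curve T \<mu> \<longleftrightarrow>
     (\<forall>t\<in>{0..T}. \<mu> t \<in> P_c) \<and>
     (\<forall>t\<in>{0..T}. ((\<lambda>s. W1 (\<mu> s) (\<mu> t)) \<longlongrightarrow> 0) (at t within {0..T}))"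

definition bderiv :: "('a::real_normed_vector \<Rightarrow> 'b::real_normed_vector) \<Rightarrow> 'a \<Rightarrow> 'a \<Rightarrow>\<^sub>L 'b" where
  "bderiv f x = Blinfun (frechet_derivative f (at x))"

definition assumption_A1 ::
  "real \<Rightarrow> (real \<Rightarrow> real ^ 'd \<Rightarrow> real ^ 'm \<Rightarrow> real ^ 'd) \<Rightarrow> bool" where
  "assumption_A1 T F \<longleftrightarrow>
     (\<forall>\<theta>. continuous_on ({0..T} \<times> UNIV) (\<lambda>(t, x). F t x \<theta>)) \<and>
     (\<exists>C\<^sub>F>0. \<forall>\<theta>. AE t\<in>{0..T} in lborel. \<forall>x. norm (F t x \<theta>) \<le> C\<^sub>F * (1 + norm x)) \<and>
     (\<exists>L\<^sub>F>0. \<forall>\<theta>. AE t\<in>{0..T} in lborel. \<forall>x\<^sub>1 x\<^sub>2.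
        norm (F t x\<^sub>1 \<theta> - F t x\<^sub>2 \<theta>) \<le> L\<^sub>F * (1 + norm \<theta>) * norm (x\<^sub>1 - x\<^sub>2)) \<and>
     (\<forall>t\<in>{0..T}. \<forall>x \<theta>. F t x differentiable at \<theta> \<and> bderiv (F t x) differentiable at \<theta>) \<and>
     (\<forall>R>0.
        continuous_on ({0..T} \<times> cball 0 R \<times> UNIV) (\<lambda>(t, x, \<theta>). bderiv (F t x) \<theta>) \<and>
        continuous_on ({0..T} \<times> cball 0 R \<times> UNIV) (\<lambda>(t, x, \<theta>). bderiv (bderiv (F t x)) \<theta>) \<and>
        (\<exists>C>0. \<forall>t\<in>{0..T}. \<forall>x\<in>cball 0 R. \<forall>\<theta>.
           norm (bderiv (F t x) \<theta>) + norm (bderiv (bderiv (F t x)) \<theta>) \<le> C))"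

text \<open>A constant \<open>C(d,m,R,\<bar>\<theta>\<bar>)\<close> is a nondecreasing function of \<open>\<bar>\<theta>\<bar>\<close> (equivalently, a constant
  that is locally uniform in \<open>\<theta>\<close>); \<open>\<nabla>\<^sub>x\<cdot>\<nabla>\<^sub>\<theta>\<F>\<close> is the full mixed second derivative.\<close>

definition assumption_A2 ::
  "real \<Rightarrow> (real \<Rightarrow> real ^ 'd \<Rightarrow> real ^ 'm \<Rightarrow> real ^ 'd) \<Rightarrow> bool" where
  "assumption_A2 T F \<longleftrightarrow> (\<forall>R>0.
     (\<forall>t\<in>{0..T}. \<forall>\<theta>. C_k 2 (\<lambda>x. F t x \<theta>) \<and> (\<lambda>x. bderiv (F t x) \<theta>) differentiable_on UNIV) \<and>
     (\<exists>C. mono C \<and> (\<forall>t\<in>{0..T}. \<forall>x\<in>cball 0 R. \<forall>\<theta>.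
        norm (bderiv (\<lambda>x'. bderiv (F t x') \<theta>) x) + norm (bderiv (\<lambda>x'. F t x' \<theta>) x)
          + norm (bderiv (bderiv (\<lambda>x'. F t x' \<theta>)) x) \<le> C (norm \<theta>))) \<and>
     (\<exists>C. \<forall>\<theta>\<^sub>1 \<theta>\<^sub>2. \<forall>s\<in>{0..T}. \<forall>t\<in>{0..T}. \<forall>x\<in>cball 0 R.
        norm (F t x \<theta>\<^sub>1 - F s x \<theta>\<^sub>2) \<le> C * (\<bar>t - s\<bar> + norm (\<theta>\<^sub>1 - \<theta>\<^sub>2))) \<and>
     (\<exists>C. mono C \<and> (\<forall>\<theta>. \<forall>t\<in>{0..T}. \<forall>x\<in>cball 0 R. \<forall>y\<in>cball 0 R.
        norm (bderiv (F t x) \<theta> - bderiv (F t y) \<theta>) \<le> C (norm \<theta>) * norm (x - y))))"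

definition grad_x :: "((real ^ 'd) \<times> (real ^ 'd) \<Rightarrow> real) \<Rightarrow> (real ^ 'd) \<times> (real ^ 'd) \<Rightarrow> real ^ 'd" where
  "grad_x g z = (\<chi> k. frechet_derivative (\<lambda>x. g (x, snd z)) (at (fst z)) (axis k 1))"

text \<open>The row vector \<open>v \<cdot> \<nabla>\<^sub>\<theta>\<F>(t,x,\<theta>)\<close>, with \<open>j\<close>-th entry \<open>\<Sum>\<^sub>k v\<^sub>k \<partial>\<^bsub>\<theta>\<^sub>j\<^esub>\<F>\<^sub>k\<close>.\<close>

definition row_grad_theta ::
  "(real \<Rightarrow> real ^ 'd \<Rightarrow> real ^ 'm \<Rightarrow> real ^ 'd) \<Rightarrow> real ^ 'd \<Rightarrow> real \<Rightarrow> real ^ 'd \<Rightarrow> real ^ 'm \<Rightarrow> real ^ 'm" where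
  "row_grad_theta F v t x \<theta> =
     (\<chi> j. \<Sum>k\<in>UNIV. v $ k * frechet_derivative (F t x) (at \<theta>) (axis j 1) $ k)"

definition continuity_equation ::
  "real \<Rightarrow> (real \<Rightarrow> real ^ 'd \<Rightarrow> real ^ 'm \<Rightarrow> real ^ 'd) \<Rightarrow> (real \<Rightarrow> real ^ 'm)
     \<Rightarrow> (real \<Rightarrow> ((real ^ 'd) \<times> (real ^ 'd)) measure) \<Rightarrow> bool" where
  "continuity_equation T F \<theta> \<mu> \<longleftrightarrow>
     (\<forall>\<phi>. test_fun T \<phi> \<longrightarrow>
        (LINT t:{0..T}|lborel.
           (LINT z|\<mu> t. deriv (\<lambda>s. \<phi> (s, z)) t
                          + grad_x (\<lambda>z'. \<phi> (t, z')) z \<bullet> F t (fst z) (\<theta> t))) = 0)"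

definition backward_equation ::
  "real \<Rightarrow> (real \<Rightarrow> real ^ 'd \<Rightarrow> real ^ 'm \<Rightarrow> real ^ 'd) \<Rightarrow> (real \<Rightarrow> real ^ 'm)
     \<Rightarrow> ((real ^ 'd) \<times> (real ^ 'd) \<Rightarrow> real) \<Rightarrow> (real \<Rightarrow> (real ^ 'd) \<times> (real ^ 'd) \<Rightarrow> real) \<Rightarrow> bool" where
  "backward_equation T F \<theta> \<psi>\<^sub>T \<psi> \<longleftrightarrow>
     (\<forall>t\<in>{0..T}. \<forall>z. ((\<lambda>s. \<psi> s z) has_real_derivative
        - (grad_x (\<psi> t) z \<bullet> F t (fst z) (\<theta> t))) (at t within {0..T})) \<and>
     \<psi> T = \<psi>\<^sub>T"

definition control_equation ::
  "real \<Rightarrow> (real \<Rightarrow> real ^ 'd \<Rightarrow> real ^ 'm \<Rightarrow> real ^ 'd) \<Rightarrow> real \<Rightarrow> (real \<Rightarrow> ((real ^ 'd) \<times> (real ^ 'd)) measure)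
     \<Rightarrow> (real \<Rightarrow> real ^ 'm) \<Rightarrow> (real \<Rightarrow> (real ^ 'd) \<times> (real ^ 'd) \<Rightarrow> real) \<Rightarrow> bool" where
  "control_equation T F lam \<mu> \<theta> \<psi> \<longleftrightarrow>
     (\<forall>t\<in>{0..T}. \<theta> t = - (1 / (2 * lam)) *\<^sub>R
        (LINT z|\<mu> t. row_grad_theta F (grad_x (\<psi> t) z) t (fst z) (\<theta> t)))"

definition solution ::
  "real \<Rightarrow> (real \<Rightarrow> real ^ 'd \<Rightarrow> real ^ 'm \<Rightarrow> real ^ 'd) \<Rightarrow> ((real ^ 'd) \<times> (real ^ 'd) \<Rightarrow> real) \<Rightarrow> real \<Rightarrow> real
     \<Rightarrow> ((real ^ 'd) \<times> (real ^ 'd)) measure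
     \<Rightarrow> (real \<Rightarrow> ((real ^ 'd) \<times> (real ^ 'd)) measure) \<Rightarrow> (real \<Rightarrow> real ^ 'm)
     \<Rightarrow> (real \<Rightarrow> (real ^ 'd) \<times> (real ^ 'd) \<Rightarrow> real) \<Rightarrow> bool" where
  "solution T F \<psi>\<^sub>T C\<^sub>\<Gamma> lam \<mu>\<^sub>0 \<mu> \<theta> \<psi> \<longleftrightarrow>
     P_c_curve T \<mu> \<and> (\<exists>L. L-lipschitz_on {0..T} \<theta>) \<and> \<theta> \<in> control_ball T C\<^sub>\<Gamma> \<and> C1_C2c T \<psi> \<and>
     \<mu> 0 = \<mu>\<^sub>0 \<and> continuity_equation T F \<theta> \<mu> \<and> backward_equation T F \<theta> \<psi>\<^sub>T \<psi> \<and>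
     control_equation T F lam \<mu> \<theta> \<psi>"

text \<open>The property of \<open>R\<^sub>T\<close> that matters: solutions of the continuity equation that start in
  \<open>B(R)\<close> stay in \<open>B(R\<^sub>T)\<close>, uniformly in the control. Any such radius is admitted; by Gronwall
  one depending only on \<open>R\<close>, \<open>T\<close> and the growth constant of \<open>\<F>\<close> exists.\<close>

definition confining_radius ::
  "real \<Rightarrow> (real \<Rightarrow> real ^ 'd \<Rightarrow> real ^ 'm \<Rightarrow> real ^ 'd) \<Rightarrow> real \<Rightarrow> real \<Rightarrow> bool" where
  "confining_radius T F R R\<^sub>T \<longleftrightarrow>
     R\<^sub>T > 0 \<and>
     (\<forall>\<theta> \<mu>. L2_control T \<theta> \<longrightarrow> P_c_curve T \<mu> \<longrightarrow> continuity_equation T F \<theta> \<mu> \<longrightarrow>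
        measure_supp (\<mu> 0) \<subseteq> cball 0 R \<longrightarrow> (\<forall>t\<in>{0..T}. measure_supp (\<mu> t) \<subseteq> cball 0 R\<^sub>T))"

text \<open>The flow, for \<open>\<tau> \<le> t\<close>; trajectories are solutions in the integral sense because
  controls are in general only measurable in time.\<close>

definition trajectory ::
  "(real \<Rightarrow> real ^ 'd \<Rightarrow> real ^ 'm \<Rightarrow> real ^ 'd) \<Rightarrow> (real \<Rightarrow> real ^ 'm) \<Rightarrow> real \<Rightarrow> real
     \<Rightarrow> real ^ 'd \<Rightarrow> (real \<Rightarrow> real ^ 'd) \<Rightarrow> bool" where
  "trajectory F \<theta> \<tau> t x X \<longleftrightarrow>
     set_integrable lborel {\<tau>..t} (\<lambda>s. F s (X s) (\<theta> s)) \<and>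
     (\<forall>s\<in>{\<tau>..t}. X s = x + (LINT r:{\<tau>..s}|lborel. F r (X r) (\<theta> r)))"

definition flow ::
  "(real \<Rightarrow> real ^ 'd \<Rightarrow> real ^ 'm \<Rightarrow> real ^ 'd) \<Rightarrow> (real \<Rightarrow> real ^ 'm) \<Rightarrow> real \<Rightarrow> real
     \<Rightarrow> real ^ 'd \<Rightarrow> real ^ 'd" where
  "flow F \<theta> \<tau> t x = (THE y. \<exists>X. trajectory F \<theta> \<tau> t x X \<and> X t = y)"

end

(*
  Solutions are represented along characteristics: mu_t is the image of mu_0 under the flow of the
  Lipschitz field v = (F(t,x,theta_t),0), and psi_t is psi_T composed with the flow from t to T. For
  the first claim, a Lipschitz function that is constant along characteristics is mollified in
  space-time; its derivative in direction (1,v) is small by a commutator estimate, so testing the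
  weak equation with it shows that its integral against mu_t does not depend on t.

  Stability then needs no derivative of the flow. Gronwall's inequality for differences and for
  second differences of trajectories shows that grad_x psi is Lipschitz and depends in a Lipschitz
  way on the control in the supremum norm. Pulling the control equation back to a coupling of the
  initial data with cost J, the distance delta of the two controls satisfies
  delta <= D / (2 lam) * (J + delta), hence delta <= J as soon as lam >= D.
*)
theory Submission
  imports Defs
begin

section \<open>Ordinary differential equations\<close>

text \<open>The threshold for \<lambda> must be the same for all solutions, although the constant D
  contains a Lipschitz constant of F(t,x,theta_t) that grows with |theta_t|. The L2 ball of
  admissible controls breaks this circle: it bounds the L1 norm of the control, and Gronwall's
  inequality needs no more for a Lipschitz bound of the flow, hence of psi. The control equation
  turns this into a supremum bound M shared by all solutions with \<lambda> at least 1, and the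
  remaining constants are built from M. A solution contains a psi of class C^2. Its gradient thus
  exists and only its size has to be estimated, for which difference quotients suffice.
  Mollification degrades near the ends of a time interval. The weak equation therefore yields
  constancy of the integral only at interior times; continuity of the curve of measures in W1
  carries it to the end points. The estimates are made for one coupling at a time, in real numbers,
  because delta has to be subtracted; the infimum over couplings is taken last. Equal initial data
  give uniqueness.\<close>

lemma gronwall_integral:
  fixes u a :: "real \<Rightarrow> real"
  assumes st: "s \<le> t" and B: "B \<ge> 0"
    and u: "continuous_on {s..t} u" and a: "continuous_on {s..t} a"
    and a0: "\<And>r. r \<in> {s..t} \<Longrightarrow> 0 \<le> a r"
    and le: "\<And>r. r \<in> {s..t} \<Longrightarrow> u r \<le> c + integral {s..r} (\<lambda>x. a x * u x + B)"
  shows "u t \<le> (c + B * (t - s)) * exp (integral {s..t} a)"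
proof -
  define U where "U r = c + integral {s..r} (\<lambda>x. a x * u x + B)" for r
  define A where "A r = integral {s..r} a" for r
  \<comment> \<open>The factor \<open>exp (- A r)\<close> absorbs the growth caused by
    \<open>a\<close>. Since it is at most 1, the forcing contributes at most B per unit of time,
    which the term \<open>B * r\<close> compensates.\<close>
  define W where "W r = exp (- A r) * U r - B * r" for r
  have dU: "(U has_real_derivative a r * u r + B) (at r within {s..t})" if "r \<in> {s..t}" for r
  proof -
    have "((\<lambda>r. integral {s..r} (\<lambda>x. a x * u x + B)) has_real_derivative a r * u r + B) (at r within {s..t})"
      by (rule integral_has_real_derivative[OF _ that]) (intro continuous_intros u a)
    from DERIV_add[OF DERIV_const[of c] this] show ?thesis
      unfolding U_def[abs_def] by simp
  qed
  have dA: "(A has_real_derivative a r) (at r within {s..t})" if "r \<in> {s..t}" for r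
    unfolding A_def[abs_def] by (rule integral_has_real_derivative[OF a that])
  have A0: "0 \<le> A r" if "r \<in> {s..t}" for r
    unfolding A_def
    by (rule integral_nonneg) (use that a0 in \<open>auto intro!: integrable_continuous_real continuous_on_subset[OF a]\<close>)
  have dW: "(W has_real_derivative exp (- A r) * (a r * u r + B - a r * U r) - B) (at r within {s..t})"
    if "r \<in> {s..t}" for r
    unfolding W_def[abs_def]
    by (rule derivative_eq_intros dU[OF that] dA[OF that] refl)+ (simp add: algebra_simps)
  have cW: "continuous_on {s..t} W"
    by (rule DERIV_continuous_on) (rule dW)
  have "W t \<le> W s"
  proof (rule DERIV_nonpos_imp_decreasing_open[OF st _ cW])
    fix r assume r: "s < r" "r < t"
    have "(W has_real_derivative exp (- A r) * (a r * u r + B - a r * U r) - B) (at r)"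
      using dW[of r] r at_within_interior[of r "{s..t}"] by auto
    moreover have "exp (- A r) * (a r * u r + B - a r * U r) \<le> B"
    proof -
      have "a r * u r \<le> a r * U r"
        using le[of r] a0[of r] r by (intro mult_left_mono) (auto simp: U_def)
      then have "exp (- A r) * (a r * u r + B - a r * U r) \<le> exp (- A r) * B"
        by (intro mult_left_mono) auto
      also have "\<dots> \<le> 1 * B"
        using A0[of r] r B by (intro mult_right_mono) auto
      finally show ?thesis by simp
    qed
    ultimately show "\<exists>y. (W has_real_derivative y) (at r) \<and> y \<le> 0" by (intro exI[of _ "exp (- A r) * (a r * u r + B - a r * U r) - B"]) simp
  qed
  then have "exp (- A t) * U t \<le> c + B * (t - s)"
    by (simp add: W_def U_def A_def algebra_simps)
  then have "exp (A t) * (exp (- A t) * U t) \<le> exp (A t) * (c + B * (t - s))"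
    by (intro mult_left_mono) auto
  moreover have "exp (A t) * (exp (- A t) * U t) = U t" by (simp add: exp_minus)
  ultimately have "U t \<le> exp (A t) * (c + B * (t - s))" by simp
  moreover have "u t \<le> U t" using le[of t] st by (simp add: U_def)
  ultimately show ?thesis by (simp add: A_def mult.commute)
qed

text \<open>The norm of \<open>X\<close> need not be differentiable, so \<open>X'\<close> is
  integrated first and the integral form applies. The rate \<open>a\<close> may vary in time;
  \<open>flow_lipschitz_L1\<close> relies on this to see only the integral of the norm of the
  control.\<close>

lemma gronwall_derivative:
  fixes X :: "real \<Rightarrow> 'a::euclidean_space"
  assumes st: "s \<le> t" and B: "B \<ge> 0" and a: "continuous_on {s..t} a"
    and a0: "\<And>r. r \<in> {s..t} \<Longrightarrow> 0 \<le> a r"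
    and X: "\<And>r. r \<in> {s..t} \<Longrightarrow> (X has_vector_derivative X' r) (at r within {s..t})"
    and le: "\<And>r. r \<in> {s..t} \<Longrightarrow> norm (X' r) \<le> a r * norm (X r) + B"
  shows "norm (X t) \<le> (norm (X s) + B * (t - s)) * exp (integral {s..t} a)"
proof (rule gronwall_integral[OF st B _ a a0])
  have cX: "continuous_on {s..t} X"
    unfolding continuous_on_eq_continuous_within by (intro ballI has_vector_derivative_continuous[OF X])
  then show "continuous_on {s..t} (\<lambda>r. norm (X r))" by (intro continuous_intros)
  fix r assume r: "r \<in> {s..t}"
  have i1: "(X' has_integral (X r - X s)) {s..r}"
  proof (rule fundamental_theorem_of_calculus)
    fix x assume x: "x \<in> {s..r}"
    show "(X has_vector_derivative X' x) (at x within {s..r})"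
      by (rule has_vector_derivative_within_subset[OF X]) (use x r in auto)
  qed (use r in simp)
  have i2: "(\<lambda>x. a x * norm (X x) + B) integrable_on {s..r}"
    by (intro integrable_continuous_real continuous_intros continuous_on_subset[OF a]
        continuous_on_subset[OF cX]) (use r in auto)
  have "norm (integral {s..r} X') \<le> integral {s..r} (\<lambda>x. a x * norm (X x) + B)"
    by (rule integral_norm_bound_integral[OF _ i2]) (use i1 le r in auto)
  then have "norm (X r - X s) \<le> integral {s..r} (\<lambda>x. a x * norm (X x) + B)"
    using integral_unique[OF i1] by simp
  then show "norm (X r) \<le> norm (X s) + integral {s..r} (\<lambda>x. a x * norm (X x) + B)"
    using norm_triangle_sub[of "X r" "X s"] by linarith
qed

lemma gronwall_const:
  fixes X :: "real \<Rightarrow> 'a::euclidean_space"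
  assumes st: "s \<le> t" and B: "B \<ge> 0" and L: "L \<ge> 0"
    and X: "\<And>r. r \<in> {s..t} \<Longrightarrow> (X has_vector_derivative X' r) (at r within {s..t})"
    and le: "\<And>r. r \<in> {s..t} \<Longrightarrow> norm (X' r) \<le> L * norm (X r) + B"
  shows "norm (X t) \<le> (norm (X s) + B * (t - s)) * exp (L * (t - s))"
  using gronwall_derivative[OF st B, of "\<lambda>_. L" X X'] L X le st
  by (simp add: mult.commute)

section \<open>The flow of a globally Lipschitz field\<close>

definition ode_sol :: "(real \<Rightarrow> 'a::euclidean_space \<Rightarrow> 'a) \<Rightarrow> real \<Rightarrow> real \<Rightarrow> (real \<Rightarrow> 'a) \<Rightarrow> bool" where
  "ode_sol v t r X \<longleftrightarrow> (\<forall>s\<in>{t..r}. (X has_vector_derivative v s (X s)) (at s within {t..r}))"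

text \<open>Meaningful only for \<open>t \<le> r\<close>: otherwise the interval is empty, every
  function solves the equation and the description is unspecified. This is why \<open>dual\<close>
  clamps its starting time.\<close>

definition ode_flow :: "(real \<Rightarrow> 'a::euclidean_space \<Rightarrow> 'a) \<Rightarrow> real \<Rightarrow> real \<Rightarrow> 'a \<Rightarrow> 'a" where
  "ode_flow v t r z = (THE y. \<exists>X. ode_sol v t r X \<and> X t = z \<and> X r = y)"

locale lipschitz_field =
  fixes v :: "real \<Rightarrow> 'a::euclidean_space \<Rightarrow> 'a" and L :: real
  assumes cont: "continuous_on UNIV (\<lambda>(t, z). v t z)"
    and lip: "norm (v t x - v t y) \<le> L * norm (x - y)"
begin

lemma cont': "continuous_on S f \<Longrightarrow> continuous_on S g \<Longrightarrow> continuous_on S (\<lambda>s. v (f s) (g s))"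
  using continuous_on_compose2[OF cont, of S "\<lambda>s. (f s, g s)"] by (auto intro!: continuous_on_Pair)

lemma L_nonneg: "0 \<le> L"
proof -
  obtain i :: 'a where i: "i \<in> Basis" using nonempty_Basis by (metis ex_in_conv)
  have "0 \<le> L * norm (i - 0)" by (rule order_trans[OF norm_ge_zero lip])
  then show ?thesis using i by simp
qed

text \<open>Gronwall for the difference of two solutions. Equal initial values give uniqueness,
  different ones the Lipschitz dependence of the flow on its starting point.\<close>

lemma ode_sol_unique:
  assumes X: "ode_sol v t r X" and Y: "ode_sol v t r Y" and tr: "t \<le> r"
  shows "norm (X r - Y r) \<le> norm (X t - Y t) * exp (L * (r - t))"
proof -
  have "((\<lambda>s. X s - Y s) has_vector_derivative v s (X s) - v s (Y s)) (at s within {t..r})"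
    if "s \<in> {t..r}" for s
    using X Y that unfolding ode_sol_def by (intro has_vector_derivative_diff) auto
  from gronwall_const[OF tr _ L_nonneg this, of 0] lip show ?thesis by simp
qed

text \<open>Picard iteration in an exponentially weighted supremum norm. The unknown is the solution
  times exp(- M (s - t)); for it the Picard map contracts by \<open>L / M\<close> on the whole
  interval, whatever its length, so no local solutions have to be glued.\<close>

lemma ode_sol_exists:
  assumes tr: "t \<le> r"
  shows "\<exists>X. ode_sol v t r X \<and> X t = z"
proof -
  \<comment> \<open>Any M above L makes the ratio \<open>L / M\<close> less than 1;
    \<open>L + 1\<close> is also positive when L is 0.\<close>
  define M where "M = L + 1"
  have M: "M > 0" using L_nonneg by (simp add: M_def)
  \<comment> \<open>Freezing time outside the interval turns functions on it into bounded continuous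
    functions on the line, which form a complete space.\<close>
  define c where "c s = max t (min r s)" for s
  have c: "c s \<in> {t..r}" for s using tr by (auto simp: c_def)
  have cc: "continuous_on S c" for S unfolding c_def[abs_def] by (intro continuous_intros)
  define G where "G Y s = exp (- M * (s - t)) *\<^sub>R (z + integral {t..s} (\<lambda>q. v q (exp (M * (q - t)) *\<^sub>R apply_bcontfun Y q)))"
    for Y :: "real \<Rightarrow>\<^sub>C 'a" and s
  define P where "P Y = Bcontfun (\<lambda>s. G Y (c s))" for Y
  have ci: "continuous_on {t..r} (\<lambda>q. v q (exp (M * (q - t)) *\<^sub>R apply_bcontfun Y q))" for Y :: "real \<Rightarrow>\<^sub>C 'a"
    by (intro cont' continuous_intros continuous_on_apply_bcontfun)
  have cG: "continuous_on {t..r} (G Y)" for Y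
    unfolding G_def[abs_def]
    by (intro continuous_intros indefinite_integral_continuous_1 integrable_continuous_real ci)
  have cGc: "continuous_on UNIV (\<lambda>s. G Y (c s))" for Y
    by (rule continuous_on_compose2[OF cG cc]) (use c in auto)
  have bG: "(\<lambda>s. G Y (c s)) \<in> bcontfun" for Y
  proof -
    have "bounded (G Y ` {t..r})"
      by (intro compact_imp_bounded compact_continuous_image cG) auto
    then obtain b where b: "\<forall>y\<in>G Y ` {t..r}. norm y \<le> b" unfolding bounded_iff by (elim exE)
    show ?thesis by (rule bcontfun_normI[OF cGc, of Y b]) (use b c[of _] in auto)
  qed
  have P: "apply_bcontfun (P Y) s = G Y (c s)" for Y s
    unfolding P_def using Bcontfun_inverse[OF bG] by simp
  have "\<exists>!Y. P Y = Y"
  proof (rule banach_fix_type)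
    show "0 \<le> L / M" using L_nonneg M by simp
    show "L / M < 1" using M by (simp add: M_def)
    have "dist (P Y) (P Y') \<le> L / M * dist Y Y'" for Y Y'
    proof (rule dist_bound)
      fix s
      let ?D = "dist Y Y'"
      let ?f = "\<lambda>Y q. v q (exp (M * (q - t)) *\<^sub>R apply_bcontfun Y q)"
      have cs: "t \<le> c s" "c s \<le> r" using c[of s] by auto
      have int: "?f Y integrable_on {t..c s}" for Y
        by (rule integrable_continuous_real, rule continuous_on_subset[OF ci]) (use cs in auto)
      \<comment> \<open>Integrating the weight reproduces it divided by M; this is where the
        contraction gains its denominator.\<close>
      have hi: "((\<lambda>q. L * ?D * exp (M * (q - t))) has_integral
         (L * ?D * exp (M * (c s - t)) / M - L * ?D * exp (M * (t - t)) / M)) {t..c s}"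
        using M cs(1) by (intro fundamental_theorem_of_calculus)
          (auto intro!: derivative_eq_intros simp: has_real_derivative_iff_has_vector_derivative[symmetric])
      have "norm (integral {t..c s} (\<lambda>q. ?f Y q - ?f Y' q)) \<le> integral {t..c s} (\<lambda>q. L * ?D * exp (M * (q - t)))"
      proof (rule integral_norm_bound_integral)
        show "(\<lambda>q. ?f Y q - ?f Y' q) integrable_on {t..c s}" by (intro integrable_diff int)
        show "(\<lambda>q. L * ?D * exp (M * (q - t))) integrable_on {t..c s}" using hi by blast
        fix q
        have "norm (?f Y q - ?f Y' q) \<le> L * norm (exp (M * (q - t)) *\<^sub>R apply_bcontfun Y q - exp (M * (q - t)) *\<^sub>R apply_bcontfun Y' q)"
          by (rule lip)
        also have "\<dots> = L * (exp (M * (q - t)) * dist (apply_bcontfun Y q) (apply_bcontfun Y' q))"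
          by (simp add: scaleR_diff_right[symmetric] dist_norm)
        also have "\<dots> \<le> L * (exp (M * (q - t)) * ?D)"
          by (intro mult_left_mono dist_bounded L_nonneg) auto
        finally show "norm (?f Y q - ?f Y' q) \<le> L * ?D * exp (M * (q - t))" by (simp add: mult_ac)
      qed
      also have "\<dots> = L * ?D * exp (M * (c s - t)) / M - L * ?D / M"
        using integral_unique[OF hi] by simp
      also have "\<dots> \<le> L * ?D * exp (M * (c s - t)) / M"
        using M L_nonneg by simp
      finally have *: "norm (integral {t..c s} (\<lambda>q. ?f Y q - ?f Y' q)) \<le> L * ?D * exp (M * (c s - t)) / M" .
      have "dist (P Y s) (P Y' s) = exp (- M * (c s - t)) * norm (integral {t..c s} (\<lambda>q. ?f Y q - ?f Y' q))"
        unfolding P G_def dist_norm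
        by (simp add: scaleR_diff_right[symmetric] integral_diff int)
      also have "\<dots> \<le> exp (- M * (c s - t)) * (L * ?D * exp (M * (c s - t)) / M)"
        by (intro mult_left_mono *) auto
      also have "\<dots> = L / M * ?D * (exp (- M * (c s - t)) * exp (M * (c s - t)))"
        by (simp add: mult_ac)
      also have "\<dots> = L / M * ?D"
        by (simp add: mult_exp_exp)
      finally show "dist (P Y s) (P Y' s) \<le> L / M * ?D" .
    qed
    then show "\<forall>x y. dist (P x) (P y) \<le> L / M * dist x y" by blast
  qed
  then obtain Y where Y: "P Y = Y" by blast
  define X where "X s = exp (M * (s - t)) *\<^sub>R apply_bcontfun Y s" for s
  have X: "X s = z + integral {t..s} (\<lambda>q. v q (X q))" if "s \<in> {t..r}" for s
  proof -
    have "c s = s" using that by (auto simp: c_def)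
    then have "apply_bcontfun Y s = G Y s" using P[of Y s] Y by simp
    then show ?thesis unfolding X_def G_def by (simp add: exp_minus)
  qed
  have "ode_sol v t r X"
    unfolding ode_sol_def
  proof
    fix s assume s: "s \<in> {t..r}"
    have "((\<lambda>s. integral {t..s} (\<lambda>q. v q (X q))) has_vector_derivative v s (X s)) (at s within {t..r})"
      by (rule integral_has_vector_derivative[OF _ s]) (use ci[of Y] in \<open>simp add: X_def\<close>)
    then have "((\<lambda>s. z + integral {t..s} (\<lambda>q. v q (X q))) has_vector_derivative v s (X s)) (at s within {t..r})"
      by (auto intro!: derivative_eq_intros)
    then show "(X has_vector_derivative v s (X s)) (at s within {t..r})"
      by (rule has_vector_derivative_transform[OF s, rotated]) (rule X)
  qed
  moreover have "X t = z" using X[of t] tr by simp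
  ultimately show ?thesis by blast
qed

lemma ode_flow_eq:
  assumes "ode_sol v t r X" "t \<le> r"
  shows "ode_flow v t r (X t) = X r"
  unfolding ode_flow_def
proof (rule the_equality)
  show "\<exists>Y. ode_sol v t r Y \<and> Y t = X t \<and> Y r = X r" using assms by blast
  fix y assume "\<exists>Y. ode_sol v t r Y \<and> Y t = X t \<and> Y r = y"
  then show "y = X r" using ode_sol_unique[OF assms(1) _ assms(2)] by fastforce
qed

lemma ode_sol_subinterval: "ode_sol v t r X \<Longrightarrow> t \<le> t' \<Longrightarrow> r' \<le> r \<Longrightarrow> ode_sol v t' r' X"
  by (force simp: ode_sol_def intro: has_vector_derivative_within_subset)

lemma ode_sol_flow:
  assumes "t \<le> r"
  shows "ode_sol v t r (\<lambda>s. ode_flow v t s z)"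
proof -
  obtain X where X: "ode_sol v t r X" "X t = z" using ode_sol_exists[OF assms] by blast
  have eq: "ode_flow v t s z = X s" if "s \<in> {t..r}" for s
    using ode_flow_eq[OF ode_sol_subinterval[OF X(1), of t s]] that X(2) by auto
  show ?thesis
    unfolding ode_sol_def
  proof
    fix s assume s: "s \<in> {t..r}"
    show "((\<lambda>s. ode_flow v t s z) has_vector_derivative v s (ode_flow v t s z)) (at s within {t..r})"
      using X(1) s unfolding ode_sol_def eq[OF s]
      by (intro has_vector_derivative_transform[OF s eq]) auto
  qed
qed

lemma ode_flow_refl [simp]: "ode_flow v t t z = z"
  using ode_sol_exists[of t t z] ode_flow_eq[of t t] by auto

lemma ode_flow_flow:
  assumes "t \<le> s" "s \<le> r"
  shows "ode_flow v s r (ode_flow v t s z) = ode_flow v t r z"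
  using ode_flow_eq[OF ode_sol_subinterval[OF ode_sol_flow[of t r z], of s r]] assms by auto

lemma ode_flow_lipschitz:
  assumes "t \<le> r"
  shows "norm (ode_flow v t r x - ode_flow v t r y) \<le> exp (L * (r - t)) * norm (x - y)"
  using ode_sol_unique[OF ode_sol_flow[OF assms] ode_sol_flow[OF assms] assms, of x y] by (simp add: mult.commute)

lemma ode_flow_has_vector_derivative:
  "s \<in> {t..r} \<Longrightarrow> ((\<lambda>s. ode_flow v t s z) has_vector_derivative v s (ode_flow v t s z)) (at s within {t..r})"
  using ode_sol_flow[of t r z] unfolding ode_sol_def by auto

lemma ode_flow_displacement:
  assumes tr: "t \<le> r" and B: "\<And>q. q \<in> {t..r} \<Longrightarrow> norm (v q z) \<le> B"
  shows "norm (ode_flow v t r z - z) \<le> B * (r - t) * exp (L * (r - t))"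
proof -
  have B0: "B \<ge> 0" using order_trans[OF norm_ge_zero B[of t]] tr by simp
  have d: "((\<lambda>s. ode_flow v t s z - z) has_vector_derivative v s (ode_flow v t s z)) (at s within {t..r})"
    if "s \<in> {t..r}" for s
    using has_vector_derivative_diff[OF ode_flow_has_vector_derivative[OF that] has_vector_derivative_const, of z z] by simp
  have "norm (v q (ode_flow v t q z)) \<le> L * norm (ode_flow v t q z - z) + B" if "q \<in> {t..r}" for q
    using lip[of q "ode_flow v t q z" z] B[OF that] norm_triangle_sub[of "v q (ode_flow v t q z)" "v q z"] by linarith
  from gronwall_const[OF tr B0 L_nonneg d this] show ?thesis by simp
qed

lemma ode_flow_integral:
  assumes "t \<le> r"
  shows "((\<lambda>s. v s (ode_flow v t s z)) has_integral (ode_flow v t r z - z)) {t..r}"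
proof -
  have "((\<lambda>s. v s (ode_flow v t s z)) has_integral (ode_flow v t r z - ode_flow v t t z)) {t..r}"
    by (rule fundamental_theorem_of_calculus[OF assms]) (rule ode_flow_has_vector_derivative)
  then show ?thesis by simp
qed

end

section \<open>Smooth functions and mollification\<close>

lemma bderiv_has_derivative:
  assumes "f differentiable at x"
  shows "(f has_derivative blinfun_apply (bderiv f x)) (at x)"
proof -
  have "(f has_derivative frechet_derivative f (at x)) (at x)"
    using assms by (simp add: frechet_derivative_works)
  then show ?thesis
    unfolding bderiv_def using has_derivative_bounded_linear by (metis bounded_linear_Blinfun_apply)
qed

lemma bderiv_apply:
  "f differentiable at x \<Longrightarrow> blinfun_apply (bderiv f x) = frechet_derivative f (at x)"
  using bderiv_has_derivative frechet_derivative_at by blast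

lemma C_k_differentiable: "C_k (Suc k) f \<Longrightarrow> f differentiable at x"
  by (auto simp: differentiable_on_def)

lemma C_k_SucI:
  assumes "\<And>x. (f has_derivative f' x) (at x)" and "\<And>i. i \<in> Basis \<Longrightarrow> C_k k (\<lambda>x. f' x i)"
  shows "C_k (Suc k) f"
proof -
  have "frechet_derivative f (at x) = f' x" for x
    using frechet_derivative_at[OF assms(1)] by simp
  then show ?thesis
    using assms by (auto simp: differentiable_on_def differentiable_def)
qed

lemma C_k_partial: "C_k (Suc k) f \<Longrightarrow> i \<in> Basis \<Longrightarrow> C_k k (\<lambda>x. frechet_derivative f (at x) i)"
  by simp

lemma C_k_continuous: "C_k k f \<Longrightarrow> continuous_on UNIV f"
  by (cases k) (auto intro: differentiable_imp_continuous_on)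

lemma C_k_continuous_bderiv:
  assumes "C_k (Suc k) f"
  shows "continuous_on UNIV (bderiv f)"
proof (rule continuous_on_blinfun_componentwise)
  show "continuous_on UNIV (\<lambda>x. bderiv f x i)" if "i \<in> Basis" for i
    using assms that by (auto simp: bderiv_apply[OF C_k_differentiable[OF assms]] intro: C_k_continuous)
qed

lemma C_k_Suc_imp: "C_k (Suc k) f \<Longrightarrow> C_k k f"
proof (induction k arbitrary: f)
  case 0
  then show ?case using C_k_continuous by fastforce
next
  case (Suc k)
  then show ?case by (metis C_k.simps(2))
qed

lemma C_k_const [simp]: "C_k k (\<lambda>x. c)"
proof (induction k arbitrary: c)
  case (Suc k)
  show ?case by (rule C_k_SucI[where f' = "\<lambda>_ _. 0"]) (use Suc in auto)
qed simp

lemma C_k_bounded_linear: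
  assumes "bounded_linear f"
  shows "C_k k f"
proof (cases k)
  case 0
  then show ?thesis using assms by (simp add: linear_continuous_on)
next
  case (Suc k)
  show ?thesis unfolding Suc
    by (rule C_k_SucI[where f' = "\<lambda>_. f"]) (auto intro: bounded_linear_imp_has_derivative assms)
qed

lemma C_k_add: "C_k k f \<Longrightarrow> C_k k g \<Longrightarrow> C_k k (\<lambda>x. f x + g x)"
proof (induction k arbitrary: f g)
  case 0
  then show ?case by (auto intro!: continuous_intros)
next
  case (Suc k)
  note d = C_k_differentiable[OF Suc.prems(1)] C_k_differentiable[OF Suc.prems(2)]
  show ?case
  proof (rule C_k_SucI)
    show "((\<lambda>x. f x + g x) has_derivative (\<lambda>i. frechet_derivative f (at x) i + frechet_derivative g (at x) i)) (at x)" for x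
      by (intro has_derivative_add) (use d in \<open>simp_all add: frechet_derivative_works\<close>)
  qed (use Suc in auto)
qed

lemma C_k_mult:
  fixes f g :: "'a::euclidean_space \<Rightarrow> real"
  shows "C_k k f \<Longrightarrow> C_k k g \<Longrightarrow> C_k k (\<lambda>x. f x * g x)"
proof (induction k arbitrary: f g)
  case 0
  then show ?case by (auto intro!: continuous_intros)
next
  case (Suc k)
  note d = C_k_differentiable[OF Suc.prems(1)] C_k_differentiable[OF Suc.prems(2)]
  show ?case
  proof (rule C_k_SucI)
    show "((\<lambda>x. f x * g x) has_derivative
      (\<lambda>i. f x * frechet_derivative g (at x) i + frechet_derivative f (at x) i * g x)) (at x)" for x
      by (intro has_derivative_mult) (use d in \<open>simp_all add: frechet_derivative_works\<close>)
    show "C_k k (\<lambda>x. f x * frechet_derivative g (at x) i + frechet_derivative f (at x) i * g x)"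
      if "i \<in> Basis" for i
      using Suc.prems that by (intro C_k_add Suc.IH C_k_Suc_imp[OF Suc.prems(1)] C_k_Suc_imp[OF Suc.prems(2)]) auto
  qed
qed

text \<open>The outer function comes with the whole sequence \<open>D\<close> of its derivatives:
  the chain rule moves from \<open>D n\<close> to \<open>D (Suc n)\<close>, so the induction on k
  has to cover all n at once.\<close>

lemma C_k_compose_real:
  fixes q :: "'a::euclidean_space \<Rightarrow> real"
  assumes D: "\<And>n x. (D n has_real_derivative D (Suc n) x) (at x)" and q: "\<And>k. C_k k q"
  shows "C_k k (\<lambda>x. D n (q x))"
proof (induction k arbitrary: n)
  case 0
  have "continuous_on UNIV (D n)"
    using D by (intro continuous_at_imp_continuous_on) (blast intro: DERIV_isCont)
  then show ?case
    using C_k_continuous[OF q[of 0]] by (auto intro: continuous_on_compose2)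
next
  case (Suc k)
  have dq: "(q has_derivative frechet_derivative q (at x)) (at x)" for x
    using C_k_differentiable[of 0 q x] q by (simp add: frechet_derivative_works del: C_k.simps)
  show ?case
  proof (rule C_k_SucI)
    show "((\<lambda>x. D n (q x)) has_derivative (\<lambda>i. D (Suc n) (q x) * frechet_derivative q (at x) i)) (at x)" for x
      using has_derivative_compose[OF dq, of "D n" "\<lambda>h. D (Suc n) (q x) * h"] D[of n "q x"]
      by (simp add: has_field_derivative_def)
    show "C_k k (\<lambda>x. D (Suc n) (q x) * frechet_derivative q (at x) i)" if "i \<in> Basis" for i
      using q[of "Suc k"] that by (intro C_k_mult Suc.IH) auto
  qed
qed

section \<open>A smooth function that is flat at the origin\<close>

text \<open>The derivative of p(1/x) exp(-1/x) is (1/x)^2 (p(1/x) - p'(1/x)) exp(-1/x), and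
  \<open>[:0, 0, 1:]\<close> is the square of the variable.\<close>

fun bump_poly :: "nat \<Rightarrow> real poly" where
  "bump_poly 0 = 1"
| "bump_poly (Suc n) = [:0, 0, 1:] * (bump_poly n - pderiv (bump_poly n))"

text \<open>The \<open>n\<close>-th derivative of the smooth function \<open>exp (- 1 / x)\<close>, extended by zero to \<open>x \<le> 0\<close>.\<close>

definition bump :: "nat \<Rightarrow> real \<Rightarrow> real" where
  "bump n x = (if x > 0 then poly (bump_poly n) (1 / x) * exp (- 1 / x) else 0)"

lemma poly_times_exp_tendsto_0: "((\<lambda>x::real. poly p x * exp (- x)) \<longlongrightarrow> 0) at_top"
proof -
  have "((\<lambda>x::real. \<Sum>i\<le>degree p. coeff p i * (x ^ i / exp x)) \<longlongrightarrow> (\<Sum>i\<le>degree p. coeff p i * 0)) at_top"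
    by (intro tendsto_sum tendsto_mult tendsto_const tendsto_power_div_exp_0)
  then show ?thesis
    by (simp add: poly_altdef sum_distrib_right exp_minus divide_inverse mult.assoc)
qed

lemma bump_has_derivative: "(bump n has_real_derivative bump (Suc n) x) (at x)"
proof -
  consider "x > 0" | "x < 0" | "x = 0" by linarith
  then show ?thesis
  proof cases
    case 1
    have "((\<lambda>x. poly (bump_poly n) (1 / x) * exp (- 1 / x)) has_real_derivative bump (Suc n) x) (at x)"
      using 1 by (auto intro!: derivative_eq_intros poly_DERIV[THEN DERIV_chain2]
          simp: bump_def field_simps power2_eq_square)
    then show ?thesis
      by (rule has_field_derivative_transform_within_open[of _ _ _ "{0<..}"]) (use 1 in \<open>auto simp: bump_def\<close>)
  next
    case 2
    have "((\<lambda>x. 0) has_real_derivative bump (Suc n) x) (at x)"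
      using 2 by (auto simp: bump_def)
    then show ?thesis
      by (rule has_field_derivative_transform_within_open[of _ _ _ "{..<0}"]) (use 2 in \<open>auto simp: bump_def\<close>)
  next
    case 3
    have "((\<lambda>y. bump n y / y) \<longlongrightarrow> 0) (at 0)"
    proof (rule filterlim_split_at)
      have "\<forall>\<^sub>F y in at_left 0. bump n y / y = 0"
        by (auto simp: eventually_at_filter bump_def)
      then show "((\<lambda>y. bump n y / y) \<longlongrightarrow> 0) (at_left 0)"
        by (simp add: tendsto_eventually)
      \<comment> \<open>Prefixing the coefficient 0 multiplies the polynomial by 1/y, which accounts
        for the division by y in the difference quotient; the exponential then beats the
        polynomial.\<close>
      have "((\<lambda>y. poly (pCons 0 (bump_poly n)) (inverse y) * exp (- inverse y)) \<longlongrightarrow> 0) (at_right (0::real))"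
        by (rule filterlim_compose[OF poly_times_exp_tendsto_0 filterlim_inverse_at_top_right])
      moreover have "\<forall>\<^sub>F y in at_right 0. poly (pCons 0 (bump_poly n)) (inverse y) * exp (- inverse y) = bump n y / y"
        by (auto simp: eventually_at_filter bump_def field_simps)
      ultimately show "((\<lambda>y. bump n y / y) \<longlongrightarrow> 0) (at_right 0)"
        by (rule Lim_transform_eventually)
    qed
    then show ?thesis
      using 3 by (simp add: has_field_derivative_iff bump_def)
  qed
qed

section \<open>Mollifiers and convolution\<close>

text \<open>The bump exp(-1/(\<epsilon>^2 - |w|^2)), built on the squared norm because that is
  smooth at 0. It is not normalised: the mass is carried as a common factor through the estimates
  and cancelled at the end.\<close>

definition mollifier :: "real \<Rightarrow> 'a::euclidean_space \<Rightarrow> real" where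
  "mollifier \<epsilon> w = bump 0 (\<epsilon>\<^sup>2 - w \<bullet> w)"

definition moll_mass :: "'a::euclidean_space itself \<Rightarrow> real \<Rightarrow> real" where
  "moll_mass _ \<epsilon> = (LINT q|lborel. mollifier \<epsilon> (q::'a))"

lemma C_k_quadratic: "C_k k (\<lambda>w::'a::euclidean_space. c - w \<bullet> w)"
proof (cases k)
  case 0
  then show ?thesis by (auto intro!: continuous_intros)
next
  case (Suc k)
  show ?thesis unfolding Suc
  proof (rule C_k_SucI)
    show "((\<lambda>w::'a. c - w \<bullet> w) has_derivative (\<lambda>h. - (2 * (w \<bullet> h)))) (at w)" for w
      by (auto intro!: derivative_eq_intros simp: inner_commute)
    have "bounded_linear (\<lambda>w. - (2 * (w \<bullet> i)))" for i :: 'a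
      by (intro bounded_linear_minus bounded_linear_const_mult bounded_linear_inner_left)
    then show "C_k k (\<lambda>w::'a. - (2 * (w \<bullet> i)))" for i by (rule C_k_bounded_linear)
  qed
qed

lemma C_k_mollifier: "C_k k (mollifier \<epsilon> :: 'a::euclidean_space \<Rightarrow> real)"
  unfolding mollifier_def[abs_def] by (rule C_k_compose_real[where D = bump]) (rule bump_has_derivative C_k_quadratic)+

lemma continuous_mollifier: "continuous_on UNIV (mollifier \<epsilon>)"
  by (rule C_k_continuous[OF C_k_mollifier])

lemma continuous_mollifier' [continuous_intros]:
  "continuous_on S f \<Longrightarrow> continuous_on S (\<lambda>x. mollifier \<epsilon> (f x))"
  by (rule continuous_on_compose2[OF continuous_mollifier]) auto

lemma mollifier_nonneg [simp]: "0 \<le> mollifier \<epsilon> w"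
  by (simp add: mollifier_def bump_def)

lemma mollifier_minus: "mollifier \<epsilon> (- w) = mollifier \<epsilon> w"
  by (simp add: mollifier_def)

lemma mollifier_zero: "0 \<le> \<epsilon> \<Longrightarrow> \<epsilon> \<le> norm w \<Longrightarrow> mollifier \<epsilon> w = 0"
  using power_mono[of \<epsilon> "norm w" 2] by (simp add: mollifier_def bump_def dot_square_norm not_less)

lemma mollifier_pos: "0 < \<epsilon> \<Longrightarrow> mollifier \<epsilon> 0 > 0"
  by (simp add: mollifier_def bump_def)

lemma integrable_compact_support:
  fixes f :: "'a::euclidean_space \<Rightarrow> real"
  assumes "continuous_on UNIV f" "\<And>x. x \<notin> cball p r \<Longrightarrow> f x = 0"
  shows "integrable lborel f"
proof -
  have "integrable lborel (\<lambda>x. indicator (cball p r) x *\<^sub>R f x)"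
    by (rule borel_integrable_compact) (auto intro: continuous_on_subset[OF assms(1)])
  also have "(\<lambda>x. indicator (cball p r) x *\<^sub>R f x) = f"
    using assms(2) by (auto simp: indicator_def fun_eq_iff)
  finally show ?thesis .
qed

lemma lborel_integral_translate:
  fixes f :: "'a::euclidean_space \<Rightarrow> real"
  assumes "continuous_on UNIV f"
  shows "(LINT q|lborel. f (c + q)) = (LINT q|lborel. f q)"
proof -
  have "(LINT q|lborel. f q) = (LINT q|distr lborel borel ((+) c). f q)"
    by (simp add: lborel_distr_plus)
  also have "\<dots> = (LINT q|lborel. f (c + q))"
    by (rule integral_distr) (auto intro: borel_measurable_continuous_onI assms)
  finally show ?thesis by simp
qed

lemma integrable_mollifier:
  fixes p :: "'a::euclidean_space"
  assumes "continuous_on UNIV f" "0 \<le> \<epsilon>"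
  shows "integrable lborel (\<lambda>q. f q * mollifier \<epsilon> (p - q))"
  by (rule integrable_compact_support[of _ p \<epsilon>])
    (auto intro!: continuous_intros assms mollifier_zero simp: dist_norm assms(2))

lemma integral_mollifier:
  fixes p :: "'a::euclidean_space"
  shows "(LINT q|lborel. mollifier \<epsilon> (p - q)) = moll_mass TYPE('a) \<epsilon>"
proof -
  have "(LINT q|lborel. mollifier \<epsilon> (p - (p + q))) = (LINT q|lborel. mollifier \<epsilon> (p - q))"
    by (rule lborel_integral_translate) (intro continuous_intros)
  then show ?thesis by (simp add: moll_mass_def mollifier_minus)
qed

text \<open>With mass 0 the mollifier would vanish almost everywhere, hence everywhere because its
  zero set is closed; but it is positive at 0.\<close>

lemma moll_mass_pos:
  assumes "0 < \<epsilon>"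
  shows "moll_mass TYPE('a::euclidean_space) \<epsilon> > 0"
proof -
  have int: "integrable lborel (mollifier \<epsilon> :: 'a \<Rightarrow> real)"
    using integrable_mollifier[of "\<lambda>_. 1" \<epsilon> "0::'a"] assms by (simp add: mollifier_minus)
  have "moll_mass TYPE('a) \<epsilon> \<noteq> 0"
  proof
    assume "moll_mass TYPE('a) \<epsilon> = 0"
    then have "AE q::'a in lborel. mollifier \<epsilon> q = 0"
      unfolding moll_mass_def by (subst (asm) integral_nonneg_eq_0_iff_AE[OF int]) auto
    then have "AE q::'a in lebesgue. q \<in> {q. mollifier \<epsilon> q = 0}"
      by (simp add: AE_completion)
    moreover have "closed {q::'a. mollifier \<epsilon> q = 0}"
      by (intro closed_Collect_eq continuous_intros)
    ultimately have "mollifier \<epsilon> (0::'a) = 0"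
      using mem_closed_if_AE_lebesgue by blast
    then show False using mollifier_pos[OF assms, where 'a = 'a] by simp
  qed
  moreover have "moll_mass TYPE('a) \<epsilon> \<ge> 0"
    unfolding moll_mass_def by (rule Bochner_Integration.integral_nonneg) simp
  ultimately show ?thesis by simp
qed

text \<open>A convolution cut off to a box. The compact domain permits differentiation under the
  integral for merely continuous \<phi>, and together with a compactly supported kernel it makes the
  result compactly supported. The kernel is a parameter so that its derivatives can take its
  place.\<close>

definition mollify :: "'a::euclidean_space \<Rightarrow> 'a \<Rightarrow> ('a \<Rightarrow> real) \<Rightarrow> ('a \<Rightarrow> real) \<Rightarrow> 'a \<Rightarrow> real" where
  "mollify a b \<phi> K p = integral (cbox a b) (\<lambda>q. \<phi> q * K (p - q))"

lemma mollify_has_derivative: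
  assumes phi: "continuous_on UNIV \<phi>" and K: "C_k 1 K"
  shows "(mollify a b \<phi> K has_derivative (\<lambda>i. mollify a b \<phi> (\<lambda>x. frechet_derivative K (at x) i) p)) (at p)"
proof -
  have dK: "K differentiable at x" for x using K C_k_differentiable[of 0 K] by (simp del: C_k.simps)
  have cK: "continuous_on UNIV K" by (rule C_k_continuous[OF K])
  have cdK: "continuous_on UNIV (bderiv K)" using C_k_continuous_bderiv[of 0 K] K by (simp del: C_k.simps)
  \<comment> \<open>The Leibniz rule integrates the derivative as a bounded linear map; it is
    evaluated in a direction only afterwards.\<close>
  define fx where "fx p q = \<phi> q *\<^sub>R bderiv K (p - q)" for p q
  have cfx: "continuous_on S (\<lambda>(p, q). fx p q)" for S
    unfolding fx_def split_beta
    by (intro continuous_intros continuous_on_compose2[OF phi] continuous_on_compose2[OF cdK]) auto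
  have cfx': "continuous_on S (fx p)" for S p
    unfolding fx_def[abs_def]
    by (intro continuous_intros continuous_on_compose2[OF phi] continuous_on_compose2[OF cdK]) auto
  have "((\<lambda>p. integral (cbox a b) (\<lambda>q. \<phi> q * K (p - q))) has_derivative integral (cbox a b) (fx p)) (at p within UNIV)"
  proof (rule leibniz_rule)
    fix x t
    have "((\<lambda>x. K (x - t)) has_derivative (\<lambda>h. bderiv K (x - t) h)) (at x within UNIV)"
      using has_derivative_compose[where f = "\<lambda>x. x - t" and f' = "\<lambda>h. h" and x = x and s = UNIV and g = K and g' = "blinfun_apply (bderiv K (x - t))"]
        bderiv_has_derivative[OF dK, of "x - t"] has_derivative_diff[OF has_derivative_ident[of "at x"] has_derivative_const[of t]]
      by simp
    from has_derivative_mult_right[OF this, of "\<phi> t"]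
    show "((\<lambda>x. \<phi> t * K (x - t)) has_derivative blinfun_apply (fx x t)) (at x within UNIV)"
      by (simp add: fx_def scaleR_blinfun.rep_eq)
  next
    show "(\<lambda>q. \<phi> q * K (x - q)) integrable_on cbox a b" for x
      by (intro integrable_continuous continuous_intros continuous_on_compose2[OF phi] continuous_on_compose2[OF cK]) auto
  qed (auto intro: cfx)
  moreover have "blinfun_apply (integral (cbox a b) (fx p)) = (\<lambda>i. mollify a b \<phi> (\<lambda>x. frechet_derivative K (at x) i) p)"
  proof
    fix i
    have "blinfun_apply (integral (cbox a b) (fx p)) i = integral (cbox a b) (\<lambda>q. fx p q i)"
      by (rule blinfun_apply_integral) (intro integrable_continuous cfx')
    then show "blinfun_apply (integral (cbox a b) (fx p)) i = mollify a b \<phi> (\<lambda>x. frechet_derivative K (at x) i) p"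
      by (simp add: mollify_def fx_def scaleR_blinfun.rep_eq bderiv_apply[OF dK])
  qed
  ultimately show ?thesis by (simp add: mollify_def[abs_def])
qed

lemma C_k_mollify:
  assumes "continuous_on UNIV \<phi>" "\<And>k. C_k k K"
  shows "C_k k (mollify a b \<phi> K)"
  using assms(2)
proof (induction k arbitrary: K)
  case 0
  have "isCont (mollify a b \<phi> K) p" for p
    using mollify_has_derivative[OF assms(1) 0] by (rule has_derivative_continuous)
  then show ?case by (simp add: continuous_at_imp_continuous_on)
next
  case (Suc k)
  show ?case
  proof (rule C_k_SucI[OF mollify_has_derivative[OF assms(1) Suc.prems]])
    fix i :: 'a assume "i \<in> Basis"
    then have "C_k k (\<lambda>x. frechet_derivative K (at x) i)" for k
      using Suc.prems[of "Suc k"] by simp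
    then show "C_k k (\<lambda>x. mollify a b \<phi> (\<lambda>x. frechet_derivative K (at x) i) x)"
      by (rule Suc.IH)
  qed
qed

text \<open>The kernel vanishes outside a ball, so the cut-off is invisible once that ball lies in
  the box. The integral over the whole space is wanted for its translation invariance.\<close>

lemma mollify_eq_lborel:
  assumes "continuous_on UNIV \<phi>" "0 \<le> \<epsilon>" "cball p \<epsilon> \<subseteq> cbox a b"
  shows "mollify a b \<phi> (mollifier \<epsilon>) p = (LINT q|lborel. \<phi> q * mollifier \<epsilon> (p - q))"
proof -
  have z: "\<phi> q * mollifier \<epsilon> (p - q) = 0" if "q \<notin> cbox a b" for q
    using assms(3) that mollifier_zero[OF assms(2), of "p - q"] by (force simp: dist_norm)
  have "((\<lambda>q. \<phi> q * mollifier \<epsilon> (p - q)) has_integral (LINT q|lborel. \<phi> q * mollifier \<epsilon> (p - q))) UNIV"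
    by (rule has_integral_integral_lborel[OF integrable_mollifier[OF assms(1,2)]])
  then have "integral UNIV (\<lambda>q. \<phi> q * mollifier \<epsilon> (p - q)) = (LINT q|lborel. \<phi> q * mollifier \<epsilon> (p - q))"
    by (rule integral_unique)
  moreover have "integral UNIV (\<lambda>q. \<phi> q * mollifier \<epsilon> (p - q)) = integral (cbox a b) (\<lambda>q. \<phi> q * mollifier \<epsilon> (p - q))"
  proof -
    have "(\<lambda>q. \<phi> q * mollifier \<epsilon> (p - q)) = (\<lambda>q. if q \<in> cbox a b then \<phi> q * mollifier \<epsilon> (p - q) else 0)"
      using z by auto
    then show ?thesis
      using Henstock_Kurzweil_Integration.integral_restrict_UNIV[of "cbox a b" "\<lambda>q. \<phi> q * mollifier \<epsilon> (p - q)"] by simp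
  qed
  ultimately show ?thesis by (simp add: mollify_def)
qed

lemma mollify_zero:
  assumes "0 \<le> \<epsilon>" "\<And>q. q \<in> cbox a b \<Longrightarrow> \<epsilon> \<le> norm (p - q)"
  shows "mollify a b \<phi> (mollifier \<epsilon>) p = 0"
  unfolding mollify_def using mollifier_zero[OF assms(1) assms(2)] by (simp cong: integral_cong)

lemma weighted_integral_bound:
  fixes p :: "'a::euclidean_space"
  assumes "continuous_on UNIV f" "0 \<le> \<epsilon>" "\<And>q. q \<in> cball p \<epsilon> \<Longrightarrow> \<bar>f q\<bar> \<le> \<omega>"
  shows "\<bar>LINT q|lborel. f q * mollifier \<epsilon> (p - q)\<bar> \<le> \<omega> * moll_mass TYPE('a) \<epsilon>"
proof -
  have i: "integrable lborel (\<lambda>q. \<omega> * mollifier \<epsilon> (p - q))"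
    using integrable_mollifier[of "\<lambda>_. \<omega>" \<epsilon> p] assms(2) by simp
  have "norm (LINT q|lborel. f q * mollifier \<epsilon> (p - q)) \<le> (LINT q|lborel. norm (f q * mollifier \<epsilon> (p - q)))"
    by (rule integral_norm_bound)
  also have "\<dots> \<le> (LINT q|lborel. \<omega> * mollifier \<epsilon> (p - q))"
  proof (rule integral_mono)
    show "integrable lborel (\<lambda>q. norm (f q * mollifier \<epsilon> (p - q)))"
      by (intro integrable_norm integrable_mollifier assms)
    fix q
    show "norm (f q * mollifier \<epsilon> (p - q)) \<le> \<omega> * mollifier \<epsilon> (p - q)"
    proof (cases "q \<in> cball p \<epsilon>")
      case True
      then show ?thesis using assms(3)[of q] by (simp add: abs_mult mult_right_mono)
    next
      case False
      then show ?thesis using mollifier_zero[OF assms(2), of "p - q"] by (simp add: dist_norm)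
    qed
  qed (rule i)
  also have "\<dots> = \<omega> * moll_mass TYPE('a) \<epsilon>" by (simp add: integral_mollifier)
  finally show ?thesis by simp
qed

lemma mollify_close:
  fixes p :: "'a::euclidean_space"
  assumes "continuous_on UNIV \<phi>" "0 \<le> \<epsilon>" "cball p \<epsilon> \<subseteq> cbox a b"
    and "\<And>q. q \<in> cball p \<epsilon> \<Longrightarrow> \<bar>\<phi> q - \<phi> p\<bar> \<le> \<omega>"
  shows "\<bar>mollify a b \<phi> (mollifier \<epsilon>) p - \<phi> p * moll_mass TYPE('a) \<epsilon>\<bar> \<le> \<omega> * moll_mass TYPE('a) \<epsilon>"
proof -
  have "mollify a b \<phi> (mollifier \<epsilon>) p - \<phi> p * moll_mass TYPE('a) \<epsilon>
      = (LINT q|lborel. \<phi> q * mollifier \<epsilon> (p - q)) - (LINT q|lborel. \<phi> p * mollifier \<epsilon> (p - q))"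
    by (simp add: mollify_eq_lborel[OF assms(1-3)] integral_mollifier)
  also have "\<dots> = (LINT q|lborel. \<phi> q * mollifier \<epsilon> (p - q) - \<phi> p * mollifier \<epsilon> (p - q))"
    by (subst Bochner_Integration.integral_diff) (rule integrable_mollifier[OF _ assms(2)] assms continuous_on_const refl)+
  also have "\<dots> = (LINT q|lborel. (\<phi> q - \<phi> p) * mollifier \<epsilon> (p - q))"
    by (simp add: left_diff_distrib)
  also have "\<bar>\<dots>\<bar> \<le> \<omega> * moll_mass TYPE('a) \<epsilon>"
    by (rule weighted_integral_bound) (auto intro!: continuous_intros assms simp: assms(4)[simplified])
  finally show ?thesis .
qed

text \<open>A one-sided bound on the increments of \<open>\<phi>\<close> in direction \<open>V\<close> suffices, because the
  mollification is differentiable.\<close>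

lemma mollify_directional_derivative:
  fixes p V :: "'a::euclidean_space"
  assumes phi: "continuous_on UNIV \<phi>" and e: "0 < \<epsilon>" and box: "cball p (2 * \<epsilon>) \<subseteq> cbox a b"
    and h0: "0 < h0"
    and bd: "\<And>h q. 0 < h \<Longrightarrow> h < h0 \<Longrightarrow> q \<in> cball p \<epsilon> \<Longrightarrow> \<bar>\<phi> (q + h *\<^sub>R V) - \<phi> q\<bar> \<le> h * (\<omega> + C * h)"
  shows "\<bar>frechet_derivative (mollify a b \<phi> (mollifier \<epsilon>)) (at p) V\<bar> \<le> \<omega> * moll_mass TYPE('a) \<epsilon>"
proof -
  let ?\<Phi> = "mollify a b \<phi> (mollifier \<epsilon>)" and ?m = "moll_mass TYPE('a) \<epsilon>"
  have d: "?\<Phi> differentiable at p"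
    using mollify_has_derivative[OF phi C_k_mollifier] differentiable_def by blast
  have "((\<lambda>h. ?\<Phi> (p + h *\<^sub>R V)) has_derivative (\<lambda>h. frechet_derivative ?\<Phi> (at p) (h *\<^sub>R V))) (at 0)"
  proof (rule has_derivative_compose[where f = "\<lambda>h. p + h *\<^sub>R V" and g = ?\<Phi>])
    show "((\<lambda>h. p + h *\<^sub>R V) has_derivative (\<lambda>h. h *\<^sub>R V)) (at 0)"
      by (auto intro!: derivative_eq_intros)
    show "(?\<Phi> has_derivative frechet_derivative ?\<Phi> (at p)) (at (p + 0 *\<^sub>R V))"
      using d by (simp add: frechet_derivative_works)
  qed
  moreover have "(\<lambda>h. frechet_derivative ?\<Phi> (at p) (h *\<^sub>R V)) = (\<lambda>h. h *\<^sub>R frechet_derivative ?\<Phi> (at p) V)"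
    using d linear_cmul[OF linear_frechet_derivative] by blast
  ultimately have "((\<lambda>h. ?\<Phi> (p + h *\<^sub>R V)) has_vector_derivative frechet_derivative ?\<Phi> (at p) V) (at 0)"
    unfolding has_vector_derivative_def by simp
  then have lim: "((\<lambda>h. (?\<Phi> (p + h *\<^sub>R V) - ?\<Phi> p) / h) \<longlongrightarrow> frechet_derivative ?\<Phi> (at p) V) (at_right 0)"
    using tendsto_within_subset[of _ _ 0 UNIV "{0<..}"]
    by (auto simp: has_real_derivative_iff_has_vector_derivative[symmetric] has_field_derivative_iff)
  \<comment> \<open>For shorter steps the shift by \<open>h *\<^sub>R V\<close> has norm at most
    \<epsilon>, and the ball around the shifted point stays in the ball of radius 2 \<epsilon>,
    where the box cut-off is not felt.\<close>
  define h1 where "h1 = min h0 (\<epsilon> / (1 + norm V))"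
  have h1: "h1 > 0" using h0 e by (auto simp: h1_def add_pos_nonneg)
  have bound: "\<bar>(?\<Phi> (p + h *\<^sub>R V) - ?\<Phi> p) / h\<bar> \<le> (\<omega> + C * h) * ?m" if h: "0 < h" "h < h1" for h
  proof -
    have hV: "norm (h *\<^sub>R V) \<le> \<epsilon>"
    proof -
      have "h * norm V \<le> \<epsilon> / (1 + norm V) * (1 + norm V)"
        using h e by (intro mult_mono) (auto simp: h1_def)
      also have "\<dots> = \<epsilon>" by (simp add: add_nonneg_eq_0_iff add.commute)
      finally show ?thesis using h by simp
    qed
    have "cball (p + h *\<^sub>R V) \<epsilon> \<subseteq> cball p (2 * \<epsilon>)"
      using hV by (intro cball_subset_cball_iff[THEN iffD2]) (auto simp: dist_norm)
    then have "?\<Phi> (p + h *\<^sub>R V) = (LINT q|lborel. \<phi> q * mollifier \<epsilon> (p + h *\<^sub>R V - q))"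
      using e box by (intro mollify_eq_lborel phi) auto
    \<comment> \<open>Translation moves the shift from the kernel to \<phi>, where the bound on
      increments applies.\<close>
    also have "\<dots> = (LINT q|lborel. \<phi> (h *\<^sub>R V + q) * mollifier \<epsilon> (p + h *\<^sub>R V - (h *\<^sub>R V + q)))"
      by (rule lborel_integral_translate[symmetric])
        (intro continuous_intros continuous_on_compose2[OF phi], auto)
    finally have 1: "?\<Phi> (p + h *\<^sub>R V) = (LINT q|lborel. \<phi> (q + h *\<^sub>R V) * mollifier \<epsilon> (p - q))"
      by (simp add: algebra_simps)
    have "cball p \<epsilon> \<subseteq> cball p (2 * \<epsilon>)" using e by (intro subset_cball) simp
    then have 2: "?\<Phi> p = (LINT q|lborel. \<phi> q * mollifier \<epsilon> (p - q))"
      using e box by (intro mollify_eq_lborel phi) auto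
    have c2: "continuous_on UNIV (\<lambda>q. \<phi> (q + h *\<^sub>R V))"
      by (intro continuous_on_compose2[OF phi] continuous_intros) auto
    have "?\<Phi> (p + h *\<^sub>R V) - ?\<Phi> p = (LINT q|lborel. (\<phi> (q + h *\<^sub>R V) - \<phi> q) * mollifier \<epsilon> (p - q))"
      unfolding 1 2 left_diff_distrib
      by (rule Bochner_Integration.integral_diff[symmetric]) (auto intro!: integrable_mollifier c2 phi less_imp_le e)
    also have "\<bar>\<dots>\<bar> \<le> h * (\<omega> + C * h) * ?m"
      by (rule weighted_integral_bound) (use h e bd in \<open>auto intro!: continuous_intros c2 phi simp: h1_def\<close>)
    finally have "\<bar>?\<Phi> (p + h *\<^sub>R V) - ?\<Phi> p\<bar> \<le> h * ((\<omega> + C * h) * ?m)" by (simp add: mult.assoc)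
    then show ?thesis using h by (simp add: abs_divide divide_le_eq mult.commute)
  qed
  \<comment> \<open>The term with C disappears in the limit. Hence C may depend on the point and on
    the direction without affecting the result.\<close>
  have "((\<lambda>h. (\<omega> + C * h) * ?m) \<longlongrightarrow> (\<omega> + C * 0) * ?m) (at_right 0)"
    by (intro tendsto_intros)
  moreover have "((\<lambda>h. \<bar>(?\<Phi> (p + h *\<^sub>R V) - ?\<Phi> p) / h\<bar>) \<longlongrightarrow> \<bar>frechet_derivative ?\<Phi> (at p) V\<bar>) (at_right 0)"
    by (intro tendsto_rabs lim)
  moreover have "\<forall>\<^sub>F h in at_right 0. \<bar>(?\<Phi> (p + h *\<^sub>R V) - ?\<Phi> p) / h\<bar> \<le> (\<omega> + C * h) * ?m"
    using eventually_at_right_less[of 0] eventually_at_right_real[OF h1]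
    by eventually_elim (use bound in auto)
  ultimately show ?thesis
    using tendsto_le[OF trivial_limit_at_right_real] by fastforce
qed

section \<open>Measures, couplings and the Wasserstein distance\<close>

text \<open>In the nonintegrable case the integral has the default value 0, which satisfies the
  bound because B is nonnegative.\<close>

lemma prob_integral_norm_le:
  fixes f :: "'a \<Rightarrow> 'b::{banach, second_countable_topology}"
  assumes "prob_space \<mu>" and ae: "AE z in \<mu>. norm (f z) \<le> B" and B: "B \<ge> 0"
  shows "norm (LINT z|\<mu>. f z) \<le> B"
proof (cases "integrable \<mu> f")
  case True
  interpret prob_space \<mu> by fact
  have "norm (LINT z|\<mu>. f z) \<le> (LINT z|\<mu>. norm (f z))" by (rule integral_norm_bound)
  also have "\<dots> \<le> (LINT z|\<mu>. B)" by (rule integral_mono_AE) (use True ae in auto)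
  finally show ?thesis by (simp add: prob_space)
next
  case False
  then show ?thesis using B by (simp add: not_integrable_integral_eq)
qed

text \<open>Every point outside the support has a null neighbourhood and therefore lies in a null
  member of a countable basis; countably many null sets have a null union.\<close>

lemma AE_measure_supp:
  fixes \<mu> :: "'a::second_countable_topology measure"
  assumes "sets \<mu> = sets borel"
  shows "AE x in \<mu>. x \<in> measure_supp \<mu>"
proof -
  obtain B :: "'a set set" where B: "countable B" "topological_basis B"
    using ex_countable_basis by blast
  let ?N = "\<Union>{b\<in>B. emeasure \<mu> b = 0}"
  have N: "?N \<in> null_sets \<mu>"
  proof (rule null_sets_UN'[where N = "\<lambda>b. b", simplified])
    show "countable {b \<in> B. emeasure \<mu> b = 0}" using B(1) by simp
    show "b \<in> null_sets \<mu>" if "b \<in> {b \<in> B. emeasure \<mu> b = 0}" for b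
      using that topological_basis_open[OF B(2), of b] assms by auto
  qed
  have "{x \<in> space \<mu>. x \<notin> measure_supp \<mu>} \<subseteq> ?N"
  proof
    fix x assume "x \<in> {x \<in> space \<mu>. x \<notin> measure_supp \<mu>}"
    then obtain U where U: "open U" "x \<in> U" "emeasure \<mu> U = 0"
      by (auto simp: measure_supp_def)
    obtain b where b: "b \<in> B" "x \<in> b" "b \<subseteq> U" using topological_basisE[OF B(2) U(1,2)] .
    have "emeasure \<mu> b \<le> emeasure \<mu> U"
      by (rule emeasure_mono[OF b(3)]) (simp add: assms U(1))
    then show "x \<in> ?N" using b U(3) by auto
  qed
  then show ?thesis by (rule AE_I'[OF N])
qed

lemma measure_supp_subset_closed:
  assumes "closed C" "emeasure \<mu> (- C) = 0"
  shows "measure_supp \<mu> \<subseteq> C"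
  using assms by (force simp: measure_supp_def open_Compl)

lemma P_cD:
  assumes "\<mu> \<in> P_c"
  shows "sets \<mu> = sets borel" "prob_space \<mu>" "space \<mu> = UNIV"
  using assms sets_eq_imp_space_eq[of \<mu> borel] by (auto simp: P_c_def)

text \<open>An empirical measure is the image of the uniform distribution on the indices, so that
  integrals and images reduce to those of a finite distribution.\<close>

lemma empirical_eq_distr:
  assumes "N \<ge> 1"
  shows "empirical N Z = distr (measure_pmf (pmf_of_set {..<N})) borel Z"
proof (rule measure_eqI)
  fix A assume "A \<in> sets (empirical N Z)"
  then have A: "A \<in> sets borel" by simp
  have ne: "{..<N} \<noteq> {}" using assms by (simp add: lessThan_empty_iff)
  have "emeasure (distr (measure_pmf (pmf_of_set {..<N})) borel Z) A = ennreal (real (card ({..<N} \<inter> Z -` A)) / real N)"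
    using A ne by (simp add: emeasure_distr emeasure_pmf_of_set)
  also have "\<dots> = of_nat (card ({..<N} \<inter> Z -` A)) / of_nat N"
    using assms by (simp add: divide_ennreal[symmetric] ennreal_of_nat_eq_real_of_nat)
  also have "of_nat (card ({..<N} \<inter> Z -` A)) = (\<Sum>i<N. indicator A (Z i) :: ennreal)"
    by (simp add: indicator_def sum.If_cases Int_def vimage_def)
  finally show "emeasure (empirical N Z) A = emeasure (distr (measure_pmf (pmf_of_set {..<N})) borel Z) A"
    by (simp add: emeasure_empirical[OF A])
qed simp

lemma integral_empirical:
  fixes f :: "'a::euclidean_space \<Rightarrow> real"
  assumes "N \<ge> 1" "f \<in> borel_measurable borel"
  shows "(LINT z|empirical N Z. f z) = 1 / real N * (\<Sum>i<N. f (Z i))"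
proof -
  have "{..<N} \<noteq> {}" using assms by (simp add: lessThan_empty_iff)
  then have "(LINT i|measure_pmf (pmf_of_set {..<N}). f (Z i)) = (\<Sum>i<N. f (Z i)) / real N"
    by (subst integral_pmf_of_set) auto
  then show ?thesis
    unfolding empirical_eq_distr[OF assms(1)] by (subst integral_distr) (auto simp: assms)
qed

lemma distr_empirical:
  assumes "f \<in> borel_measurable borel" "N \<ge> 1"
  shows "distr (empirical N Z) borel f = empirical N (\<lambda>i. f (Z i))"
  unfolding empirical_eq_distr[OF assms(2)] using assms(1)
  by (subst distr_distr) (auto simp: o_def)

lemma measure_supp_empirical:
  assumes "closed C" "\<And>i. i < N \<Longrightarrow> Z i \<in> C"
  shows "measure_supp (empirical N Z) \<subseteq> C"
proof (rule measure_supp_subset_closed[OF assms(1)])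
  show "emeasure (empirical N Z) (- C) = 0"
    using assms by (subst emeasure_empirical) auto
qed

text \<open>Lets a statement about the support be evaluated at every single atom, which an
  almost-everywhere statement does not directly offer.\<close>

lemma atom_in_measure_supp:
  assumes "i < N"
  shows "Z i \<in> measure_supp (empirical N Z)"
  unfolding measure_supp_def
proof (intro CollectI allI impI)
  fix U assume U: "open U" "Z i \<in> U"
  have "(1::ennreal) = indicator U (Z i)" using U by simp
  also have "\<dots> \<le> (\<Sum>i<N. indicator U (Z i))" using assms by (intro member_le_sum) auto
  finally have "(\<Sum>i<N. indicator U (Z i) :: ennreal) \<noteq> 0" by (metis not_one_le_zero)
  then show "0 < emeasure (empirical N Z) U"
    using U by (subst emeasure_empirical) (auto simp: ennreal_zero_less_divide zero_less_iff_neq_zero)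
qed

section \<open>Couplings and integrals\<close>

lemma couplingsD:
  assumes "\<gamma> \<in> couplings \<mu> \<nu>" "sets \<mu> = sets borel" "prob_space \<mu>" "sets \<nu> = sets borel"
  shows "prob_space \<gamma>" "fst \<in> borel_measurable \<gamma>" "snd \<in> borel_measurable \<gamma>"
    and "\<And>P. (AE x in \<mu>. P x) \<Longrightarrow> (AE p in \<gamma>. P (fst p))"
    and "\<And>P. (AE x in \<nu>. P x) \<Longrightarrow> (AE p in \<gamma>. P (snd p))"
proof -
  have s: "sets \<gamma> = sets borel" and d: "distr \<gamma> borel fst = \<mu>" "distr \<gamma> borel snd = \<nu>"
    using assms(1) by (auto simp: couplings_def)
  have "(fst :: 'a \<times> 'a \<Rightarrow> 'a) \<in> borel_measurable borel" "(snd :: 'a \<times> 'a \<Rightarrow> 'a) \<in> borel_measurable borel"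
    by (auto intro!: borel_measurable_continuous_onI continuous_intros)
  then show m: "fst \<in> borel_measurable \<gamma>" "snd \<in> borel_measurable \<gamma>"
    by (simp_all add: measurable_cong_sets[OF s refl])
  show "prob_space \<gamma>" by (rule prob_space_distrD[OF m(1)]) (simp add: d assms)
  show "AE p in \<gamma>. P (fst p)" if "AE x in \<mu>. P x" for P
    by (rule AE_distrD[OF m(1)], unfold d, rule that)
  show "AE p in \<gamma>. P (snd p)" if "AE x in \<nu>. P x" for P
    by (rule AE_distrD[OF m(2)], unfold d, rule that)
qed

text \<open>Both integrals are pulled back to the coupling. The integrands may differ because two
  solutions come with two flows and two gradients: \<open>e\<close> measures how far they are apart
  at a common point, C their dependence on the point.\<close>

lemma coupling_integral_diff:
  fixes f g :: "'a::euclidean_space \<Rightarrow> 'b::{banach, second_countable_topology}"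
  assumes g: "\<gamma> \<in> couplings \<mu> \<nu>" and mu: "sets \<mu> = sets borel" "prob_space \<mu>" and nu: "sets \<nu> = sets borel"
    and int: "integrable \<mu> f" "integrable \<nu> g"
    and A: "AE x in \<mu>. x \<in> A" "AE x in \<nu>. x \<in> A"
    and e: "0 \<le> e" "0 \<le> C" and le: "\<And>x y. x \<in> A \<Longrightarrow> y \<in> A \<Longrightarrow> norm (f x - g y) \<le> e + C * dist x y"
  shows "ennreal (norm ((LINT x|\<mu>. f x) - (LINT y|\<nu>. g y)))
    \<le> ennreal e + ennreal C * (\<integral>\<^sup>+z. ennreal (dist (fst z) (snd z)) \<partial>\<gamma>)"
proof -
  note c = couplingsD[OF g mu nu]
  interpret prob_space \<gamma> by (rule c(1))
  have d: "distr \<gamma> borel fst = \<mu>" "distr \<gamma> borel snd = \<nu>"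
    using g by (auto simp: couplings_def)
  have fm: "f \<in> borel_measurable borel" "g \<in> borel_measurable borel"
    using borel_measurable_integrable[OF int(1)] borel_measurable_integrable[OF int(2)]
    by (simp_all add: measurable_cong_sets[OF mu(1) refl] measurable_cong_sets[OF nu refl])
  have i1: "integrable \<gamma> (\<lambda>p. f (fst p))" "(LINT x|\<mu>. f x) = (LINT p|\<gamma>. f (fst p))"
    using integrable_distr_eq[OF c(2) fm(1)] integral_distr[OF c(2) fm(1)] int(1) unfolding d by auto
  have i2: "integrable \<gamma> (\<lambda>p. g (snd p))" "(LINT x|\<nu>. g x) = (LINT p|\<gamma>. g (snd p))"
    using integrable_distr_eq[OF c(3) fm(2)] integral_distr[OF c(3) fm(2)] int(2) unfolding d by auto
  have "ennreal (norm ((LINT x|\<mu>. f x) - (LINT y|\<nu>. g y))) = ennreal (norm (LINT p|\<gamma>. f (fst p) - g (snd p)))"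
    unfolding i1(2) i2(2) by (simp add: Bochner_Integration.integral_diff[OF i1(1) i2(1)])
  also have "\<dots> \<le> (\<integral>\<^sup>+p. norm (f (fst p) - g (snd p)) \<partial>\<gamma>)"
    by (rule integral_norm_bound_ennreal) (intro Bochner_Integration.integrable_diff i1 i2)
  also have "\<dots> \<le> (\<integral>\<^sup>+p. ennreal e + ennreal C * ennreal (dist (fst p) (snd p)) \<partial>\<gamma>)"
  proof (rule nn_integral_mono_AE)
    show "AE p in \<gamma>. ennreal (norm (f (fst p) - g (snd p))) \<le> ennreal e + ennreal C * ennreal (dist (fst p) (snd p))"
      using c(4)[OF A(1)] c(5)[OF A(2)]
    proof eventually_elim
      case (elim p)
      have "ennreal (norm (f (fst p) - g (snd p))) \<le> ennreal (e + C * dist (fst p) (snd p))"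
        using le[OF elim] by (intro ennreal_leI)
      then show ?case using e by (simp add: ennreal_plus ennreal_mult)
    qed
  qed
  also have "\<dots> = ennreal e + ennreal C * (\<integral>\<^sup>+z. ennreal (dist (fst z) (snd z)) \<partial>\<gamma>)"
    using c(2,3) by (subst nn_integral_add) (auto simp: nn_integral_cmult emeasure_space_1)
  finally show ?thesis .
qed

text \<open>Solving for \<open>f i\<close> makes the left side independent of i, so the infimum can
  be taken; truncated subtraction of the finite number \<open>a\<close> is harmless here because it
  is undone by an equivalence. Positivity of c is what permits the division.\<close>

lemma le_affine_INF_ennreal:
  fixes X :: ennreal
  assumes c: "0 < c" and le: "\<And>i. i \<in> S \<Longrightarrow> X \<le> ennreal a + ennreal c * f i"
  shows "X \<le> ennreal a + ennreal c * (INF i\<in>S. f i)"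
proof -
  have "(X - ennreal a) / ennreal c \<le> f i" if "i \<in> S" for i
    using c le[OF that] by (intro divide_le_posI_ennreal) (auto simp: ennreal_minus_le_iff)
  then have "(X - ennreal a) / ennreal c \<le> (INF i\<in>S. f i)" by (rule INF_greatest)
  then have "ennreal c * ((X - ennreal a) / ennreal c) \<le> ennreal c * (INF i\<in>S. f i)"
    by (rule mult_left_mono) simp
  also have "ennreal c * ((X - ennreal a) / ennreal c) = X - ennreal a"
    using c by (simp add: ennreal_times_divide mult.commute[of "ennreal c"] mult_divide_eq_ennreal)
  finally show ?thesis by (simp add: ennreal_minus_le_iff)
qed

text \<open>The elementary direction of Kantorovich duality, for two integrands and with an additive
  error.\<close>

lemma W1_integral_diff:
  fixes f g :: "'a::euclidean_space \<Rightarrow> real"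
  assumes "sets \<mu> = sets borel" "prob_space \<mu>" "sets \<nu> = sets borel"
    and "integrable \<mu> f" "integrable \<nu> g"
    and "AE x in \<mu>. x \<in> A" "AE x in \<nu>. x \<in> A"
    and e: "0 \<le> e" and C: "0 < C" and "\<And>x y. x \<in> A \<Longrightarrow> y \<in> A \<Longrightarrow> \<bar>f x - g y\<bar> \<le> e + C * dist x y"
  shows "ennreal \<bar>(LINT x|\<mu>. f x) - (LINT y|\<nu>. g y)\<bar> \<le> ennreal e + ennreal C * W1 \<mu> \<nu>"
  unfolding W1_def real_norm_def[symmetric] using assms
  by (intro le_affine_INF_ennreal coupling_integral_diff[where A = A]) auto

text \<open>W1 controls only Lipschitz integrands. On a compact set a continuous one is Lipschitz up
  to an additive error: close points are handled by uniform continuity, distant ones by boundedness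
  with a large Lipschitz constant.\<close>

lemma continuous_on_integral_P_c_curve:
  fixes j :: "real \<Rightarrow> 'a::euclidean_space \<Rightarrow> real"
  assumes mu: "P_c_curve T \<mu>" and supp: "\<And>t. t \<in> {0..T} \<Longrightarrow> measure_supp (\<mu> t) \<subseteq> cball 0 P"
    and j: "continuous_on ({0..T} \<times> UNIV) (\<lambda>(t, z). j t z)"
  shows "continuous_on {0..T} (\<lambda>t. LINT z|\<mu> t. j t z)"
    and "\<And>t. t \<in> {0..T} \<Longrightarrow> integrable (\<mu> t) (j t)"
proof -
  let ?K = "{0..T} \<times> cball (0::'a) P"
  have jK: "continuous_on ?K (\<lambda>(t, z). j t z)" by (rule continuous_on_subset[OF j]) auto
  have K: "compact ?K" by (intro compact_Times) auto
  have "bounded ((\<lambda>(t, z). j t z) ` ?K)"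
    by (intro compact_imp_bounded compact_continuous_image jK K)
  then obtain B0 where "\<forall>y\<in>(\<lambda>(t, z). j t z) ` ?K. norm y \<le> B0" unfolding bounded_iff by (elim exE)
  then have B0: "\<And>t z. t \<in> {0..T} \<Longrightarrow> z \<in> cball 0 P \<Longrightarrow> \<bar>j t z\<bar> \<le> B0" by force
  define B where "B = \<bar>B0\<bar> + 1"
  have B: "\<And>t z. t \<in> {0..T} \<Longrightarrow> z \<in> cball 0 P \<Longrightarrow> \<bar>j t z\<bar> \<le> B" "B > 0"
    using B0 by (force simp: B_def)+
  have Pc: "\<mu> t \<in> P_c" if "t \<in> {0..T}" for t using mu that by (auto simp: P_c_curve_def)
  have ae: "AE z in \<mu> t. z \<in> cball 0 P" if "t \<in> {0..T}" for t
    using AE_measure_supp[OF P_cD(1)[OF Pc[OF that]]] by eventually_elim (use supp[OF that] in auto)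
  show int: "integrable (\<mu> t) (j t)" if t: "t \<in> {0..T}" for t
  proof -
    interpret prob_space "\<mu> t" by (rule P_cD(2)[OF Pc[OF t]])
    have "continuous_on UNIV (j t)"
      using continuous_on_compose2[OF j, of UNIV "\<lambda>z. (t, z)"] t
      by (simp add: continuous_on_Pair image_subset_iff)
    then have "j t \<in> borel_measurable (\<mu> t)"
      using borel_measurable_continuous_onI measurable_cong_sets[OF P_cD(1)[OF Pc[OF t]] refl] by blast
    moreover have "AE z in \<mu> t. norm (j t z) \<le> B"
      using ae[OF t] by eventually_elim (use B t in auto)
    ultimately show ?thesis by (intro integrable_const_bound)
  qed
  show "continuous_on {0..T} (\<lambda>t. LINT z|\<mu> t. j t z)"
    unfolding continuous_on_def
  proof (intro ballI tendstoI)
    fix t e :: real assume t: "t \<in> {0..T}" and e: "0 < e"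
    have "uniformly_continuous_on ?K (\<lambda>(t, z). j t z)"
      by (rule compact_uniformly_continuous[OF jK K])
    then obtain d where d: "d > 0" and
      ud: "\<And>p q. p \<in> ?K \<Longrightarrow> q \<in> ?K \<Longrightarrow> dist p q < d \<Longrightarrow> \<bar>(case p of (t, z) \<Rightarrow> j t z) - (case q of (t, z) \<Rightarrow> j t z)\<bar> < e / 4"
      using e unfolding uniformly_continuous_on_def dist_real_def by (metis divide_pos_pos zero_less_numeral)
    \<comment> \<open>Chosen so that \<open>C * (d / 2)\<close> equals 2 B, the largest possible
      difference of two values; points at distance at least d / 2 then cost nothing more.\<close>
    define C where "C = 4 * B / d"
    have C: "C > 0" using B d by (simp add: C_def)
    have key: "\<bar>j s x - j t y\<bar> \<le> e / 4 + C * dist x y"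
      if "s \<in> {0..T}" "\<bar>s - t\<bar> < d / 2" "x \<in> cball 0 P" "y \<in> cball 0 P" for s x y
    proof (cases "dist x y < d / 2")
      case True
      have "dist (s, x) (t, y) \<le> \<bar>s - t\<bar> + dist x y"
        unfolding dist_Pair_Pair by (metis dist_real_def sqrt_sum_squares_le_sum_abs abs_of_nonneg zero_le_dist)
      then have "\<bar>j s x - j t y\<bar> < e / 4"
        using ud[of "(s, x)" "(t, y)"] that t True by auto
      moreover have "0 \<le> C * dist x y" using C by simp
      ultimately show ?thesis by linarith
    next
      case False
      have "\<bar>j s x - j t y\<bar> \<le> 2 * B"
        using B(1)[OF that(1,3)] B(1)[OF t that(4)] by linarith
      also have "\<dots> = C * (d / 2)" using d by (simp add: C_def)
      also have "\<dots> \<le> C * dist x y" using False C by (intro mult_left_mono) auto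
      finally show ?thesis using e by simp
    qed
    have "((\<lambda>s. W1 (\<mu> s) (\<mu> t)) \<longlongrightarrow> 0) (at t within {0..T})"
      using mu t by (auto simp: P_c_curve_def)
    moreover have "ennreal (e / (4 * C)) > 0" using e C by simp
    ultimately have "\<forall>\<^sub>F s in at t within {0..T}. W1 (\<mu> s) (\<mu> t) < ennreal (e / (4 * C))"
      by (rule order_tendstoD)
    moreover have "\<forall>\<^sub>F s in at t within {0..T}. s \<in> {0..T} \<and> \<bar>s - t\<bar> < d / 2"
      using d by (auto simp: eventually_at dist_real_def intro!: exI[of _ "d / 2"])
    ultimately show "\<forall>\<^sub>F s in at t within {0..T}. dist (LINT z|\<mu> s. j s z) (LINT z|\<mu> t. j t z) < e"
    proof eventually_elim
      case (elim s)
      have "ennreal \<bar>(LINT z|\<mu> s. j s z) - (LINT z|\<mu> t. j t z)\<bar> \<le> ennreal (e / 4) + ennreal C * W1 (\<mu> s) (\<mu> t)"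
        by (rule W1_integral_diff[where A = "cball 0 P"])
          (use elim t e C in \<open>auto intro!: P_cD Pc int ae key simp del: mem_cball mem_cball_0\<close>)
      also have "\<dots> \<le> ennreal (e / 4) + ennreal C * ennreal (e / (4 * C))"
        using elim by (intro add_left_mono mult_left_mono) auto
      also have "\<dots> = ennreal (e / 4 + C * (e / (4 * C)))"
        using e C by (simp only: ennreal_plus ennreal_mult divide_nonneg_nonneg mult_nonneg_nonneg less_imp_le zero_le_numeral)
      also have "e / 4 + C * (e / (4 * C)) = e / 2" using C by simp
      finally have "\<bar>(LINT z|\<mu> s. j s z) - (LINT z|\<mu> t. j t z)\<bar> \<le> e / 2"
        using e by (simp add: ennreal_le_iff)
      then show ?case using e by (simp add: dist_real_def)
    qed
  qed
qed

text \<open>Closed sets form a generator stable under intersection, and the indicator of a closed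
  set is the limit of Lipschitz functions of the distance to it.\<close>

lemma prob_measure_eqI_lipschitz:
  fixes \<mu> \<nu> :: "'a::euclidean_space measure"
  assumes mu: "sets \<mu> = sets borel" "prob_space \<mu>" and nu: "sets \<nu> = sets borel" "prob_space \<nu>"
    and eq: "\<And>g K. K > 0 \<Longrightarrow> (\<And>x y. \<bar>g x - g y\<bar> \<le> K * dist x y) \<Longrightarrow> (LINT x|\<mu>. g x) = (LINT x|\<nu>. g x)"
  shows "\<mu> = \<nu>"
proof (rule measure_eqI_generator_eq[of "{S. closed S}" UNIV])
  interpret M: prob_space \<mu> by fact
  interpret N: prob_space \<nu> by fact
  show "Int_stable {S :: 'a set. closed S}" by (auto simp: Int_stable_def)
  have "sets (borel :: 'a measure) = sigma_sets UNIV {S. closed S}"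
    by (subst borel_eq_closed) (simp add: sets_measure_of)
  then show "sets \<mu> = sigma_sets UNIV {S. closed S}" "sets \<nu> = sigma_sets UNIV {S. closed S}"
    using mu nu by auto
  show "range (\<lambda>_::nat. UNIV) \<subseteq> {S :: 'a set. closed S}" "(\<Union>i::nat. UNIV) = (UNIV :: 'a set)"
    "{S :: 'a set. closed S} \<subseteq> Pow UNIV" by auto
  show "emeasure \<mu> UNIV \<noteq> \<infinity>" for i :: nat by simp
  fix A :: "'a set" assume "A \<in> {S. closed S}"
  then have A: "closed A" by simp
  show "emeasure \<mu> A = emeasure \<nu> A"
  \<comment> \<open>The empty set is separated because the distance to it has the default value 0,
    which would make the approximating functions equal to 1.\<close>
  proof (cases "A = {}")
    case False
    define g where "g n x = max 0 (1 - real (Suc n) * infdist x A)" for n x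
    have gl: "\<bar>g n x - g n y\<bar> \<le> real (Suc n) * dist x y" for n x y
    proof -
      have "\<bar>infdist x A - infdist y A\<bar> \<le> dist x y"
        by (rule infdist_triangle_abs)
      then have "real (Suc n) * \<bar>infdist x A - infdist y A\<bar> \<le> real (Suc n) * dist x y"
        by (intro mult_left_mono) auto
      moreover have "\<bar>g n x - g n y\<bar> \<le> \<bar>real (Suc n) * infdist x A - real (Suc n) * infdist y A\<bar>"
        unfolding g_def by linarith
      ultimately show ?thesis
        by (simp only: right_diff_distrib[symmetric] abs_mult abs_of_nat)
    qed
    have gc: "continuous_on UNIV (g n)" for n unfolding g_def by (intro continuous_intros)
    have lim: "(\<lambda>n. g n x) \<longlonglongrightarrow> indicator A x" for x
    proof (cases "x \<in> A")
      case True
      then show ?thesis using infdist_zero[of x A] by (simp add: g_def)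
    next
      case F: False
      then have d: "infdist x A > 0"
        using in_closed_iff_infdist_zero[OF A False] infdist_nonneg[of x A] by force
      obtain m where m: "1 / infdist x A < real m" using reals_Archimedean2 by blast
      have "\<forall>\<^sub>F n in sequentially. g n x = 0"
        using eventually_ge_at_top[of m]
      proof eventually_elim
        case (elim n)
        have "1 \<le> real m * infdist x A" using m d by (simp add: field_simps)
        also have "\<dots> \<le> real (Suc n) * infdist x A" using elim d by (intro mult_right_mono) auto
        finally show ?case by (simp add: g_def)
      qed
      then show ?thesis using F by (simp add: tendsto_eventually)
    qed
    have *: "(\<lambda>n. LINT x|\<rho>. g n x) \<longlonglongrightarrow> measure \<rho> A" if "prob_space \<rho>" "sets \<rho> = sets borel" for \<rho>
    proof -
      interpret R: prob_space \<rho> by fact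
      have "(\<lambda>n. LINT x|\<rho>. g n x) \<longlonglongrightarrow> (LINT x|\<rho>. indicator A x)"
      proof (rule integral_dominated_convergence[where w = "\<lambda>_. 1"])
        show "g n \<in> borel_measurable \<rho>" for n
          using borel_measurable_continuous_onI[OF gc] measurable_cong_sets[OF that(2) refl] by blast
        show "AE x in \<rho>. norm (g n x) \<le> 1" for n
          by (auto simp: g_def infdist_nonneg simp del: of_nat_Suc)
        show "(indicator A :: _ \<Rightarrow> real) \<in> borel_measurable \<rho>"
          by (rule borel_measurable_indicator) (simp add: A that)
      qed (auto simp: lim)
      then show ?thesis using sets_eq_imp_space_eq[OF that(2)] by simp
    qed
    have e: "(\<lambda>n. LINT x|\<mu>. g n x) = (\<lambda>n. LINT x|\<nu>. g n x)"
      by (intro ext eq[OF _ gl]) simp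
    have "measure \<mu> A = measure \<nu> A"
      using LIMSEQ_unique[OF *[OF mu(2,1)]] *[OF nu(2,1)] unfolding e by blast
    then show ?thesis by (simp only: M.emeasure_eq_measure N.emeasure_eq_measure)
  qed simp
qed

section \<open>Distributional solutions of the continuity equation\<close>

lemma (in lipschitz_field) continuous_on_ode_flow:
  assumes "t \<le> r"
  shows "continuous_on UNIV (ode_flow v t r)"
  by (rule lipschitz_on_continuous_on[of "exp (L * (r - t))"], rule lipschitz_onI)
    (use ode_flow_lipschitz[OF assms] in \<open>auto simp: dist_norm\<close>)

text \<open>Time and space are merged into one Euclidean space: the transport operator becomes the
  derivative in direction (1, v), and space-time mollification is ordinary mollification
  there.\<close>

locale weak_transport = lipschitz_field v L
  for v :: "real \<Rightarrow> 'e::euclidean_space \<Rightarrow> 'e" and L +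
  fixes T P :: real and \<mu> :: "real \<Rightarrow> 'e measure"
  assumes T: "T > 0" and curve: "P_c_curve T \<mu>"
    and supp: "\<And>t. t \<in> {0..T} \<Longrightarrow> measure_supp (\<mu> t) \<subseteq> cball 0 P"
    and time_lip: "\<exists>A\<ge>0. \<forall>t t' z. norm z \<le> P + 1 \<longrightarrow> norm (v t z - v t' z) \<le> A * \<bar>t - t'\<bar>"
    and weak: "\<And>\<phi>. test_fun T \<phi> \<Longrightarrow>
      (LINT t:{0..T}|lborel. (LINT z|\<mu> t. frechet_derivative \<phi> (at (t, z)) (1, v t z))) = 0"
begin

lemma mu_P_c: "t \<in> {0..T} \<Longrightarrow> \<mu> t \<in> P_c"
  using curve by (auto simp: P_c_curve_def)

lemma mu_AE:
  assumes t: "t \<in> {0..T}"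
  shows "AE z in \<mu> t. norm z \<le> P"
  using AE_measure_supp[OF P_cD(1)[OF mu_P_c[OF t]]]
proof eventually_elim
  case (elim z)
  then show ?case using supp[OF t] by auto
qed

lemma P_nonneg: "P \<ge> 0"
proof (rule ccontr)
  assume "\<not> P \<ge> 0"
  moreover have "AE z in \<mu> 0. norm z \<le> P" using T by (intro mu_AE) simp
  ultimately have "AE z in \<mu> 0. False"
    by (auto elim!: eventually_mono dest: order_trans[OF norm_ge_zero])
  then show False
    using prob_space.AE_False[OF P_cD(2)[OF mu_P_c]] T by auto
qed

lemma continuous_on_integral_mu:
  fixes j :: "real \<Rightarrow> 'e \<Rightarrow> real"
  assumes "continuous_on ({0..T} \<times> UNIV) (\<lambda>(t, z). j t z)"
  shows "continuous_on {0..T} (\<lambda>t. LINT z|\<mu> t. j t z)" and "\<And>t. t \<in> {0..T} \<Longrightarrow> integrable (\<mu> t) (j t)"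
proof -
  show "continuous_on {0..T} (\<lambda>t. LINT z|\<mu> t. j t z)"
    by (rule continuous_on_integral_P_c_curve(1)[OF curve _ assms]) (rule supp)
  show "integrable (\<mu> t) (j t)" if "t \<in> {0..T}" for t
    by (rule continuous_on_integral_P_c_curve(2)[OF curve _ assms that]) (rule supp)
qed

lemma integral_bound_mu:
  assumes t: "t \<in> {0..T}" and b: "\<And>z. norm z \<le> P \<Longrightarrow> \<bar>f z\<bar> \<le> (B::real)"
  shows "\<bar>LINT z|\<mu> t. f z\<bar> \<le> B"
proof -
  have "0 \<le> B" using order_trans[OF abs_ge_zero b[of 0]] P_nonneg by simp
  moreover have "AE z in \<mu> t. norm (f z) \<le> B" using mu_AE[OF t] by eventually_elim (simp add: b)
  ultimately show ?thesis using prob_integral_norm_le[OF P_cD(2)[OF mu_P_c[OF t]], of f B] by simp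
qed

text \<open>The solution by characteristics of the backward transport equation with datum g at time
  s. It is extended constantly in time beyond [0, s], so that it is continuous on the whole
  space-time and can be mollified.\<close>

definition dual :: "real \<Rightarrow> ('e \<Rightarrow> real) \<Rightarrow> real \<Rightarrow> 'e \<Rightarrow> real" where
  "dual s g t z = g (ode_flow v (max 0 (min s t)) s z)"

context
  fixes s K :: real and g :: "'e \<Rightarrow> real"
  assumes s: "0 < s" "s \<le> T" and K: "K > 0" and g: "\<And>x y. \<bar>g x - g y\<bar> \<le> K * dist x y"
begin

lemma dual_flow:
  assumes "0 \<le> t" "t \<le> r" "r \<le> s"
  shows "dual s g t z = dual s g r (ode_flow v t r z)"
  using assms ode_flow_flow[of t r s z] by (simp add: dual_def)

lemma dual_lipschitz: "\<bar>dual s g t x - dual s g t y\<bar> \<le> K * exp (L * s) * norm (x - y)"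
proof -
  let ?c = "max 0 (min s t)"
  have c: "?c \<le> s" "0 \<le> ?c" using s by auto
  have "\<bar>dual s g t x - dual s g t y\<bar> \<le> K * norm (ode_flow v ?c s x - ode_flow v ?c s y)"
    unfolding dual_def using g by (simp add: dist_norm)
  also have "\<dots> \<le> K * (exp (L * (s - ?c)) * norm (x - y))"
    using K by (intro mult_left_mono ode_flow_lipschitz c) auto
  also have "\<dots> \<le> K * (exp (L * s) * norm (x - y))"
    using K c L_nonneg by (intro mult_left_mono mult_right_mono) (auto intro!: mult_left_mono)
  finally show ?thesis by (simp add: mult.assoc)
qed

text \<open>Since \<open>dual\<close> is constant along the flow, an increment in time equals an
  increment in space by the displacement of a characteristic. The factor 1 + |z| reflects the linear
  growth of the field.\<close>

lemma dual_time_lipschitz: "\<exists>D\<ge>0. \<forall>t r z. \<bar>dual s g t z - dual s g r z\<bar> \<le> D * (1 + norm z) * \<bar>t - r\<bar>"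
proof -
  have "continuous_on {0..s} (\<lambda>t. v t 0)" by (intro cont' continuous_intros)
  then have "bounded ((\<lambda>t. v t 0) ` {0..s})" by (intro compact_imp_bounded compact_continuous_image) auto
  then obtain B0 where B0: "\<forall>y\<in>(\<lambda>t. v t 0) ` {0..s}. norm y \<le> B0" unfolding bounded_iff by (elim exE)
  define B where "B = \<bar>B0\<bar> + L"
  have vB: "norm (v t z) \<le> B * (1 + norm z)" if "t \<in> {0..s}" for t z
  proof -
    have "norm (v t z) \<le> L * norm z + norm (v t 0)"
      using lip[of t z 0] norm_triangle_sub[of "v t z" "v t 0"] by simp
    also have "norm (v t 0) \<le> \<bar>B0\<bar>" using B0 that by force
    also have "L * norm z + \<bar>B0\<bar> \<le> B * (1 + norm z)"
      using L_nonneg by (simp add: B_def algebra_simps)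
    finally show ?thesis by simp
  qed
  define E where "E = exp (L * s)"
  have key: "\<bar>dual s g t z - dual s g r z\<bar> \<le> K * E * (B * (1 + norm z) * (r - t) * E)"
    if tr: "0 \<le> t" "t \<le> r" "r \<le> s" for t r z
  proof -
    have "\<bar>dual s g t z - dual s g r z\<bar> \<le> K * E * norm (ode_flow v t r z - z)"
      unfolding dual_flow[OF tr] E_def by (rule dual_lipschitz)
    also have "\<dots> \<le> K * E * (B * (1 + norm z) * (r - t) * exp (L * (r - t)))"
      using K tr by (intro mult_left_mono ode_flow_displacement vB) (auto simp: E_def)
    also have "\<dots> \<le> K * E * (B * (1 + norm z) * (r - t) * E)"
      using K tr L_nonneg unfolding E_def B_def by (intro mult_left_mono) (auto intro!: mult_left_mono)
    finally show ?thesis .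
  qed
  have clamp: "dual s g t z = dual s g (max 0 (min s t)) z" for t z
    using s by (simp add: dual_def)
  have "\<bar>dual s g t z - dual s g r z\<bar> \<le> (K * E * B * E) * (1 + norm z) * \<bar>t - r\<bar>" for t r z
  proof -
    let ?t = "max 0 (min s t)" and ?r = "max 0 (min s r)"
    have "\<bar>dual s g ?t z - dual s g ?r z\<bar> \<le> K * E * (B * (1 + norm z) * \<bar>?t - ?r\<bar> * E)"
    proof (cases "?t \<le> ?r")
      case True
      then show ?thesis using key[OF _ True, of z] s by simp
    next
      case False
      then have rt: "?r \<le> ?t" by simp
      from key[OF _ this, of z] s
      have "\<bar>dual s g ?r z - dual s g ?t z\<bar> \<le> K * E * (B * (1 + norm z) * (?t - ?r) * E)" by simp
      moreover have "\<bar>?t - ?r\<bar> = ?t - ?r" using rt by (simp only: abs_of_nonneg diff_ge_0_iff_ge)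
      ultimately show ?thesis by (metis abs_minus_commute)
    qed
    also have "\<dots> \<le> K * E * (B * (1 + norm z) * \<bar>t - r\<bar> * E)"
      using K L_nonneg unfolding E_def B_def by (intro mult_left_mono mult_right_mono) auto
    finally show ?thesis using clamp by (simp add: mult_ac)
  qed
  moreover have "K * E * B * E \<ge> 0" using K L_nonneg by (simp add: E_def B_def)
  ultimately show ?thesis by blast
qed

lemma continuous_dual: "continuous_on UNIV (\<lambda>(t, z). dual s g t z)"
proof -
  obtain D where D: "D \<ge> 0" "\<And>t r z. \<bar>dual s g t z - dual s g r z\<bar> \<le> D * (1 + norm z) * \<bar>t - r\<bar>"
    using dual_time_lipschitz by blast
  have "((\<lambda>q. dual s g (fst q) (snd q)) \<longlongrightarrow> dual s g (fst p) (snd p)) (at p)" for p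
  proof -
    have "((\<lambda>q. dual s g (fst q) (snd q) - dual s g (fst p) (snd p)) \<longlongrightarrow> 0) (at p)"
    proof (rule Lim_null_comparison)
      show "\<forall>\<^sub>F q in at p. norm (dual s g (fst q) (snd q) - dual s g (fst p) (snd p))
         \<le> K * exp (L * s) * norm (snd q - snd p) + D * (1 + norm (snd p)) * \<bar>fst q - fst p\<bar>"
      proof (intro always_eventually allI)
        fix q
        show "norm (dual s g (fst q) (snd q) - dual s g (fst p) (snd p))
           \<le> K * exp (L * s) * norm (snd q - snd p) + D * (1 + norm (snd p)) * \<bar>fst q - fst p\<bar>"
          using dual_lipschitz[of "fst q" "snd q" "snd p"] D(2)[of "fst q" "snd p" "fst p"]
          unfolding real_norm_def by linarith
      qed
      have "((\<lambda>q. K * exp (L * s) * norm (snd q - snd p) + D * (1 + norm (snd p)) * \<bar>fst q - fst p\<bar>)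
         \<longlongrightarrow> K * exp (L * s) * norm (snd p - snd p) + D * (1 + norm (snd p)) * \<bar>fst p - fst p\<bar>) (at p)"
        by (intro tendsto_intros)
      then show "((\<lambda>q. K * exp (L * s) * norm (snd q - snd p) + D * (1 + norm (snd p)) * \<bar>fst q - fst p\<bar>) \<longlongrightarrow> 0) (at p)"
        by simp
    qed
    then show ?thesis by (simp add: LIM_zero_iff)
  qed
  then show ?thesis unfolding continuous_on_def split_beta by simp
qed

text \<open>The commutator estimate: \<open>\<phi>\<close> is constant along characteristics, and the characteristic
  from a nearby point differs from the straight line in direction \<open>(1, v t z)\<close> by \<open>O(h (\<epsilon> + h))\<close>.\<close>

lemma dual_increment:
  "\<exists>C1\<ge>0. \<forall>t z. norm z \<le> P \<longrightarrow> (\<exists>C. \<forall>h \<tau> w. 0 < h \<longrightarrow> 0 \<le> \<tau> \<longrightarrow> \<tau> + h \<le> s \<longrightarrow> (\<forall>\<epsilon>>0. \<bar>\<tau> - t\<bar> \<le> \<epsilon> \<longrightarrow> norm (w - z) \<le> \<epsilon> \<longrightarrow>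
     \<bar>dual s g (\<tau> + h) (w + h *\<^sub>R v t z) - dual s g \<tau> w\<bar> \<le> h * (C1 * \<epsilon> + C * h)))"
proof -
  obtain A where A: "A \<ge> 0" "\<And>t t' z. norm z \<le> P + 1 \<Longrightarrow> norm (v t z - v t' z) \<le> A * \<bar>t - t'\<bar>"
    using time_lip by blast
  define E where "E = exp (L * s)"
  have E: "E > 0" by (simp add: E_def)
  \<comment> \<open>The order of quantifiers matters: \<open>C1\<close> must serve all points
    because it survives as the error of order \<epsilon>, whereas the factor of h may depend on t
    and z, since h tends to 0 first.\<close>
  define C1 where "C1 = K * E * ((L + A) * E)"
  have "C1 \<ge> 0" using K E A L_nonneg by (simp add: C1_def)
  moreover have "\<exists>C. \<forall>h \<tau> w. 0 < h \<longrightarrow> 0 \<le> \<tau> \<longrightarrow> \<tau> + h \<le> s \<longrightarrow> (\<forall>\<epsilon>>0. \<bar>\<tau> - t\<bar> \<le> \<epsilon> \<longrightarrow> norm (w - z) \<le> \<epsilon> \<longrightarrow>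
     \<bar>dual s g (\<tau> + h) (w + h *\<^sub>R v t z) - dual s g \<tau> w\<bar> \<le> h * (C1 * \<epsilon> + C * h))"
    if z: "norm z \<le> P" for t z
  proof (intro exI allI impI)
    fix h \<tau> w \<epsilon> assume h: "0 < h" and tau: "0 \<le> \<tau>" "\<tau> + h \<le> s" and e: "\<epsilon> > 0" "\<bar>\<tau> - t\<bar> \<le> \<epsilon>" "norm (w - z) \<le> \<epsilon>"
    define V where "V = norm (v t z)"
    define B where "B = (L + A) * \<epsilon> + h * (L * V + A)"
    \<comment> \<open>The deviation of the characteristic from the straight line whose velocity is
      frozen at (t, z), not at its own starting point (\<tau>, w).\<close>
    define Y where "Y r = ode_flow v \<tau> r w - w - (r - \<tau>) *\<^sub>R v t z" for r
    have "norm (Y (\<tau> + h)) \<le> (norm (Y \<tau>) + B * (\<tau> + h - \<tau>)) * exp (L * (\<tau> + h - \<tau>))"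
    proof (rule gronwall_const)
      show "0 \<le> B" using h e A L_nonneg by (simp add: B_def V_def)
      fix r assume r: "r \<in> {\<tau>..\<tau> + h}"
      show "(Y has_vector_derivative v r (ode_flow v \<tau> r w) - v t z) (at r within {\<tau>..\<tau> + h})"
        unfolding Y_def[abs_def]
        using ode_flow_has_vector_derivative[OF r, of w]
        by (auto intro!: derivative_eq_intros)
      have "norm (v r (ode_flow v \<tau> r w) - v t z) \<le> norm (v r (ode_flow v \<tau> r w) - v r z) + norm (v r z - v t z)"
        using norm_triangle_ineq[of "v r (ode_flow v \<tau> r w) - v r z" "v r z - v t z"] by simp
      also have "norm (v r (ode_flow v \<tau> r w) - v r z) \<le> L * (norm (Y r) + \<epsilon> + h * V)"
      proof -
        have "ode_flow v \<tau> r w - z = Y r + (w - z) + (r - \<tau>) *\<^sub>R v t z" by (simp add: Y_def)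
        then have "norm (ode_flow v \<tau> r w - z) \<le> norm (Y r) + norm (w - z) + norm ((r - \<tau>) *\<^sub>R v t z)"
          by (metis norm_triangle_ineq norm_triangle_mono order_refl)
        also have "norm ((r - \<tau>) *\<^sub>R v t z) \<le> h * V"
          using r by (simp add: V_def mult_right_mono)
        finally have "norm (ode_flow v \<tau> r w - z) \<le> norm (Y r) + \<epsilon> + h * V" using e by linarith
        from order_trans[OF lip mult_left_mono[OF this L_nonneg]] show ?thesis .
      qed
      also have "norm (v r z - v t z) \<le> A * (\<epsilon> + h)"
      proof -
        have "norm (v r z - v t z) \<le> A * \<bar>r - t\<bar>" using A(2) z by simp
        also have "\<dots> \<le> A * (\<epsilon> + h)" using r e A(1) by (intro mult_left_mono) auto
        finally show ?thesis .
      qed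
      finally show "norm (v r (ode_flow v \<tau> r w) - v t z) \<le> L * norm (Y r) + B"
        by (simp add: B_def algebra_simps)
    qed (use h L_nonneg in auto)
    then have "norm (Y (\<tau> + h)) \<le> B * h * exp (L * h)" by (simp add: Y_def)
    also have "\<dots> \<le> B * h * E"
      using h e A tau L_nonneg unfolding E_def by (intro mult_left_mono) (auto simp: B_def V_def intro!: mult_left_mono)
    finally have Y: "norm (Y (\<tau> + h)) \<le> B * h * E" .
    have "\<bar>dual s g (\<tau> + h) (w + h *\<^sub>R v t z) - dual s g \<tau> w\<bar>
       = \<bar>dual s g (\<tau> + h) (w + h *\<^sub>R v t z) - dual s g (\<tau> + h) (ode_flow v \<tau> (\<tau> + h) w)\<bar>"
      using dual_flow[of \<tau> "\<tau> + h" w] tau h by simp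
    also have "\<dots> \<le> K * E * norm (w + h *\<^sub>R v t z - ode_flow v \<tau> (\<tau> + h) w)"
      unfolding E_def by (rule dual_lipschitz)
    also have "norm (w + h *\<^sub>R v t z - ode_flow v \<tau> (\<tau> + h) w) = norm (Y (\<tau> + h))"
      unfolding Y_def by (subst norm_minus_cancel[symmetric]) (simp add: algebra_simps)
    also have "K * E * norm (Y (\<tau> + h)) \<le> K * E * (B * h * E)"
      using Y K E by (intro mult_left_mono) auto
    also have "\<dots> = h * (C1 * \<epsilon> + (K * E * E * (L * norm (v t z) + A)) * h)"
      by (simp add: C1_def B_def V_def algebra_simps)
    finally show "\<bar>dual s g (\<tau> + h) (w + h *\<^sub>R v t z) - dual s g \<tau> w\<bar>
      \<le> h * (C1 * \<epsilon> + (K * E * E * (L * norm (v t z) + A)) * h)" .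
  qed
  ultimately show ?thesis by blast
qed

text \<open>Errors are relative to the mass c, which depends on \<epsilon>, while C does not. The
  directional bound is confined to times at distance more than \<epsilon> from 0 and s, because the
  constant extension of \<open>dual\<close> is not transported by the field.\<close>

lemma dual_uniform_mollification:
  "\<exists>C>0. \<forall>\<epsilon>. 0 < \<epsilon> \<longrightarrow> \<epsilon> < 1 \<longrightarrow> (\<exists>\<Phi> R c. c > 0 \<and> (\<forall>k. C_k k \<Phi>) \<and> (\<forall>p. R \<le> norm p \<longrightarrow> \<Phi> p = 0) \<and>
     (\<forall>t z. 0 \<le> t \<longrightarrow> t \<le> s \<longrightarrow> norm z \<le> P \<longrightarrow> \<bar>\<Phi> (t, z) - dual s g t z * c\<bar> \<le> C * \<epsilon> * c) \<and>
     (\<forall>t z. \<epsilon> < t \<longrightarrow> t < s - \<epsilon> \<longrightarrow> norm z \<le> P \<longrightarrow> \<bar>frechet_derivative \<Phi> (at (t, z)) (1, v t z)\<bar> \<le> C * \<epsilon> * c))"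
proof -
  obtain D where D: "D \<ge> 0" "\<And>t r z. \<bar>dual s g t z - dual s g r z\<bar> \<le> D * (1 + norm z) * \<bar>t - r\<bar>"
    using dual_time_lipschitz by blast
  obtain C1 where C1: "C1 \<ge> 0" "\<And>t z. norm z \<le> P \<Longrightarrow> (\<exists>C. \<forall>h \<tau> w. 0 < h \<longrightarrow> 0 \<le> \<tau> \<longrightarrow> \<tau> + h \<le> s \<longrightarrow> (\<forall>\<epsilon>>0. \<bar>\<tau> - t\<bar> \<le> \<epsilon> \<longrightarrow> norm (w - z) \<le> \<epsilon> \<longrightarrow>
     \<bar>dual s g (\<tau> + h) (w + h *\<^sub>R v t z) - dual s g \<tau> w\<bar> \<le> h * (C1 * \<epsilon> + C * h)))"
    using dual_increment by blast
  define C where "C = 1 + C1 + (K * exp (L * s) + D * (1 + P))"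
  have CC: "C > 0" "C1 \<le> C" "K * exp (L * s) + D * (1 + P) \<le> C"
    using C1 D K P_nonneg by (auto simp: C_def intro!: add_pos_nonneg)
  let ?\<phi> = "\<lambda>p. dual s g (fst p) (snd p)"
  have phi: "continuous_on UNIV ?\<phi>" using continuous_dual by (simp add: split_beta)
  \<comment> \<open>The radius leaves room for balls of radius 2 \<epsilon> < 2 around all points
    with time in [0, s] and position of norm at most P.\<close>
  obtain a :: "real \<times> 'e" where a: "cball 0 (s + P + 2) \<subseteq> cbox (- a) a"
    using bounded_subset_cbox_symmetric[OF bounded_cball] by blast
  obtain R0 where R0: "\<And>q. q \<in> cbox (- a) a \<Longrightarrow> norm q \<le> R0"
    using bounded_cbox[of "- a" a] unfolding bounded_iff by blast
  have "\<exists>\<Phi> R c. c > 0 \<and> (\<forall>k. C_k k \<Phi>) \<and> (\<forall>p. R \<le> norm p \<longrightarrow> \<Phi> p = 0) \<and>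
     (\<forall>t z. 0 \<le> t \<longrightarrow> t \<le> s \<longrightarrow> norm z \<le> P \<longrightarrow> \<bar>\<Phi> (t, z) - dual s g t z * c\<bar> \<le> C * \<epsilon> * c) \<and>
     (\<forall>t z. \<epsilon> < t \<longrightarrow> t < s - \<epsilon> \<longrightarrow> norm z \<le> P \<longrightarrow> \<bar>frechet_derivative \<Phi> (at (t, z)) (1, v t z)\<bar> \<le> C * \<epsilon> * c)"
    if e: "0 < \<epsilon>" "\<epsilon> < 1" for \<epsilon>
  proof (intro exI conjI allI impI)
    let ?\<Phi> = "mollify (- a) a ?\<phi> (mollifier \<epsilon>)" and ?c = "moll_mass TYPE(real \<times> 'e) \<epsilon>"
    show c: "?c > 0" by (rule moll_mass_pos[OF e(1)])
    show "C_k k ?\<Phi>" for k by (rule C_k_mollify[OF phi C_k_mollifier])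
    show "?\<Phi> p = 0" if "R0 + \<epsilon> \<le> norm p" for p
    proof (rule mollify_zero)
      fix q assume "q \<in> cbox (- a) a"
      from R0[OF this] norm_triangle_ineq2[of p q] that show "\<epsilon> \<le> norm (p - q)" by linarith
    qed (use e in simp)
    have box: "cball (t, z) (2 * \<epsilon>) \<subseteq> cbox (- a) a" if "0 \<le> t" "t \<le> s" "norm z \<le> P" for t z
    proof -
      have "norm (t, z) \<le> s + P" using norm_Pair_le[of t z] that by simp
      then have "cball (t, z) (2 * \<epsilon>) \<subseteq> cball 0 (s + P + 2)"
        using e by (intro cball_subset_cball_iff[THEN iffD2]) (auto simp: dist_norm)
      then show ?thesis using a by blast
    qed
    have cb: "cball p \<epsilon> \<subseteq> cball p (2 * \<epsilon>)" for p :: "real \<times> 'e" using e by (intro subset_cball) simp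
    have near: "\<bar>fst q - t\<bar> \<le> \<epsilon>" "norm (snd q - z) \<le> \<epsilon>" if "q \<in> cball (t, z) \<epsilon>" for q t z
      using that norm_fst_le[of "t - fst q" "z - snd q"] norm_snd_le[of "z - snd q" "t - fst q"]
      by (cases q; auto simp: dist_norm norm_minus_commute abs_minus_commute)+
    show "\<bar>?\<Phi> (t, z) - dual s g t z * ?c\<bar> \<le> C * \<epsilon> * ?c" if "0 \<le> t" "t \<le> s" "norm z \<le> P" for t z
    proof -
      have "\<bar>?\<phi> q - ?\<phi> (t, z)\<bar> \<le> C * \<epsilon>" if q: "q \<in> cball (t, z) \<epsilon>" for q
      proof -
        have "\<bar>?\<phi> q - ?\<phi> (t, z)\<bar> \<le> K * exp (L * s) * norm (snd q - z) + D * (1 + norm z) * \<bar>fst q - t\<bar>"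
          using dual_lipschitz[of "fst q" "snd q" z] D(2)[of "fst q" z t] by simp
        also have "\<dots> \<le> K * exp (L * s) * \<epsilon> + D * (1 + P) * \<epsilon>"
          using K D P_nonneg near[OF q] \<open>norm z \<le> P\<close> by (intro add_mono mult_mono) auto
        also have "\<dots> \<le> C * \<epsilon>" using CC e by (simp add: distrib_right[symmetric])
        finally show ?thesis .
      qed
      from mollify_close[OF phi _ subset_trans[OF cb box[OF that]] this] e show ?thesis by simp
    qed
    show "\<bar>frechet_derivative ?\<Phi> (at (t, z)) (1, v t z)\<bar> \<le> C * \<epsilon> * ?c"
      if t: "\<epsilon> < t" "t < s - \<epsilon>" and z: "norm z \<le> P" for t z
    proof -
      obtain C2 where C2: "\<And>h \<tau> w. 0 < h \<Longrightarrow> 0 \<le> \<tau> \<Longrightarrow> \<tau> + h \<le> s \<Longrightarrow> \<bar>\<tau> - t\<bar> \<le> \<epsilon> \<Longrightarrow> norm (w - z) \<le> \<epsilon> \<Longrightarrow>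
         \<bar>dual s g (\<tau> + h) (w + h *\<^sub>R v t z) - dual s g \<tau> w\<bar> \<le> h * (C1 * \<epsilon> + C2 * h)"
        using C1(2)[OF z, of t] e(1) by blast
      have "\<bar>frechet_derivative ?\<Phi> (at (t, z)) (1, v t z)\<bar> \<le> (C1 * \<epsilon>) * ?c"
      \<comment> \<open>Steps shorter than s - \<epsilon> - t keep \<tau> + h below s for every
        \<tau> within \<epsilon> of t, so the comparison never leaves the interval where
        \<open>dual\<close> is transported.\<close>
      proof (rule mollify_directional_derivative[OF phi e(1) box, where ?h0.0 = "s - \<epsilon> - t" and C = C2])
        fix h q assume h: "0 < h" "h < s - \<epsilon> - t" and q: "q \<in> cball (t, z) \<epsilon>"
        show "\<bar>?\<phi> (q + h *\<^sub>R (1, v t z)) - ?\<phi> q\<bar> \<le> h * (C1 * \<epsilon> + C2 * h)"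
          using C2[of h "fst q" "snd q"] near[OF q] h t by simp
      qed (use t e z in auto)
      also have "\<dots> \<le> C * \<epsilon> * ?c" using CC e c by (intro mult_right_mono) auto
      finally show ?thesis .
    qed
  qed
  then show ?thesis using CC(1) by blast
qed

section \<open>Constancy in time of the pairing with a measure curve\<close>

definition moment :: "real \<Rightarrow> real" where
  "moment t = (LINT z|\<mu> t. dual s g t z)"

lemma continuous_moment: "continuous_on {0..T} moment"
  unfolding moment_def[abs_def]
  by (rule continuous_on_integral_mu) (auto intro: continuous_on_subset[OF continuous_dual])

text \<open>The distributional derivative of \<open>moment\<close> vanishes, tested against a
  translated mollifier. The weak equation is applied to the product of this mollifier in time and
  the space-time mollification of \<open>dual\<close>; the product rule leaves the wanted integral
  and errors of order \<epsilon>.\<close>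

lemma moment_weak_derivative:
  assumes \<delta>: "0 < \<delta>" and a: "\<delta> < a" "a < s - \<delta>"
  shows "integral {0..T} (\<lambda>t. moment t * frechet_derivative (mollifier \<delta>) (at (a - t)) 1) = 0"
proof -
  define Dm where "Dm x = frechet_derivative (mollifier \<delta>) (at x) 1" for x :: real
  have dm: "(mollifier \<delta> has_derivative (\<lambda>h. h * Dm x)) (at x)" for x :: real
  proof -
    have d: "(mollifier \<delta> :: real \<Rightarrow> real) differentiable at x"
      using C_k_mollifier[of "Suc 0" \<delta>] by (rule C_k_differentiable)
    have "frechet_derivative (mollifier \<delta>) (at x) h = h * Dm x" for h
      using linear_cmul[OF linear_frechet_derivative[OF d], of h 1] by (simp add: Dm_def)
    then have "frechet_derivative (mollifier \<delta>) (at x) = (\<lambda>h. h * Dm x)" by (rule ext)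
    then show ?thesis using d by (simp add: frechet_derivative_works)
  qed
  have cDm: "continuous_on UNIV Dm"
    using C_k_mollifier[of "Suc 0" \<delta>, where 'a = real] by (simp add: Dm_def[abs_def])
  have zm: "mollifier \<delta> x = 0" if "\<delta> \<le> \<bar>x\<bar>" for x :: real
    using mollifier_zero[of \<delta> x] that \<delta> by simp
  have zD: "Dm x = 0" if "\<delta> < \<bar>x\<bar>" for x
  proof -
    have "((\<lambda>x. 0) has_derivative (\<lambda>h. h * Dm x)) (at x)"
      by (rule has_derivative_transform_within_open[OF dm, of "{x. \<delta> < \<bar>x\<bar>}"])
        (use that zm in \<open>auto intro!: open_Collect_less continuous_intros\<close>)
    then have "(\<lambda>h. h * Dm x) = (\<lambda>_. 0)" by (rule has_derivative_unique[OF _ has_derivative_const])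
    from fun_cong[OF this, of 1] show ?thesis by simp
  qed
  define \<eta> where "\<eta> t = mollifier \<delta> (a - t)" for t
  have bdd: "\<exists>H\<ge>0. \<forall>t\<in>{0..T}. \<bar>f t\<bar> \<le> H" if f: "continuous_on {0..T} f" for f :: "real \<Rightarrow> real"
  proof -
    have "bounded (f ` {0..T})" by (intro compact_imp_bounded compact_continuous_image f) auto
    then obtain H where "\<forall>y\<in>f ` {0..T}. norm y \<le> H" unfolding bounded_iff by (elim exE)
    then show ?thesis using T by (intro exI[of _ H]) (auto intro: order_trans[OF abs_ge_zero, of "f 0"])
  qed
  have c\<eta>: "continuous_on S \<eta>" for S unfolding \<eta>_def[abs_def] by (intro continuous_intros)
  have cDa: "continuous_on S (\<lambda>t. Dm (a - t))" for S
    by (rule continuous_on_compose2[OF cDm]) (auto intro!: continuous_intros)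
  obtain H0 where H0: "H0 \<ge> 0" "\<And>t. t \<in> {0..T} \<Longrightarrow> \<bar>\<eta> t\<bar> \<le> H0"
    using bdd[OF c\<eta>] by blast
  obtain H1 where H1: "H1 \<ge> 0" "\<And>t. t \<in> {0..T} \<Longrightarrow> \<bar>Dm (a - t)\<bar> \<le> H1"
    using bdd[OF cDa] by blast
  obtain C where C: "C > 0" "\<And>\<epsilon>. 0 < \<epsilon> \<Longrightarrow> \<epsilon> < 1 \<Longrightarrow> (\<exists>\<Phi> R c. c > 0 \<and> (\<forall>k. C_k k \<Phi>) \<and> (\<forall>p. R \<le> norm p \<longrightarrow> \<Phi> p = 0) \<and>
     (\<forall>t z. 0 \<le> t \<longrightarrow> t \<le> s \<longrightarrow> norm z \<le> P \<longrightarrow> \<bar>\<Phi> (t, z) - dual s g t z * c\<bar> \<le> C * \<epsilon> * c) \<and>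
     (\<forall>t z. \<epsilon> < t \<longrightarrow> t < s - \<epsilon> \<longrightarrow> norm z \<le> P \<longrightarrow> \<bar>frechet_derivative \<Phi> (at (t, z)) (1, v t z)\<bar> \<le> C * \<epsilon> * c))"
    using dual_uniform_mollification by blast
  define I where "I = integral {0..T} (\<lambda>t. moment t * Dm (a - t))"
  \<comment> \<open>The restrictions on \<epsilon> keep the interval of radius \<delta> around a
    inside the times where the directional derivative of the mollified function is
    controlled.\<close>
  have est: "\<bar>I\<bar> \<le> (C * (H0 + H1) * T) * \<epsilon>" if e: "0 < \<epsilon>" "\<epsilon> < 1" "\<epsilon> < a - \<delta>" "\<epsilon> < s - \<delta> - a" for \<epsilon>
  proof -
    obtain \<Phi> R c where c: "c > 0" and Ck: "\<And>k. C_k k \<Phi>" and R: "\<And>p. R \<le> norm p \<Longrightarrow> \<Phi> p = 0"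
      and close: "\<And>t z. 0 \<le> t \<Longrightarrow> t \<le> s \<Longrightarrow> norm z \<le> P \<Longrightarrow> \<bar>\<Phi> (t, z) - dual s g t z * c\<bar> \<le> C * \<epsilon> * c"
      and dir: "\<And>t z. \<epsilon> < t \<Longrightarrow> t < s - \<epsilon> \<Longrightarrow> norm z \<le> P \<Longrightarrow> \<bar>frechet_derivative \<Phi> (at (t, z)) (1, v t z)\<bar> \<le> C * \<epsilon> * c"
      using C(2)[OF e(1,2)] by blast
    have d\<Phi>: "\<Phi> differentiable at p" for p using C_k_differentiable[OF Ck[of "Suc 0"]] .
    have c\<Phi>: "continuous_on UNIV \<Phi>" by (rule C_k_continuous[OF Ck])
    \<comment> \<open>The factor \<eta> supplies the support in time inside (0, T), which \<Phi> by
      itself need not have.\<close>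
    define \<Theta> where "\<Theta> p = \<eta> (fst p) * \<Phi> p" for p :: "real \<times> 'e"
    have test: "test_fun T \<Theta>"
      unfolding test_fun_def
    proof (intro conjI allI)
      have "C_k k (\<lambda>p::real \<times> 'e. bump 0 (\<delta>\<^sup>2 - (a - fst p) \<bullet> (a - fst p)))" for k
      proof (rule C_k_compose_real[where D = bump], rule bump_has_derivative)
        fix k
        have l: "C_k k (\<lambda>p::real \<times> 'e. a + (- fst p))"
          by (intro C_k_add C_k_const C_k_bounded_linear bounded_linear_minus bounded_linear_fst)
        have "C_k k (\<lambda>p::real \<times> 'e. \<delta>\<^sup>2 + (-1) * ((a + (- fst p)) * (a + (- fst p))))"
          by (intro C_k_add C_k_mult C_k_const l)
        then show "C_k k (\<lambda>p::real \<times> 'e. \<delta>\<^sup>2 - (a - fst p) \<bullet> (a - fst p))" by simp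
      qed
      then show "C_k k \<Theta>" for k
        unfolding \<Theta>_def[abs_def] \<eta>_def mollifier_def by (intro C_k_mult Ck)
      have sub: "{p. \<Theta> p \<noteq> 0} \<subseteq> ({a - \<delta>..a + \<delta>} \<times> UNIV) \<inter> cball 0 R"
      proof
        fix p assume "p \<in> {p. \<Theta> p \<noteq> 0}"
        then have "\<eta> (fst p) \<noteq> 0" "\<Phi> p \<noteq> 0" by (auto simp: \<Theta>_def)
        then have "\<bar>a - fst p\<bar> < \<delta>" "norm p < R" using zm R[of p] by (force simp: \<eta>_def not_le)+
        then show "p \<in> ({a - \<delta>..a + \<delta>} \<times> UNIV) \<inter> cball 0 R" by (cases p) auto
      qed
      have cl: "closed (({a - \<delta>..a + \<delta>} \<times> UNIV) \<inter> cball (0 :: real \<times> 'e) R)"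
        by (intro closed_Int closed_Times closed_cball) auto
      have sub2: "fun_supp \<Theta> \<subseteq> ({a - \<delta>..a + \<delta>} \<times> UNIV) \<inter> cball 0 R"
        unfolding fun_supp_def by (rule closure_minimal[OF sub cl])
      then show "fun_supp \<Theta> \<subseteq> {0<..<T} \<times> UNIV" using a s by force
      have "bounded (fun_supp \<Theta>)" by (rule bounded_subset[OF bounded_cball[of 0 R]]) (use sub2 in blast)
      then show "compact (fun_supp \<Theta>)" by (simp add: compact_eq_bounded_closed fun_supp_def)
    qed
    have der: "frechet_derivative \<Theta> (at (t, z)) (1, v t z)
        = (- Dm (a - t)) * \<Phi> (t, z) + \<eta> t * frechet_derivative \<Phi> (at (t, z)) (1, v t z)" for t z
    proof -
      have "((\<lambda>p. \<eta> (fst p)) has_derivative (\<lambda>h. (- fst h) * Dm (a - t))) (at (t, z))"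
      proof -
        have "((\<lambda>p::real \<times> 'e. a - fst p) has_derivative (\<lambda>h. - fst h)) (at (t, z))"
          by (auto intro!: derivative_eq_intros)
        from has_derivative_compose[OF this, of "mollifier \<delta>" "\<lambda>h. h * Dm (a - t)"] dm[of "a - t"]
        show ?thesis unfolding \<eta>_def by simp
      qed
      from has_derivative_mult[OF this d\<Phi>[of "(t, z)", unfolded frechet_derivative_works]]
      have "(\<Theta> has_derivative (\<lambda>h. \<eta> (fst (t, z)) * frechet_derivative \<Phi> (at (t, z)) h + (- fst h) * Dm (a - t) * \<Phi> (t, z))) (at (t, z))"
        unfolding \<Theta>_def[abs_def] .
      from fun_cong[OF frechet_derivative_at[OF this], of "(1, v t z)"] show ?thesis by simp
    qed
    have cV: "continuous_on UNIV (\<lambda>(t, z). frechet_derivative \<Phi> (at (t, z)) (1, v t z))"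
    proof -
      have "continuous_on UNIV (\<lambda>p. blinfun_apply (bderiv \<Phi> p) (1, v (fst p) (snd p)))"
        by (intro continuous_intros cont' C_k_continuous_bderiv[OF Ck])
      then show ?thesis by (simp add: bderiv_apply[OF d\<Phi>] split_beta)
    qed
    define A where "A t = (LINT z|\<mu> t. \<Phi> (t, z))" for t
    define B where "B t = (LINT z|\<mu> t. frechet_derivative \<Phi> (at (t, z)) (1, v t z))" for t
    have jA: "continuous_on ({0..T} \<times> UNIV) (\<lambda>(t, z). \<Phi> (t, z))" using continuous_on_subset[OF c\<Phi>] by simp
    have jB: "continuous_on ({0..T} \<times> UNIV) (\<lambda>(t, z). frechet_derivative \<Phi> (at (t, z)) (1, v t z))"
      by (rule continuous_on_subset[OF cV]) simp
    note iA = continuous_on_integral_mu[OF jA] and iB = continuous_on_integral_mu[OF jB]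
    have cA: "continuous_on {0..T} A" using iA(1) by (simp add: A_def[abs_def])
    have cB: "continuous_on {0..T} B" using iB(1) by (simp add: B_def[abs_def])
    have J: "(LINT z|\<mu> t. frechet_derivative \<Theta> (at (t, z)) (1, v t z)) = (- Dm (a - t)) * A t + \<eta> t * B t"
      if "t \<in> {0..T}" for t
      unfolding der A_def B_def using iA(2)[OF that] iB(2)[OF that] by simp
    have cJ: "continuous_on {0..T} (\<lambda>t. (- Dm (a - t)) * A t + \<eta> t * B t)"
      by (intro continuous_intros cA cB cDa c\<eta>)
    have "(LINT t:{0..T}|lborel. (- Dm (a - t)) * A t + \<eta> t * B t)
        = (LINT t:{0..T}|lborel. (LINT z|\<mu> t. frechet_derivative \<Theta> (at (t, z)) (1, v t z)))"
      by (rule set_lebesgue_integral_cong) (auto simp: J)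
    also have "\<dots> = 0" by (rule weak[OF test])
    finally have J0: "integral {0..T} (\<lambda>t. (- Dm (a - t)) * A t + \<eta> t * B t) = 0"
      using set_borel_integral_eq_integral(2)[OF borel_integrable_atLeastAtMost'[OF cJ]] by (simp only:)
    have cI: "(\<lambda>t. moment t * Dm (a - t)) integrable_on {0..T}"
      by (intro integrable_continuous_real continuous_intros continuous_moment cDa)
    \<comment> \<open>The weak equation enters as an added zero. Combined under one integral, the
      terms leave only A - c moment and B, both of order \<epsilon> c.\<close>
    have "c * I = integral {0..T} (\<lambda>t. c * (moment t * Dm (a - t))) + integral {0..T} (\<lambda>t. (- Dm (a - t)) * A t + \<eta> t * B t)"
      unfolding J0 by (simp add: I_def)
    also have "\<dots> = integral {0..T} (\<lambda>t. c * (moment t * Dm (a - t)) + ((- Dm (a - t)) * A t + \<eta> t * B t))"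
      by (rule integral_add[symmetric])
        (intro integrable_continuous_real continuous_intros continuous_moment cDa cA cB c\<eta>)+
    finally have cIeq: "c * I = integral {0..T} (\<lambda>t. c * (moment t * Dm (a - t)) + ((- Dm (a - t)) * A t + \<eta> t * B t))" .
    have "norm (integral {0..T} (\<lambda>t. c * (moment t * Dm (a - t)) + ((- Dm (a - t)) * A t + \<eta> t * B t)))
       \<le> integral {0..T} (\<lambda>t. C * \<epsilon> * c * (H0 + H1))"
    proof (rule integral_norm_bound_integral)
      show "(\<lambda>t. c * (moment t * Dm (a - t)) + ((- Dm (a - t)) * A t + \<eta> t * B t)) integrable_on {0..T}"
        by (intro integrable_continuous_real continuous_intros continuous_moment cDa cA cB c\<eta>)
      fix t assume t: "t \<in> {0..T}"
      show "norm (c * (moment t * Dm (a - t)) + ((- Dm (a - t)) * A t + \<eta> t * B t)) \<le> C * \<epsilon> * c * (H0 + H1)"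
      proof (cases "\<delta> < \<bar>a - t\<bar>")
        case True
        then have "Dm (a - t) = 0" "\<eta> t = 0" using zD zm[of "a - t"] by (auto simp: \<eta>_def)
        then show ?thesis using C e c H0 H1 by simp
      next
        case False
        then have te: "\<epsilon> < t" "t < s - \<epsilon>" using e by auto
        have "A t - c * moment t = (LINT z|\<mu> t. \<Phi> (t, z) - dual s g t z * c)"
          unfolding A_def moment_def
          using iA(2)[OF t] continuous_on_integral_mu(2)[OF continuous_on_subset[OF continuous_dual] t]
          by simp
        also have "\<bar>\<dots>\<bar> \<le> C * \<epsilon> * c"
          using te e by (intro integral_bound_mu[OF t] close) auto
        finally have 1: "\<bar>A t - c * moment t\<bar> \<le> C * \<epsilon> * c" .
        have 2: "\<bar>B t\<bar> \<le> C * \<epsilon> * c"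
          unfolding B_def by (intro integral_bound_mu[OF t] dir te)
        have "c * (moment t * Dm (a - t)) + ((- Dm (a - t)) * A t + \<eta> t * B t) = - (Dm (a - t) * (A t - c * moment t)) + \<eta> t * B t"
          by (simp add: algebra_simps)
        also have "norm \<dots> \<le> \<bar>Dm (a - t)\<bar> * \<bar>A t - c * moment t\<bar> + \<bar>\<eta> t\<bar> * \<bar>B t\<bar>"
          unfolding real_norm_def by (rule order_trans[OF abs_triangle_ineq]) (simp add: abs_mult)
        also have "\<dots> \<le> H1 * (C * \<epsilon> * c) + H0 * (C * \<epsilon> * c)"
          using 1 2 H0 H1 t by (intro add_mono mult_mono) auto
        finally show ?thesis by (simp add: algebra_simps)
      qed
    qed (rule integrable_const_ivl)
    also have "integral {0..T} (\<lambda>t. C * \<epsilon> * c * (H0 + H1)) = C * \<epsilon> * c * (H0 + H1) * T" using T by simp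
    finally have "\<bar>c * I\<bar> \<le> C * \<epsilon> * c * (H0 + H1) * T" by (simp only: cIeq real_norm_def)
    then have "c * \<bar>I\<bar> \<le> c * ((C * (H0 + H1) * T) * \<epsilon>)" using c by (simp add: abs_mult mult_ac)
    then show ?thesis using c by simp
  qed
  have "I = 0"
  proof (rule ccontr)
    assume "I \<noteq> 0"
    \<comment> \<open>Adding 1 makes Q positive; the choice of \<epsilon> at most |I| / (2 Q) then
      forces |I| to be at most |I| / 2.\<close>
    define Q where "Q = C * (H0 + H1) * T + 1"
    have Q: "Q > 0" using C H0 H1 T by (auto simp: Q_def intro!: add_nonneg_pos)
    define \<epsilon> where "\<epsilon> = min (min (1/2) (\<bar>I\<bar> / (2 * Q))) (min ((a - \<delta>) / 2) ((s - \<delta> - a) / 2))"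
    have e: "0 < \<epsilon>" using \<open>I \<noteq> 0\<close> Q a by (simp add: \<epsilon>_def)
    have "\<bar>I\<bar> \<le> (C * (H0 + H1) * T) * \<epsilon>" by (rule est[OF e]) (use a in \<open>auto simp: \<epsilon>_def min_def\<close>)
    also have "\<dots> \<le> Q * \<epsilon>" using e by (intro mult_right_mono) (auto simp: Q_def)
    also have "\<dots> \<le> Q * (\<bar>I\<bar> / (2 * Q))" using Q by (intro mult_left_mono) (auto simp: \<epsilon>_def)
    also have "\<dots> = \<bar>I\<bar> / 2" using Q by simp
    finally show False using \<open>I \<noteq> 0\<close> by simp
  qed
  then show ?thesis by (simp add: I_def Dm_def)
qed

text \<open>A continuous function with vanishing weak derivative is constant: its mollification has
  derivative 0 between \<delta> and s - \<delta>, and for small \<delta> the mollified values at a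
  and b are close to the original ones times the mass.\<close>

lemma moment_eq:
  assumes "0 < a" "a < s" "0 < b" "b < s"
  shows "moment a = moment b"
proof (rule ccontr)
  assume ne: "moment a \<noteq> moment b"
  define e where "e = \<bar>moment a - moment b\<bar> / 4"
  have e: "e > 0" using ne by (simp add: e_def)
  \<comment> \<open>Mollification expects a function continuous on the whole line; the values on
    [0, T] are unchanged.\<close>
  define m where "m t = moment (max 0 (min T t))" for t
  have m: "m t = moment t" if "t \<in> {0..T}" for t using that by (simp add: m_def)
  have cm: "continuous_on UNIV m"
    unfolding m_def by (rule continuous_on_compose2[OF continuous_moment]) (use T in \<open>auto intro!: continuous_intros\<close>)
  then have "\<exists>d>0. \<forall>q. dist q x < d \<longrightarrow> dist (m q) (m x) < e" for x
    using e unfolding continuous_on_iff by auto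
  then obtain d where d: "\<And>x. d x > 0" "\<And>x q. dist q x < d x \<Longrightarrow> \<bar>m q - m x\<bar> < e"
    unfolding dist_real_def by metis
  define \<delta> where "\<delta> = min (min (d a) (d b)) (min (min a (s - a)) (min b (s - b))) / 2"
  have \<delta>: "0 < \<delta>" "\<delta> < d a" "\<delta> < d b" "\<delta> < a" "a < s - \<delta>" "\<delta> < b" "b < s - \<delta>"
  proof -
    have le: "\<delta> \<le> d a / 2" "\<delta> \<le> d b / 2" "\<delta> \<le> a / 2" "\<delta> \<le> (s - a) / 2" "\<delta> \<le> b / 2" "\<delta> \<le> (s - b) / 2"
      by (simp_all add: \<delta>_def min_le_iff_disj)
    show "0 < \<delta>" using d(1)[of a] d(1)[of b] assms by (simp add: \<delta>_def)
    show "\<delta> < d a" "\<delta> < d b" using le(1,2) d(1)[of a] d(1)[of b] by linarith+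
    show "\<delta> < a" "\<delta> < b" using le(3,5) assms by linarith+
    show "a < s - \<delta>" using le(4) assms(2) by argo
    show "b < s - \<delta>" using le(6) assms(4) by argo
  qed
  \<comment> \<open>Its derivative puts the differentiation on the kernel and is exactly the
    integral that \<open>moment_weak_derivative\<close> annihilates.\<close>
  define G where "G = mollify 0 T m (mollifier \<delta>)"
  have dG: "(G has_real_derivative 0) (at x)" if x: "\<delta> < x" "x < s - \<delta>" for x
  proof -
    have Ck: "C_k 1 (mollifier \<delta> :: real \<Rightarrow> real)" by (rule C_k_mollifier)
    have d: "(G has_derivative (\<lambda>i. mollify 0 T m (\<lambda>x. frechet_derivative (mollifier \<delta>) (at x) i) x)) (at x)"
      unfolding G_def by (rule mollify_has_derivative[OF cm Ck])
    have "mollify 0 T m (\<lambda>x. frechet_derivative (mollifier \<delta>) (at x) 1) x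
        = integral {0..T} (\<lambda>t. moment t * frechet_derivative (mollifier \<delta>) (at (x - t)) 1)"
      unfolding mollify_def cbox_interval by (rule integral_cong) (simp add: m)
    also have "\<dots> = 0" by (rule moment_weak_derivative[OF \<delta>(1) x])
    finally have z: "mollify 0 T m (\<lambda>x. frechet_derivative (mollifier \<delta>) (at x) 1) x = 0" .
    have "(\<lambda>i. mollify 0 T m (\<lambda>x. frechet_derivative (mollifier \<delta>) (at x) i) x) = (*) 0"
      using linear_cmul[OF has_derivative_linear[OF d], of _ 1] z by (intro ext) simp
    then show ?thesis using d by (simp only: has_field_derivative_def)
  qed
  have "\<exists>k. \<forall>x\<in>{\<delta><..<s - \<delta>}. G x = k"
  proof (rule has_field_derivative_zero_constant)
    fix x assume "x \<in> {\<delta><..<s - \<delta>}"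
    then have "(G has_real_derivative 0) (at x)" by (intro dG) simp_all
    then show "(G has_real_derivative 0) (at x within {\<delta><..<s - \<delta>})"
      by (rule has_field_derivative_at_within)
  qed simp
  then obtain k where k: "\<forall>x\<in>{\<delta><..<s - \<delta>}. G x = k" ..
  have "a \<in> {\<delta><..<s - \<delta>}" "b \<in> {\<delta><..<s - \<delta>}" using \<delta>(4-7) by simp_all
  then have Gab: "G a = G b" by (simp only: bspec[OF k])
  define c where "c = moll_mass TYPE(real) \<delta>"
  have c: "c > 0" unfolding c_def by (rule moll_mass_pos[OF \<delta>(1)])
  have cl: "\<bar>G x - m x * c\<bar> \<le> e * c" if x: "\<delta> < x" "x < s - \<delta>" "\<delta> < d x" for x
    unfolding G_def c_def
  proof (rule mollify_close[OF cm])
    show "0 \<le> \<delta>" using \<delta>(1) by simp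
    show "cball x \<delta> \<subseteq> cbox 0 T" using x(1,2) s(2) by (auto simp only: cball_eq_atLeastAtMost cbox_interval atLeastAtMost_iff)
    show "\<bar>m q - m x\<bar> \<le> e" if "q \<in> cball x \<delta>" for q
    proof (rule less_imp_le, rule d(2))
      show "dist q x < d x" using that x(3) by (simp only: mem_cball dist_commute)
    qed
  qed
  have "\<bar>m a * c - m b * c\<bar> \<le> (2 * e) * c"
    using cl[OF \<delta>(4,5,2)] cl[OF \<delta>(6,7,3)] unfolding Gab by linarith
  then have "\<bar>m a - m b\<bar> * c \<le> (2 * e) * c"
    using c by (simp add: left_diff_distrib[symmetric] abs_mult)
  then have "\<bar>m a - m b\<bar> \<le> 2 * e"
    using c by simp
  then show False using e assms s by (simp add: e_def m)
qed

text \<open>Interior constancy of \<open>moment\<close> extends to the closed interval by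
  continuity. At time 0 \<open>dual\<close> is g composed with the flow, at time s it is g.\<close>

lemma dual_pairing: "(LINT z|\<mu> 0. g (ode_flow v 0 s z)) = (LINT z|\<mu> s. g z)"
proof -
  have c: "continuous_on {0..s} moment" using continuous_on_subset[OF continuous_moment] s by simp
  have cl: "closure {0<..<s} = {0..s}" using s by simp
  have "moment x = moment (s / 2)" if "x \<in> {0..s}" for x
  proof (rule continuous_constant_on_closure[where S = "{0<..<s}" and f = moment])
    show "moment y = moment (s / 2)" if "y \<in> {0<..<s}" for y
      by (rule moment_eq) (use that s in simp_all)
  qed (use c that cl in simp_all)
  from this[of 0] this[of s] have "moment 0 = moment s" using s by simp
  then show ?thesis using s by (simp add: moment_def dual_def)
qed

end

text \<open>\<open>dual_pairing\<close> says that both measures integrate every Lipschitz function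
  alike. Time 0 is separate, since the pairing is set up for positive s only.\<close>

theorem mu_eq_distr_flow:
  assumes s: "s \<in> {0..T}"
  shows "\<mu> s = distr (\<mu> 0) borel (ode_flow v 0 s)"
proof (rule prob_measure_eqI_lipschitz)
  have 0: "\<mu> 0 \<in> P_c" using mu_P_c T by simp
  have cf: "continuous_on UNIV (ode_flow v 0 s)" using s by (intro continuous_on_ode_flow) simp
  then have m: "ode_flow v 0 s \<in> borel_measurable (\<mu> 0)"
    using borel_measurable_continuous_onI measurable_cong_sets[OF P_cD(1)[OF 0] refl] by blast
  show "sets (\<mu> s) = sets borel" "prob_space (\<mu> s)" using P_cD mu_P_c[OF s] by auto
  show "prob_space (distr (\<mu> 0) borel (ode_flow v 0 s))"
    by (rule prob_space.prob_space_distr[OF P_cD(2)[OF 0] m])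
  fix g :: "'e \<Rightarrow> real" and K assume K: "K > 0" "\<And>x y. \<bar>g x - g y\<bar> \<le> K * dist x y"
  have "continuous_on UNIV g"
    by (rule lipschitz_on_continuous_on[of K], rule lipschitz_onI) (use K in \<open>auto simp: dist_real_def\<close>)
  then have gm: "g \<in> borel_measurable borel" by (rule borel_measurable_continuous_onI)
  have "(LINT z|\<mu> s. g z) = (LINT z|\<mu> 0. g (ode_flow v 0 s z))"
    using dual_pairing[OF _ _ K] s by (cases "s = 0") auto
  then show "(LINT x|\<mu> s. g x) = (LINT x|distr (\<mu> 0) borel (ode_flow v 0 s). g x)"
    by (simp add: integral_distr[OF m gm])
qed simp

end

section \<open>Transport along the flow and second differences\<close>

context lipschitz_field
begin

text \<open>The function \<psi> is differentiable in time at fixed points and C^1 in space at fixed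
  times, which alone does not justify the chain rule along a moving point. Uniformity of the time
  difference quotients in space closes this gap.\<close>

lemma transport_along_flow:
  fixes \<psi> \<psi>' :: "real \<Rightarrow> 'a \<Rightarrow> real"
  assumes T: "T > 0" and C: "\<And>t. t \<in> {0..T} \<Longrightarrow> C_k (Suc 0) (\<psi> t)"
    and ul: "\<And>t. t \<in> {0..T} \<Longrightarrow>
      uniform_limit UNIV (\<lambda>s z. (\<psi> s z - \<psi> t z) / (s - t)) (\<psi>' t) (at t within {0..T})"
    and eq: "\<And>t z. t \<in> {0..T} \<Longrightarrow>
      ((\<lambda>s. \<psi> s z) has_real_derivative - frechet_derivative (\<psi> t) (at z) (v t z)) (at t within {0..T})"
    and t: "t \<in> {0..T}"
  shows "\<psi> t z = \<psi> T (ode_flow v t T z)"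
proof -
  define X where "X s = ode_flow v t s z" for s
  have dX: "(X has_vector_derivative v r (X r)) (at r within {t..T})" if "r \<in> {t..T}" for r
    unfolding X_def by (rule ode_flow_has_vector_derivative[OF that])
  have nt: "at r within {0..T} \<noteq> bot" if "r \<in> {0..T}" for r
    using that T trivial_limit_within[of r "{0..T}"] by simp
  have dh: "((\<lambda>s. \<psi> s (X s)) has_real_derivative 0) (at r within {t..T})" if r: "r \<in> {t..T}" for r
  proof -
    have r0: "r \<in> {0..T}" using r t by auto
    have sub: "at r within {t..T} \<le> at r within {0..T}" using t by (intro at_le) auto
    \<comment> \<open>The time derivative is a uniform limit of continuous difference quotients,
      hence continuous in space.\<close>
    have cr: "continuous_on UNIV (\<psi>' r)"
    proof (rule uniform_limit_theorem[OF _ ul[OF r0] nt[OF r0]])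
      have "\<forall>\<^sub>F s in at r within {0..T}. s \<in> {0..T}" by (simp add: eventually_at_filter)
      then show "\<forall>\<^sub>F s in at r within {0..T}. continuous_on UNIV (\<lambda>z. (\<psi> s z - \<psi> r z) / (s - r))"
      proof eventually_elim
        case (elim s)
        show ?case
          unfolding divide_inverse
          by (intro continuous_on_mult continuous_on_diff C_k_continuous[OF C] continuous_on_const r0 elim)
      qed
    qed
    have "((\<lambda>s. (\<psi> s (X r) - \<psi> r (X r)) / (s - r)) \<longlongrightarrow> \<psi>' r (X r)) (at r within {0..T})"
      by (rule tendsto_uniform_limitI[OF ul[OF r0]]) simp
    then have val: "\<psi>' r (X r) = - frechet_derivative (\<psi> r) (at (X r)) (v r (X r))"
      using eq[OF r0, of "X r"] tendsto_unique[OF nt[OF r0]] by (auto simp: has_field_derivative_iff)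
    have lX: "(X \<longlongrightarrow> X r) (at r within {t..T})"
      using has_vector_derivative_continuous[OF dX[OF r]] by (simp add: continuous_within)
    \<comment> \<open>The time increment is taken at the moving point \<open>X s\<close>: uniform
      convergence replaces the quotient by the derivative there, and continuity of the derivative
      moves the point to \<open>X r\<close>.\<close>
    have l1: "((\<lambda>s. (\<psi> s (X s) - \<psi> r (X s)) / (s - r)) \<longlongrightarrow> \<psi>' r (X r)) (at r within {t..T})"
    proof -
      have "((\<lambda>s. (\<psi> s (X s) - \<psi> r (X s)) / (s - r) - \<psi>' r (X s)) \<longlongrightarrow> 0) (at r within {t..T})"
      proof (rule tendstoI)
        fix e :: real assume "e > 0"
        have "\<forall>\<^sub>F s in at r within {t..T}. \<forall>z\<in>UNIV. dist ((\<psi> s z - \<psi> r z) / (s - r)) (\<psi>' r z) < e"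
          using uniform_limitD[OF ul[OF r0] \<open>e > 0\<close>] sub by (rule filter_leD[rotated])
        then show "\<forall>\<^sub>F s in at r within {t..T}. dist ((\<psi> s (X s) - \<psi> r (X s)) / (s - r) - \<psi>' r (X s)) 0 < e"
          by eventually_elim (simp add: dist_real_def)
      qed
      moreover have "((\<lambda>s. \<psi>' r (X s)) \<longlongrightarrow> \<psi>' r (X r)) (at r within {t..T})"
        using continuous_on_tendsto_compose[OF cr lX] by simp
      ultimately have "((\<lambda>s. ((\<psi> s (X s) - \<psi> r (X s)) / (s - r) - \<psi>' r (X s)) + \<psi>' r (X s)) \<longlongrightarrow> 0 + \<psi>' r (X r)) (at r within {t..T})"
        by (rule tendsto_add)
      then show ?thesis by simp
    qed
    have "(\<psi> r has_derivative frechet_derivative (\<psi> r) (at (X r))) (at (X r))"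
      using C_k_differentiable[OF C[OF r0]] by (simp add: frechet_derivative_works)
    from vector_derivative_diff_chain_within[OF dX[OF r] has_derivative_at_withinI[OF this]]
    have "((\<lambda>s. \<psi> r (X s)) has_real_derivative frechet_derivative (\<psi> r) (at (X r)) (v r (X r))) (at r within {t..T})"
      by (simp add: o_def has_real_derivative_iff_has_vector_derivative)
    then have l2: "((\<lambda>s. (\<psi> r (X s) - \<psi> r (X r)) / (s - r)) \<longlongrightarrow> frechet_derivative (\<psi> r) (at (X r)) (v r (X r))) (at r within {t..T})"
      by (simp add: has_field_derivative_iff)
    have "((\<lambda>s. (\<psi> s (X s) - \<psi> r (X s)) / (s - r) + (\<psi> r (X s) - \<psi> r (X r)) / (s - r)) \<longlongrightarrow> 0) (at r within {t..T})"
      using tendsto_add[OF l1 l2] val by simp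
    then show ?thesis
      by (simp add: has_field_derivative_iff add_divide_distrib[symmetric])
  qed
  have "\<exists>c. \<forall>s\<in>{t..T}. \<psi> s (X s) = c"
    by (rule has_field_derivative_zero_constant) (use dh in simp_all)
  then have "\<psi> t (X t) = \<psi> T (X T)" using t by auto
  then show ?thesis by (simp add: X_def)
qed

end

section \<open>Mean value estimates and second differences\<close>

lemma segment_bound:
  fixes f :: "real \<Rightarrow> 'b::real_normed_vector"
  assumes "\<And>\<tau>. \<tau> \<in> {0..1} \<Longrightarrow> (f has_vector_derivative f' \<tau>) (at \<tau> within {0..1})"
    and "\<And>\<tau>. \<tau> \<in> {0..1} \<Longrightarrow> norm (f' \<tau>) \<le> B"
  shows "norm (f 1 - f 0) \<le> B"
proof -
  have B: "B \<ge> 0" using order_trans[OF norm_ge_zero assms(2)[of 0]] by simp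
  have "norm (f 1 - f 0) \<le> B * norm (1 - 0 :: real)"
  proof (rule differentiable_bound[of "{0..1}"])
    show "(f has_derivative (\<lambda>h. h *\<^sub>R f' x)) (at x within {0..1})" if "x \<in> {0..1}" for x
      using assms(1)[OF that] by (simp add: has_vector_derivative_def)
    show "onorm (\<lambda>h. h *\<^sub>R f' x) \<le> B" if "x \<in> {0..1}" for x
      by (rule onorm_bound[OF B]) (use assms(2)[OF that] in \<open>simp add: mult.commute[of B] mult_left_mono\<close>)
  qed auto
  then show ?thesis by simp
qed

lemma segment_derivative:
  assumes "convex S" "x \<in> S" "y \<in> S" "\<tau> \<in> {0..1}"
    and "\<And>x. x \<in> S \<Longrightarrow> (f has_derivative blinfun_apply (f' x)) (at x)"
  shows "((\<lambda>\<tau>. f (y + \<tau> *\<^sub>R (x - y))) has_vector_derivative f' (y + \<tau> *\<^sub>R (x - y)) (x - y)) (at \<tau> within {0..1})"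
proof -
  have "y + \<tau> *\<^sub>R (x - y) = (1 - \<tau>) *\<^sub>R y + \<tau> *\<^sub>R x" by (simp add: algebra_simps)
  then have "y + \<tau> *\<^sub>R (x - y) \<in> S" using assms by (simp add: convex_alt)
  then have d: "(f has_derivative blinfun_apply (f' (y + \<tau> *\<^sub>R (x - y)))) (at (y + \<tau> *\<^sub>R (x - y)))" by (rule assms)
  have "((\<lambda>\<tau>. y + \<tau> *\<^sub>R (x - y)) has_vector_derivative (x - y)) (at \<tau> within {0..1})"
    by (auto intro!: derivative_eq_intros)
  from vector_derivative_diff_chain_within[OF this has_derivative_at_withinI[OF d]]
  show ?thesis by (simp add: o_def)
qed

text \<open>The mean value inequality for the difference of f along two segments, from x2 to x1 and
  from x4 to x3, run through simultaneously. The derivative splits into one factor containing the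
  second difference of the points and one containing the distance of the segments, so a Lipschitz
  derivative suffices.\<close>

lemma quadruple_bound:
  assumes S: "convex S" and d: "\<And>x. x \<in> S \<Longrightarrow> (f has_derivative blinfun_apply (f' x)) (at x)"
    and B: "\<And>x. x \<in> S \<Longrightarrow> norm (f' x) \<le> B" and K: "\<And>x y. x \<in> S \<Longrightarrow> y \<in> S \<Longrightarrow> norm (f' x - f' y) \<le> K * norm (x - y)"
    and x: "x1 \<in> S" "x2 \<in> S" "x3 \<in> S" "x4 \<in> S" and K0: "K \<ge> 0"
  shows "norm (f x1 - f x2 - f x3 + f x4)
    \<le> B * norm (x1 - x2 - x3 + x4) + K * (norm (x1 - x3) + norm (x2 - x4)) * norm (x3 - x4)"
proof -
  define p where "p \<tau> = x2 + \<tau> *\<^sub>R (x1 - x2)" for \<tau>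
  define q where "q \<tau> = x4 + \<tau> *\<^sub>R (x3 - x4)" for \<tau>
  let ?g = "\<lambda>\<tau>. f (p \<tau>) - f (q \<tau>)"
  have "norm (?g 1 - ?g 0) \<le> B * norm (x1 - x2 - x3 + x4) + K * (norm (x1 - x3) + norm (x2 - x4)) * norm (x3 - x4)"
  proof (rule segment_bound)
    fix \<tau> :: real assume t: "\<tau> \<in> {0..1}"
    show "(?g has_vector_derivative f' (p \<tau>) (x1 - x2) - f' (q \<tau>) (x3 - x4)) (at \<tau> within {0..1})"
      unfolding p_def q_def by (intro has_vector_derivative_diff segment_derivative[OF S _ _ t d] x)
    have "p \<tau> = (1 - \<tau>) *\<^sub>R x2 + \<tau> *\<^sub>R x1" "q \<tau> = (1 - \<tau>) *\<^sub>R x4 + \<tau> *\<^sub>R x3" by (simp_all add: p_def q_def algebra_simps)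
    then have pq: "p \<tau> \<in> S" "q \<tau> \<in> S" using S x t by (simp_all add: convex_alt)
    have "f' (p \<tau>) (x1 - x2) - f' (q \<tau>) (x3 - x4) = f' (p \<tau>) (x1 - x2 - x3 + x4) + (f' (p \<tau>) - f' (q \<tau>)) (x3 - x4)"
      by (simp add: blinfun.bilinear_simps)
    also have "norm \<dots> \<le> norm (f' (p \<tau>)) * norm (x1 - x2 - x3 + x4) + norm (f' (p \<tau>) - f' (q \<tau>)) * norm (x3 - x4)"
      by (rule order_trans[OF norm_triangle_ineq add_mono[OF norm_blinfun norm_blinfun]])
    also have "\<dots> \<le> B * norm (x1 - x2 - x3 + x4) + K * (norm (x1 - x3) + norm (x2 - x4)) * norm (x3 - x4)"
    proof (intro add_mono mult_right_mono)
      show "norm (f' (p \<tau>)) \<le> B" by (rule B[OF pq(1)])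
      have "p \<tau> - q \<tau> = \<tau> *\<^sub>R (x1 - x3) + (1 - \<tau>) *\<^sub>R (x2 - x4)" by (simp add: p_def q_def algebra_simps)
      also have "norm \<dots> \<le> \<tau> * norm (x1 - x3) + (1 - \<tau>) * norm (x2 - x4)"
        using t norm_triangle_ineq[of "\<tau> *\<^sub>R (x1 - x3)" "(1 - \<tau>) *\<^sub>R (x2 - x4)"] by simp
      also have "\<dots> \<le> 1 * norm (x1 - x3) + 1 * norm (x2 - x4)"
        using t by (intro add_mono mult_right_mono) auto
      finally have "norm (p \<tau> - q \<tau>) \<le> norm (x1 - x3) + norm (x2 - x4)" by simp
      then show "norm (f' (p \<tau>) - f' (q \<tau>)) \<le> K * (norm (x1 - x3) + norm (x2 - x4))"
        by (intro order_trans[OF K[OF pq] mult_left_mono[OF _ K0]])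
    qed auto
    finally show "norm (f' (p \<tau>) (x1 - x2) - f' (q \<tau>) (x3 - x4))
      \<le> B * norm (x1 - x2 - x3 + x4) + K * (norm (x1 - x3) + norm (x2 - x4)) * norm (x3 - x4)" .
  qed
  then show ?thesis by (simp add: p_def q_def algebra_simps)
qed

lemma bderiv_bound_lipschitz:
  assumes S: "convex S" and d: "\<And>x. x \<in> S \<Longrightarrow> f differentiable (at x)" and B: "\<And>x. x \<in> S \<Longrightarrow> norm (bderiv f x) \<le> B"
    and x: "x \<in> S" "y \<in> S"
  shows "norm (f x - f y) \<le> B * norm (x - y)"
proof (rule differentiable_bound[OF S, of f "\<lambda>x. blinfun_apply (bderiv f x)"])
  show "(f has_derivative blinfun_apply (bderiv f x)) (at x within S)" if "x \<in> S" for x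
    by (rule has_derivative_at_withinI[OF bderiv_has_derivative[OF d[OF that]]])
  show "onorm (blinfun_apply (bderiv f x)) \<le> B" if "x \<in> S" for x
    using B[OF that] by (simp add: norm_blinfun.rep_eq)
qed (use x in simp_all)

lemma fun_supp_frechet_derivative: "fun_supp (\<lambda>x. frechet_derivative f (at x) i) \<subseteq> fun_supp f"
proof -
  have "frechet_derivative f (at x) i = 0" if "x \<notin> fun_supp f" for x
  proof -
    have "((\<lambda>x. 0) has_derivative (\<lambda>_. 0)) (at x)" by simp
    then have "(f has_derivative (\<lambda>_. 0)) (at x)"
    proof (rule has_derivative_transform_within_open[of _ _ _ UNIV "- fun_supp f"])
      show "0 = f y" if "y \<in> - fun_supp f" for y
        using that closure_subset[of "{x. f x \<noteq> 0}"] by (auto simp: fun_supp_def)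
    qed (use that in \<open>auto simp: fun_supp_def\<close>)
    from frechet_derivative_at[OF this] show ?thesis by (metis)
  qed
  then show ?thesis
    unfolding fun_supp_def[of "\<lambda>x. frechet_derivative f (at x) i"]
    by (intro closure_minimal) (auto simp: fun_supp_def)
qed

lemma compact_support_bounded_bderiv:
  assumes C: "C_k (Suc k) f" and c: "compact (fun_supp f)"
  shows "\<exists>B\<ge>0. \<forall>x. norm (bderiv f x) \<le> B"
proof -
  have "bounded (bderiv f ` fun_supp f)"
    by (intro compact_imp_bounded compact_continuous_image c continuous_on_subset[OF C_k_continuous_bderiv[OF C]]) auto
  then obtain B where B: "\<forall>y\<in>bderiv f ` fun_supp f. norm y \<le> B" unfolding bounded_iff by (elim exE)
  have "norm (bderiv f x) \<le> max 0 B" for x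
  proof (cases "x \<in> fun_supp f")
    case True
    then show ?thesis using B by force
  next
    case False
    have "frechet_derivative f (at x) i = 0" for i
    proof (rule ccontr)
      assume "frechet_derivative f (at x) i \<noteq> 0"
      then have "x \<in> fun_supp (\<lambda>x. frechet_derivative f (at x) i)"
        unfolding fun_supp_def using closure_subset by fastforce
      then show False using fun_supp_frechet_derivative False by blast
    qed
    then have "bderiv f x = 0"
      by (intro blinfun_eqI) (simp add: bderiv_apply[OF C_k_differentiable[OF C]])
    then show ?thesis by simp
  qed
  then show ?thesis by (intro exI[of _ "max 0 B"]) auto
qed

text \<open>Compact support makes the continuous first and second partial derivatives bounded; the
  Lipschitz bound for the full derivative is summed up from those of its partial
  derivatives.\<close>

lemma C2c_bounds:
  fixes f :: "'a::euclidean_space \<Rightarrow> real"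
  assumes "C2c f"
  obtains B where "B > 0" "\<And>x. norm (bderiv f x) \<le> B" "\<And>x y. norm (bderiv f x - bderiv f y) \<le> B * norm (x - y)"
    "\<And>x y. \<bar>f x - f y\<bar> \<le> B * norm (x - y)"
proof -
  have C: "C_k (Suc (Suc 0)) f" and c: "compact (fun_supp f)" using assms by (simp_all add: C2c_def numeral_2_eq_2)
  obtain B1 where B1: "B1 \<ge> 0" "\<And>x. norm (bderiv f x) \<le> B1" using compact_support_bounded_bderiv[OF C c] by blast
  have "\<exists>B\<ge>0. \<forall>x. norm (bderiv (\<lambda>x. frechet_derivative f (at x) i) x) \<le> B" if "i \<in> Basis" for i
  proof (rule compact_support_bounded_bderiv[where k = 0])
    show "C_k (Suc 0) (\<lambda>x. frechet_derivative f (at x) i)" by (rule C_k_partial[OF C that])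
    have "closed (fun_supp (\<lambda>x. frechet_derivative f (at x) i))" by (simp add: fun_supp_def)
    then show "compact (fun_supp (\<lambda>x. frechet_derivative f (at x) i))"
      using c fun_supp_frechet_derivative[of f i] by (meson closed_Int_compact compact_eq_bounded_closed bounded_subset)
  qed
  then obtain b where b: "\<And>i. i \<in> Basis \<Longrightarrow> b i \<ge> 0"
    "\<And>i x. i \<in> Basis \<Longrightarrow> norm (bderiv (\<lambda>x. frechet_derivative f (at x) i) x) \<le> b i" by metis
  have K: "norm (bderiv f x - bderiv f y) \<le> (\<Sum>i\<in>Basis. b i) * norm (x - y)" for x y
  proof -
    have "norm (bderiv f x - bderiv f y) \<le> (\<Sum>i\<in>Basis. norm ((bderiv f x - bderiv f y) i))"
      by (rule norm_blinfun_euclidean_le)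
    also have "\<dots> \<le> (\<Sum>i\<in>Basis. b i * norm (x - y))"
    proof (rule sum_mono)
      fix i :: 'a assume i: "i \<in> Basis"
      have C1: "C_k (Suc 0) (\<lambda>x. frechet_derivative f (at x) i)" by (rule C_k_partial[OF C i])
      have "norm (frechet_derivative f (at x) i - frechet_derivative f (at y) i) \<le> b i * norm (x - y)"
        by (rule bderiv_bound_lipschitz[of UNIV]) (use b i C_k_differentiable[OF C1] in auto)
      then show "norm ((bderiv f x - bderiv f y) i) \<le> b i * norm (x - y)"
        by (simp add: blinfun.bilinear_simps bderiv_apply[OF C_k_differentiable[OF C]])
    qed
    finally show ?thesis by (simp add: sum_distrib_right)
  qed
  define B where "B = B1 + (\<Sum>i\<in>Basis. b i) + 1"
  have s0: "(\<Sum>i\<in>Basis. b i) \<ge> 0" using b by (intro sum_nonneg)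
  show thesis
  proof (rule that[of B])
    show "B > 0" using B1 s0 by (simp add: B_def)
    show B2: "norm (bderiv f x) \<le> B" for x using B1(2)[of x] s0 by (simp add: B_def)
    show "norm (bderiv f x - bderiv f y) \<le> B * norm (x - y)" for x y
      using B1 by (intro order_trans[OF K]) (auto simp: B_def intro!: mult_right_mono)
    show "\<bar>f x - f y\<bar> \<le> B * norm (x - y)" for x y
      using bderiv_bound_lipschitz[of UNIV f B x y] C_k_differentiable[OF C] B2 by simp
  qed
qed

text \<open>\<open>C_k\<close> speaks of partial derivatives, whereas the hypotheses on
  \<open>F\<close> bound the derivative of the operator-valued derivative. The operator is a sum of
  rank-one maps with partial derivatives as coefficients.\<close>

lemma bderiv_differentiable:
  fixes f :: "'a::euclidean_space \<Rightarrow> 'b::real_normed_vector"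
  assumes C: "C_k (Suc (Suc 0)) f"
  shows "bderiv f differentiable at x"
proof -
  let ?e = "\<lambda>i c. blinfun_scaleR_left c o\<^sub>L blinfun_inner_left i :: 'a \<Rightarrow>\<^sub>L 'b"
  have "bderiv f = (\<lambda>x. \<Sum>i\<in>Basis. ?e i (frechet_derivative f (at x) i))"
  proof (intro ext blinfun_euclidean_eqI)
    fix x :: 'a and j :: 'a assume j: "j \<in> Basis"
    have "blinfun_apply (\<Sum>i\<in>Basis. ?e i (frechet_derivative f (at x) i)) j
      = (\<Sum>i\<in>Basis. (i \<bullet> j) *\<^sub>R frechet_derivative f (at x) i)"
      by (simp add: blinfun.sum_left inner_commute)
    also have "\<dots> = (\<Sum>i\<in>Basis. if i = j then frechet_derivative f (at x) i else 0)"
      by (rule sum.cong) (use j in \<open>auto simp: inner_Basis\<close>)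
    also have "\<dots> = frechet_derivative f (at x) j" using j by simp
    finally show "blinfun_apply (bderiv f x) j = blinfun_apply (\<Sum>i\<in>Basis. ?e i (frechet_derivative f (at x) i)) j"
      by (simp add: bderiv_apply[OF C_k_differentiable[OF C]])
  qed
  moreover have "(\<lambda>x. \<Sum>i\<in>Basis. ?e i (frechet_derivative f (at x) i)) differentiable at x"
  proof (rule differentiable_sum)
    show "\<forall>i\<in>Basis. (\<lambda>x. ?e i (frechet_derivative f (at x) i)) differentiable at x"
    proof
      fix i :: 'a assume "i \<in> Basis"
      then have "(\<lambda>x. frechet_derivative f (at x) i) differentiable at x"
        using C_k_differentiable[OF C_k_partial[OF C]] by blast
      then obtain D where "((\<lambda>x. frechet_derivative f (at x) i) has_derivative D) (at x)" by (auto simp: differentiable_def)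
      moreover have "bounded_linear (?e i)"
        by (intro bounded_linear_compose[OF bounded_bilinear.bounded_linear_left[OF bounded_bilinear_blinfun_compose]] bounded_linear_blinfun_scaleR_left)
      ultimately have "((\<lambda>x. ?e i (frechet_derivative f (at x) i)) has_derivative (\<lambda>h. ?e i (D h))) (at x)"
        by (rule bounded_linear.has_derivative[rotated])
      then show "(\<lambda>x. ?e i (frechet_derivative f (at x) i)) differentiable at x" by (auto simp: differentiable_def)
    qed
  qed auto
  ultimately show ?thesis by simp
qed

text \<open>The times satisfying the bound form a closed set of full measure in the open interval,
  hence contain it; continuity adds the end points.\<close>

lemma AE_Icc_le:
  fixes f :: "real \<Rightarrow> real"
  assumes T: "T > 0" and f: "continuous_on {0..T} f" and ae: "AE t\<in>{0..T} in lborel. f t \<le> c" and t: "t \<in> {0..T}"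
  shows "f t \<le> c"
proof -
  have f': "continuous_on UNIV (\<lambda>t. f (max 0 (min T t)))"
    by (rule continuous_on_compose2[OF f]) (use T in \<open>auto intro!: continuous_intros\<close>)
  have "closed {t. f (max 0 (min T t)) \<le> c}"
    by (intro closed_Collect_le f' continuous_intros)
  moreover have "AE t in lebesgue. t \<in> {0<..<T} \<longrightarrow> t \<in> {t. f (max 0 (min T t)) \<le> c}"
    using ae by (intro AE_completion) (auto elim!: eventually_mono)
  ultimately have o: "f t \<le> c" if "t \<in> {0<..<T}" for t
    using mem_closed_if_AE_lebesgue_open[of "{0<..<T}" "{t. f (max 0 (min T t)) \<le> c}" t] that by auto
  have "closure {0<..<T} = {0..T}" using T by simp
  then show ?thesis
    using continuous_le_on_closure[of "{0<..<T}" f t c] f o t by auto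
qed

lemma grad_x_inner:
  fixes g :: "(real ^ 'd) \<times> (real ^ 'd) \<Rightarrow> real"
  assumes "g differentiable at z"
  shows "grad_x g z \<bullet> w = frechet_derivative g (at z) (w, 0)"
proof -
  have "(g has_derivative frechet_derivative g (at z)) (at (fst z, snd z))"
    using assms by (simp add: frechet_derivative_works)
  moreover have "((\<lambda>x. (x, snd z)) has_derivative (\<lambda>h. (h, 0))) (at (fst z))"
    by (auto intro!: derivative_eq_intros)
  ultimately have "((\<lambda>x. g (x, snd z)) has_derivative (\<lambda>h. frechet_derivative g (at z) (h, 0))) (at (fst z))"
    using has_derivative_compose by fastforce
  from frechet_derivative_at[OF this]
  have d: "frechet_derivative (\<lambda>x. g (x, snd z)) (at (fst z)) = (\<lambda>h. frechet_derivative g (at z) (h, 0))" by simp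
  define A where "A h = frechet_derivative g (at z) (h, 0)" for h
  have lin: "linear A"
    unfolding A_def using linear_compose[of "\<lambda>h. (h, 0)", OF _ linear_frechet_derivative[OF assms]]
    by (simp add: o_def linear_iff)
  have "A w = A (\<Sum>k\<in>UNIV. (w $ k) *\<^sub>R axis k 1)"
    using basis_expansion[of w] by (simp add: scalar_mult_eq_scaleR)
  also have "\<dots> = (\<Sum>k\<in>UNIV. w $ k * A (axis k 1))"
    by (simp add: linear_sum[OF lin] linear_cmul[OF lin])
  finally show ?thesis by (simp add: grad_x_def d inner_vec_def mult.commute A_def)
qed

section \<open>Controlled systems\<close>

definition clamp :: "real \<Rightarrow> real \<Rightarrow> real" where
  "clamp T t = max 0 (min T t)"

lemma clamp_id: "t \<in> {0..T} \<Longrightarrow> clamp T t = t"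
  by (simp add: clamp_def)

lemma clamp_mem: "T > 0 \<Longrightarrow> clamp T t \<in> {0..T}"
  by (simp add: clamp_def)

lemma clamp_lipschitz: "\<bar>clamp T t - clamp T s\<bar> \<le> \<bar>t - s\<bar>"
  by (simp add: clamp_def)

text \<open>The velocity field on the product space, with \<open>y\<close> as a frozen coordinate. Clamping the time
  makes it globally Lipschitz without touching its values on \<open>[0,T]\<close>.\<close>

definition control_field ::
  "real \<Rightarrow> (real \<Rightarrow> real ^ 'd \<Rightarrow> real ^ 'm \<Rightarrow> real ^ 'd) \<Rightarrow> (real \<Rightarrow> real ^ 'm)
    \<Rightarrow> real \<Rightarrow> (real ^ 'd) \<times> (real ^ 'd) \<Rightarrow> (real ^ 'd) \<times> (real ^ 'd)" where
  "control_field T F \<theta> t z = (F (clamp T t) (fst z) (\<theta> (clamp T t)), 0)"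

lemma norm_Pair_zero [simp]: "norm (x, 0) = norm x"
  by (simp add: norm_Pair)

lemma directional_derivative_tendsto:
  fixes g :: "'a::real_normed_vector \<Rightarrow> real"
  assumes d: "g differentiable at z"
  shows "((\<lambda>h. (g (z + h *\<^sub>R w) - g z) / h) \<longlongrightarrow> frechet_derivative g (at z) w) (at 0)"
proof -
  have l1: "((\<lambda>h. z + h *\<^sub>R w) has_vector_derivative w) (at 0)"
    by (auto intro!: derivative_eq_intros)
  have l2: "(g has_derivative frechet_derivative g (at z)) (at (z + 0 *\<^sub>R w) within X)" for X
    using d by (simp add: frechet_derivative_works has_derivative_at_withinI)
  have "((\<lambda>h. g (z + h *\<^sub>R w)) has_vector_derivative frechet_derivative g (at z) w) (at 0)"
    using vector_derivative_diff_chain_within[OF l1 l2] by (simp add: o_def)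
  then show ?thesis
    by (simp add: has_real_derivative_iff_has_vector_derivative[symmetric] has_field_derivative_iff)
qed

text \<open>Directional derivatives inherit the Lipschitz bound. In the direction of the gradient u
  itself this reads |u|^2 \<le> B |u|.\<close>

lemma norm_grad_x_le:
  fixes g :: "(real ^ 'd) \<times> (real ^ 'd) \<Rightarrow> real"
  assumes d: "g differentiable at z" and B: "B \<ge> 0" and l: "\<And>x y. \<bar>g x - g y\<bar> \<le> B * norm (x - y)"
  shows "norm (grad_x g z) \<le> B"
proof -
  let ?u = "grad_x g z"
  define w where "w = (?u, 0 :: real ^ 'd)"
  have w: "norm w = norm ?u" by (simp add: w_def)
  have "((\<lambda>h. (g (z + h *\<^sub>R w) - g z) / h) \<longlongrightarrow> frechet_derivative g (at z) w) (at 0)"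
    by (rule directional_derivative_tendsto[OF d])
  then have "((\<lambda>h. \<bar>(g (z + h *\<^sub>R w) - g z) / h\<bar>) \<longlongrightarrow> \<bar>frechet_derivative g (at z) w\<bar>) (at 0)"
    by (rule tendsto_rabs)
  moreover have "\<forall>\<^sub>F h in at 0. \<bar>(g (z + h *\<^sub>R w) - g z) / h\<bar> \<le> B * norm w"
    unfolding eventually_at_filter
  proof (intro always_eventually allI impI)
    fix h :: real assume "h \<noteq> 0"
    have "\<bar>g (z + h *\<^sub>R w) - g z\<bar> \<le> B * (\<bar>h\<bar> * norm w)" using l[of "z + h *\<^sub>R w" z] by simp
    then show "\<bar>(g (z + h *\<^sub>R w) - g z) / h\<bar> \<le> B * norm w"
      using \<open>h \<noteq> 0\<close> by (simp add: abs_divide divide_le_eq mult_ac)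
  qed
  ultimately have "\<bar>frechet_derivative g (at z) (?u, 0)\<bar> \<le> B * norm ?u"
    unfolding w[symmetric] unfolding w_def[symmetric] by (rule tendsto_upperbound) simp
  then have "norm ?u * norm ?u \<le> B * norm ?u"
    using grad_x_inner[OF d, of ?u] by (simp add: dot_square_norm power2_eq_square)
  then show ?thesis using B by (cases "norm ?u = 0") auto
qed

text \<open>The row vector is the adjoint of the \<theta>-derivative applied to v. In this form it
  is estimated by testing it with itself, without coordinates.\<close>

lemma row_grad_theta_inner:
  assumes "F t x differentiable at \<theta>"
  shows "row_grad_theta F v t x \<theta> \<bullet> w = v \<bullet> blinfun_apply (bderiv (F t x) \<theta>) w"
proof -
  let ?D = "blinfun_apply (bderiv (F t x) \<theta>)"
  have lin: "linear ?D" by (simp add: bounded_linear.linear blinfun.bounded_linear_right)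
  have "?D w = ?D (\<Sum>j\<in>UNIV. (w $ j) *\<^sub>R axis j 1)"
    using basis_expansion[of w] by (simp add: scalar_mult_eq_scaleR)
  also have "\<dots> = (\<Sum>j\<in>UNIV. w $ j *\<^sub>R ?D (axis j 1))"
    by (simp add: linear_sum[OF lin] linear_cmul[OF lin])
  finally have "v \<bullet> ?D w = (\<Sum>j\<in>UNIV. w $ j * (v \<bullet> ?D (axis j 1)))" by (simp add: inner_sum_right)
  then show ?thesis
    by (simp add: row_grad_theta_def inner_vec_def[of "\<chi> j. _ j"] bderiv_apply[OF assms] inner_vec_def[of v] mult.commute)
qed

lemma norm_row_grad_theta_diff_le:
  assumes d: "F t x differentiable at \<theta>" "F t x' differentiable at \<theta>'"
    and b: "norm (bderiv (F t x) \<theta>) \<le> A" "norm (bderiv (F t x) \<theta> - bderiv (F t x') \<theta>') \<le> e"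
  shows "norm (row_grad_theta F v t x \<theta> - row_grad_theta F v' t x' \<theta>') \<le> norm (v - v') * A + norm v' * e"
proof -
  let ?u = "row_grad_theta F v t x \<theta> - row_grad_theta F v' t x' \<theta>'"
  let ?D = "bderiv (F t x) \<theta>" and ?D' = "bderiv (F t x') \<theta>'"
  have "norm ?u * norm ?u = v \<bullet> ?D ?u - v' \<bullet> ?D' ?u"
    by (simp only: row_grad_theta_inner[where F = F and t = t and x = x, OF d(1), symmetric] row_grad_theta_inner[where F = F and t = t and x = x', OF d(2), symmetric]
        inner_diff_left[symmetric] dot_square_norm power2_eq_square)
  also have "\<dots> = (v - v') \<bullet> ?D ?u + v' \<bullet> (?D - ?D') ?u"
    by (simp add: inner_diff_left inner_diff_right blinfun.diff_left)
  also have "\<dots> \<le> norm (v - v') * norm (?D ?u) + norm v' * norm ((?D - ?D') ?u)"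
    by (intro add_mono norm_cauchy_schwarz)
  also have "\<dots> \<le> norm (v - v') * (A * norm ?u) + norm v' * (e * norm ?u)"
    by (intro add_mono mult_left_mono order_trans[OF norm_blinfun mult_right_mono] b) auto
  finally have "norm ?u * norm ?u \<le> (norm (v - v') * A + norm v' * e) * norm ?u" by (simp add: algebra_simps)
  moreover have "0 \<le> A" "0 \<le> e" using order_trans[OF norm_ge_zero b(1)] order_trans[OF norm_ge_zero b(2)] by auto
  then have "0 \<le> norm (v - v') * A + norm v' * e" by simp
  ultimately show ?thesis by (cases "norm ?u = 0") auto
qed

lemma norm_row_grad_theta_le:
  assumes d: "F t x differentiable at \<theta>" and b: "norm (bderiv (F t x) \<theta>) \<le> A"
  shows "norm (row_grad_theta F v t x \<theta>) \<le> norm v * A"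
proof -
  have "row_grad_theta F 0 t x \<theta> = 0" by (simp add: row_grad_theta_def vec_eq_iff)
  then show ?thesis using norm_row_grad_theta_diff_le[where F = F and t = t and x = x and x' = x, OF d d b, of 0 v 0] by simp
qed

text \<open>The inequality |\<theta>| \<le> 1 + |\<theta>|^2 stands in for Cauchy-Schwarz; the
  constant is cruder but depends on the same data.\<close>

lemma control_ball_L1:
  fixes \<theta> :: "real \<Rightarrow> real ^ 'm"
  assumes T: "T > 0" and C: "C\<^sub>\<Gamma> > 0" and \<theta>: "\<theta> \<in> control_ball T C\<^sub>\<Gamma>" "continuous_on {0..T} \<theta>"
  shows "integral {0..T} (\<lambda>t. norm (\<theta> t)) \<le> T + C\<^sub>\<Gamma>\<^sup>2 * T"
proof -
  define q where "q t = (norm (\<theta> t))\<^sup>2" for t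
  have cq: "continuous_on {0..T} q" unfolding q_def by (intro continuous_intros \<theta>)
  have iq: "set_integrable lborel {0..T} q" by (rule borel_integrable_atLeastAtMost'[OF cq])
  define I where "I = integral {0..T} q"
  have I0: "I \<ge> 0" unfolding I_def by (rule integral_nonneg[OF integrable_continuous_real[OF cq]]) (simp add: q_def)
  have "(\<integral>\<^sup>+t\<in>{0..T}. ennreal (norm (\<theta> t) powr enn2real 2) \<partial>lborel) = (\<integral>\<^sup>+t. ennreal (indicator {0..T} t *\<^sub>R q t) \<partial>lborel)"
    by (rule nn_integral_cong) (auto simp: indicator_def q_def powr_numeral)
  also have "\<dots> = ennreal (LINT t|lborel. indicator {0..T} t *\<^sub>R q t)"
    by (rule nn_integral_eq_integral) (use iq in \<open>auto simp: set_integrable_def q_def indicator_def\<close>)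
  also have "(LINT t|lborel. indicator {0..T} t *\<^sub>R q t) = I"
    using set_borel_integral_eq_integral(2)[OF iq] by (simp add: I_def set_lebesgue_integral_def)
  finally have "Lp_norm T 2 \<theta> = ennreal (I powr (1 / 2))"
    using I0 by (simp add: Lp_norm_def)
  then have "ennreal (I powr (1 / 2)) \<le> ennreal (C\<^sub>\<Gamma> * T powr (1 / 2))"
    using \<theta>(1) by (simp add: control_ball_def)
  then have "I powr (1 / 2) \<le> C\<^sub>\<Gamma> * T powr (1 / 2)" using C by (simp add: ennreal_le_iff)
  then have "sqrt I \<le> C\<^sub>\<Gamma> * sqrt T" using I0 T by (simp add: powr_half_sqrt)
  then have "(sqrt I)\<^sup>2 \<le> (C\<^sub>\<Gamma> * sqrt T)\<^sup>2" using I0 by (intro power_mono) auto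
  then have I: "I \<le> C\<^sub>\<Gamma>\<^sup>2 * T" using I0 T by (simp add: power_mult_distrib)
  have "integral {0..T} (\<lambda>t. norm (\<theta> t)) \<le> integral {0..T} (\<lambda>t. 1 + q t)"
  proof (rule integral_le)
    show "norm (\<theta> t) \<le> 1 + q t" for t
    proof -
      have "0 \<le> (norm (\<theta> t) - 1)\<^sup>2" by simp
      then have "2 * norm (\<theta> t) \<le> 1 + q t" by (simp add: q_def power2_diff)
      then show ?thesis using norm_ge_zero[of "\<theta> t"] by linarith
    qed
  qed (intro integrable_continuous_real continuous_intros \<theta> cq)+
  also have "\<dots> = T + I"
    using T integral_add[OF integrable_const_ivl integrable_continuous_real[OF cq], of 1] by (simp add: I_def)
  finally show ?thesis using I by simp
qed

section \<open>Flows driven by admissible controls\<close>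

locale controlled_system =
  fixes T C\<^sub>F L\<^sub>F :: real and F :: "real \<Rightarrow> real ^ 'd \<Rightarrow> real ^ 'm \<Rightarrow> real ^ 'd"
  assumes T: "T > 0" and CF: "C\<^sub>F > 0" and LF: "L\<^sub>F > 0"
    and growth: "\<And>t x \<theta>. t \<in> {0..T} \<Longrightarrow> norm (F t x \<theta>) \<le> C\<^sub>F * (1 + norm x)"
    and F_lip: "\<And>t x y \<theta>. t \<in> {0..T} \<Longrightarrow> norm (F t x \<theta> - F t y \<theta>) \<le> L\<^sub>F * (1 + norm \<theta>) * norm (x - y)"
    and F_time: "\<And>r. r > 0 \<Longrightarrow> \<exists>C\<ge>0. \<forall>\<theta>\<^sub>1 \<theta>\<^sub>2. \<forall>s\<in>{0..T}. \<forall>t\<in>{0..T}. \<forall>x\<in>cball 0 r.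
        norm (F t x \<theta>\<^sub>1 - F s x \<theta>\<^sub>2) \<le> C * (\<bar>t - s\<bar> + norm (\<theta>\<^sub>1 - \<theta>\<^sub>2))"
begin

text \<open>The Gronwall bound for trajectories that start in the ball of radius \<rho> and obey the
  linear growth condition up to time T, uniformly in the control.\<close>

definition radius :: "real \<Rightarrow> real" where
  "radius \<rho> = (\<rho> + C\<^sub>F * T) * exp (C\<^sub>F * T)"

lemma radius_ge: "0 \<le> \<rho> \<Longrightarrow> \<rho> \<le> radius \<rho>"
proof -
  assume r: "0 \<le> \<rho>"
  have "\<rho> * 1 \<le> (\<rho> + C\<^sub>F * T) * exp (C\<^sub>F * T)"
    using r CF T by (intro mult_mono) auto
  then show ?thesis by (simp add: radius_def)
qed

end

locale admissible_control = controlled_system T C\<^sub>F L\<^sub>F F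
  for T C\<^sub>F L\<^sub>F :: real and F :: "real \<Rightarrow> real ^ 'd \<Rightarrow> real ^ 'm \<Rightarrow> real ^ 'd" +
  fixes \<theta> :: "real \<Rightarrow> real ^ 'm" and M :: real
  assumes \<theta>_lip: "\<exists>L. L-lipschitz_on {0..T} \<theta>" and \<theta>_bound: "\<And>t. t \<in> {0..T} \<Longrightarrow> norm (\<theta> t) \<le> M"
begin

abbreviation v :: "real \<Rightarrow> (real ^ 'd) \<times> (real ^ 'd) \<Rightarrow> (real ^ 'd) \<times> (real ^ 'd)" where
  "v \<equiv> control_field T F \<theta>"

lemma \<theta>_cont: "continuous_on {0..T} \<theta>"
  using \<theta>_lip lipschitz_on_continuous_on by blast

lemma \<theta>_clamp_lip: obtains L where "L \<ge> 0" "\<And>s t. norm (\<theta> (clamp T s) - \<theta> (clamp T t)) \<le> L * \<bar>s - t\<bar>"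
proof -
  obtain L where L: "L-lipschitz_on {0..T} \<theta>" using \<theta>_lip by blast
  have L0: "L \<ge> 0" by (rule lipschitz_on_nonneg[OF L])
  have "norm (\<theta> (clamp T s) - \<theta> (clamp T t)) \<le> L * \<bar>s - t\<bar>" for s t
    using lipschitz_onD[OF L clamp_mem[OF T] clamp_mem[OF T], of s t]
      mult_left_mono[OF clamp_lipschitz[of T s t] L0] by (simp add: dist_norm)
  then show thesis using L0 that by blast
qed

lemma M_nonneg: "M \<ge> 0"
  using order_trans[OF norm_ge_zero \<theta>_bound[of 0]] T by simp

lemma v_lip_pointwise: "norm (v t z - v t z') \<le> L\<^sub>F * (1 + norm (\<theta> (clamp T t))) * norm (z - z')"
proof -
  have "norm (v t z - v t z') \<le> L\<^sub>F * (1 + norm (\<theta> (clamp T t))) * norm (fst z - fst z')"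
    using F_lip[OF clamp_mem[OF T]] by (simp add: control_field_def)
  also have "\<dots> \<le> L\<^sub>F * (1 + norm (\<theta> (clamp T t))) * norm (z - z')"
    using LF norm_fst_le[of "fst z - fst z'" "snd z - snd z'"] by (intro mult_left_mono) (auto simp: minus_prod_def)
  finally show ?thesis .
qed

lemma v_lip: "norm (v t z - v t z') \<le> L\<^sub>F * (1 + M) * norm (z - z')"
  using LF \<theta>_bound[OF clamp_mem[OF T]]
  by (intro order_trans[OF v_lip_pointwise] mult_right_mono mult_left_mono) auto

lemma v_time: "\<exists>A\<ge>0. \<forall>t t' z. norm z \<le> r \<longrightarrow> norm (v t z - v t' z) \<le> A * \<bar>t - t'\<bar>"
proof -
  obtain L where L: "L \<ge> 0" "\<And>s t. norm (\<theta> (clamp T s) - \<theta> (clamp T t)) \<le> L * \<bar>s - t\<bar>"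
    using \<theta>_clamp_lip by blast
  obtain C where C: "C \<ge> 0" "\<And>\<theta>\<^sub>1 \<theta>\<^sub>2 s t x. s \<in> {0..T} \<Longrightarrow> t \<in> {0..T} \<Longrightarrow> x \<in> cball 0 (max r 1) \<Longrightarrow>
        norm (F t x \<theta>\<^sub>1 - F s x \<theta>\<^sub>2) \<le> C * (\<bar>t - s\<bar> + norm (\<theta>\<^sub>1 - \<theta>\<^sub>2))"
  proof -
    have "max r 1 > 0" by simp
    from F_time[OF this] show ?thesis using that by blast
  qed
  have "norm (v t z - v t' z) \<le> C * (1 + L) * \<bar>t - t'\<bar>" if "norm z \<le> r" for t t' z
  proof -
    have "norm (fst z) \<le> max r 1" using norm_fst_le[of "fst z" "snd z"] that by simp
    then have "norm (v t z - v t' z) \<le> C * (\<bar>clamp T t - clamp T t'\<bar> + norm (\<theta> (clamp T t) - \<theta> (clamp T t')))"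
      using C(2)[OF clamp_mem[OF T] clamp_mem[OF T], of "fst z"] by (simp add: control_field_def)
    also have "\<dots> \<le> C * (\<bar>t - t'\<bar> + L * \<bar>t - t'\<bar>)"
      by (intro mult_left_mono add_mono clamp_lipschitz L C)
    finally show ?thesis by (simp add: algebra_simps)
  qed
  then show ?thesis using C L by (intro exI[of _ "C * (1 + L)"]) auto
qed

sublocale lipschitz_field v "L\<^sub>F * (1 + M)"
proof
  show "norm (v t x - v t y) \<le> L\<^sub>F * (1 + M) * norm (x - y)" for t x y by (rule v_lip)
  have "((\<lambda>q. v (fst q) (snd q)) \<longlongrightarrow> v (fst p) (snd p)) (at p)" for p
  proof -
    obtain A where A: "A \<ge> 0" "\<And>t t' z. norm z \<le> norm (snd p) \<Longrightarrow> norm (v t z - v t' z) \<le> A * \<bar>t - t'\<bar>"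
      using v_time by blast
    have "((\<lambda>q. v (fst q) (snd q) - v (fst p) (snd p)) \<longlongrightarrow> 0) (at p)"
    proof (rule Lim_null_comparison)
      show "\<forall>\<^sub>F q in at p. norm (v (fst q) (snd q) - v (fst p) (snd p))
        \<le> L\<^sub>F * (1 + M) * norm (snd q - snd p) + A * \<bar>fst q - fst p\<bar>"
      proof (intro always_eventually allI)
        fix q
        show "norm (v (fst q) (snd q) - v (fst p) (snd p)) \<le> L\<^sub>F * (1 + M) * norm (snd q - snd p) + A * \<bar>fst q - fst p\<bar>"
          using v_lip[of "fst q" "snd q" "snd p"] A(2)[of "snd p" "fst q" "fst p"]
            norm_triangle_ineq[of "v (fst q) (snd q) - v (fst q) (snd p)" "v (fst q) (snd p) - v (fst p) (snd p)"]
          by simp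
      qed
      have "((\<lambda>q. L\<^sub>F * (1 + M) * norm (snd q - snd p) + A * \<bar>fst q - fst p\<bar>)
        \<longlongrightarrow> L\<^sub>F * (1 + M) * norm (snd p - snd p) + A * \<bar>fst p - fst p\<bar>) (at p)"
        by (intro tendsto_intros)
      then show "((\<lambda>q. L\<^sub>F * (1 + M) * norm (snd q - snd p) + A * \<bar>fst q - fst p\<bar>) \<longlongrightarrow> 0) (at p)" by simp
    qed
    then show ?thesis by (simp add: LIM_zero_iff)
  qed
  then show "continuous_on UNIV (\<lambda>(t, z). v t z)" unfolding continuous_on_def split_beta by simp
qed

abbreviation \<Psi> where "\<Psi> \<equiv> ode_flow v"

lemma flow_bound:
  assumes "0 \<le> t" "t \<le> r" "r \<le> T"
  shows "norm (\<Psi> t r z) \<le> radius (norm z)"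
proof -
  have g: "norm (v s (\<Psi> t s z)) \<le> C\<^sub>F * norm (\<Psi> t s z) + C\<^sub>F" for s
  proof -
    have "norm (v s (\<Psi> t s z)) \<le> C\<^sub>F * (1 + norm (fst (\<Psi> t s z)))"
      using growth[OF clamp_mem[OF T]] by (simp add: control_field_def)
    also have "\<dots> \<le> C\<^sub>F * (1 + norm (\<Psi> t s z))"
      using CF norm_fst_le[of "fst (\<Psi> t s z)" "snd (\<Psi> t s z)"] by (intro mult_left_mono add_left_mono) auto
    finally show ?thesis by (simp add: algebra_simps)
  qed
  have "norm (\<Psi> t r z) \<le> (norm (\<Psi> t t z) + C\<^sub>F * (r - t)) * exp (C\<^sub>F * (r - t))"
    by (rule gronwall_const[where X = "\<lambda>s. \<Psi> t s z", OF assms(2) _ _ ode_flow_has_vector_derivative g])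
      (use CF in auto)
  also have "\<dots> \<le> radius (norm z)"
    unfolding radius_def using assms CF T by (intro mult_mono add_mono) (auto intro!: mult_left_mono)
  finally show ?thesis .
qed

text \<open>\<open>ode_flow_lipschitz\<close> gives a constant that contains M. Here only the
  integral of the control enters, which makes the estimate usable for finding an M common to all
  solutions.\<close>

lemma flow_lipschitz_L1:
  assumes tr: "0 \<le> t" "t \<le> r" "r \<le> T" and I: "integral {0..T} (\<lambda>s. norm (\<theta> s)) \<le> I"
  shows "norm (\<Psi> t r x - \<Psi> t r y) \<le> exp (L\<^sub>F * (T + I)) * norm (x - y)"
proof -
  let ?a = "\<lambda>s. L\<^sub>F * (1 + norm (\<theta> s))"
  have ca: "continuous_on {0..T} ?a" by (intro continuous_intros \<theta>_cont)
  have ia: "?a integrable_on {0..T}" by (rule integrable_continuous_real[OF ca])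
  have "norm (\<Psi> t r x - \<Psi> t r y) \<le> (norm (\<Psi> t t x - \<Psi> t t y) + 0 * (r - t)) * exp (integral {t..r} ?a)"
  proof (rule gronwall_derivative[where X = "\<lambda>s. \<Psi> t s x - \<Psi> t s y"])
    show "continuous_on {t..r} ?a" by (rule continuous_on_subset[OF ca]) (use tr in auto)
    fix s assume s: "s \<in> {t..r}"
    show "0 \<le> ?a s" using LF by simp
    show "((\<lambda>s. \<Psi> t s x - \<Psi> t s y) has_vector_derivative v s (\<Psi> t s x) - v s (\<Psi> t s y)) (at s within {t..r})"
      by (intro has_vector_derivative_diff ode_flow_has_vector_derivative s)
    show "norm (v s (\<Psi> t s x) - v s (\<Psi> t s y)) \<le> ?a s * norm (\<Psi> t s x - \<Psi> t s y) + 0"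
      using v_lip_pointwise[of s] s tr by (simp add: clamp_id)
  qed (use tr in auto)
  also have "\<dots> = exp (integral {t..r} ?a) * norm (x - y)" by simp
  also have "\<dots> \<le> exp (L\<^sub>F * (T + I)) * norm (x - y)"
  proof (intro mult_right_mono)
    have "integral {t..r} ?a \<le> integral {0..T} ?a"
      by (rule integral_subset_le) (use tr LF ia integrable_on_subinterval[OF ia, of t r] in auto)
    also have "\<dots> = L\<^sub>F * (T + integral {0..T} (\<lambda>s. norm (\<theta> s)))"
      using T integral_add[OF integrable_const_ivl integrable_continuous_real[OF continuous_on_norm[OF \<theta>_cont]], of 1] by simp
    also have "\<dots> \<le> L\<^sub>F * (T + I)" using I LF by simp
    finally show "exp (integral {t..r} ?a) \<le> exp (L\<^sub>F * (T + I))" by simp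
  qed simp
  finally show ?thesis .
qed

lemma snd_flow: "t \<le> r \<Longrightarrow> snd (\<Psi> t r z) = snd z"
proof -
  assume tr: "t \<le> r"
  have "((\<lambda>s. v s (\<Psi> t s z)) has_integral (\<Psi> t r z - z)) {t..r}" by (rule ode_flow_integral[OF tr])
  from has_integral_linear[OF this bounded_linear_snd]
  have "((\<lambda>s. 0) has_integral snd (\<Psi> t r z - z)) {t..r}" by (simp add: o_def control_field_def)
  then have "snd (\<Psi> t r z - z) = 0" using has_integral_0 has_integral_unique by blast
  then show ?thesis by simp
qed

text \<open>Connects \<open>flow\<close>, defined by integral trajectories on the x-space, with the
  differentiable flow on the product space. A competing trajectory is only known to satisfy the
  integral equation; it is continuous as an indefinite integral, and the integral form of Gronwall
  identifies it.\<close>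

lemma fst_flow_eq: "flow F \<theta> 0 T x = fst (\<Psi> 0 T (x, y))"
proof -
  define X where "X s = fst (\<Psi> 0 s (x, y))" for s
  have cX: "continuous_on {0..T} X"
  proof -
    have "continuous_on {0..T} (\<lambda>s. \<Psi> 0 s (x, y))"
      unfolding continuous_on_eq_continuous_within
      by (intro ballI has_vector_derivative_continuous[OF ode_flow_has_vector_derivative])
    then show ?thesis unfolding X_def by (intro continuous_intros)
  qed
  have cFX: "continuous_on {0..T} (\<lambda>s. F s (X s) (\<theta> s))"
  proof -
    have "continuous_on {0..T} (\<lambda>s. v s (X s, y))"
      by (intro cont' continuous_on_Pair continuous_on_id continuous_on_const cX)
    then have "continuous_on {0..T} (\<lambda>s. fst (v s (X s, y)))" by (rule continuous_on_fst)
    then show ?thesis by (rule continuous_on_cong[THEN iffD1, rotated -1]) (auto simp: control_field_def clamp_id)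
  qed
  have tX: "trajectory F \<theta> 0 T x X"
    unfolding trajectory_def
  proof (intro conjI ballI)
    show "set_integrable lborel {0..T} (\<lambda>s. F s (X s) (\<theta> s))" by (rule borel_integrable_atLeastAtMost'[OF cFX])
    fix s assume s: "s \<in> {0..T}"
    have "((\<lambda>r. v r (\<Psi> 0 r (x, y))) has_integral (\<Psi> 0 s (x, y) - (x, y))) {0..s}"
      by (rule ode_flow_integral) (use s in simp)
    from has_integral_linear[OF this bounded_linear_fst]
    have "((\<lambda>r. fst (v r (\<Psi> 0 r (x, y)))) has_integral (X s - x)) {0..s}" by (simp add: o_def X_def)
    then have "((\<lambda>r. F r (X r) (\<theta> r)) has_integral (X s - x)) {0..s}"
      by (rule has_integral_eq[rotated]) (use s in \<open>auto simp: control_field_def clamp_id X_def\<close>)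
    moreover have "set_integrable lborel {0..s} (\<lambda>s. F s (X s) (\<theta> s))"
      by (intro borel_integrable_atLeastAtMost' continuous_on_subset[OF cFX]) (use s in auto)
    ultimately show "X s = x + (LINT r:{0..s}|lborel. F r (X r) (\<theta> r))"
      by (simp add: set_borel_integral_eq_integral(2) integral_unique)
  qed
  show ?thesis
    unfolding flow_def
  proof (rule the_equality)
    show "\<exists>X. trajectory F \<theta> 0 T x X \<and> X T = fst (\<Psi> 0 T (x, y))" using tX by (auto simp: X_def)
    fix w assume "\<exists>Y. trajectory F \<theta> 0 T x Y \<and> Y T = w"
    then obtain Y where Y: "trajectory F \<theta> 0 T x Y" "Y T = w" by blast
    have sY: "set_integrable lborel {0..T} (\<lambda>s. F s (Y s) (\<theta> s))" using Y(1) by (simp add: trajectory_def)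
    have iY: "(\<lambda>s. F s (Y s) (\<theta> s)) integrable_on {0..T}" by (rule set_borel_integral_eq_integral(1)[OF sY])
    have eY: "Y s = x + integral {0..s} (\<lambda>s. F s (Y s) (\<theta> s))" if s: "s \<in> {0..T}" for s
    proof -
      have "set_integrable lborel {0..s} (\<lambda>s. F s (Y s) (\<theta> s))"
        by (rule set_integrable_subset[OF sY]) (use s in auto)
      then show ?thesis using Y(1) s by (simp add: trajectory_def set_borel_integral_eq_integral(2))
    qed
    have iX: "(\<lambda>s. F s (X s) (\<theta> s)) integrable_on {0..T}" by (rule integrable_continuous_real[OF cFX])
    have eX: "X s = x + integral {0..s} (\<lambda>s. F s (X s) (\<theta> s))" if s: "s \<in> {0..T}" for s
    proof -
      have "set_integrable lborel {0..s} (\<lambda>s. F s (X s) (\<theta> s))"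
        by (intro borel_integrable_atLeastAtMost' continuous_on_subset[OF cFX]) (use s in auto)
      then show ?thesis using tX s by (simp add: trajectory_def set_borel_integral_eq_integral(2))
    qed
    have cY: "continuous_on {0..T} Y"
    proof -
      have "continuous_on {0..T} (\<lambda>s. x + integral {0..s} (\<lambda>s. F s (Y s) (\<theta> s)))"
        by (intro continuous_intros indefinite_integral_continuous_1 iY)
      then show ?thesis by (rule continuous_on_cong[THEN iffD1, rotated -1]) (use eY in auto)
    qed
    let ?u = "\<lambda>s. norm (X s - Y s)"
    have cu: "continuous_on {0..T} ?u" by (intro continuous_intros cX cY)
    have "?u T \<le> (0 + 0 * (T - 0)) * exp (integral {0..T} (\<lambda>_. L\<^sub>F * (1 + M)))"
    proof (rule gronwall_integral[OF _ _ cu])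
      fix r assume r: "r \<in> {0..T}"
      have sub: "{0..r} \<subseteq> {0..T}" using r by auto
      have "X r - Y r = integral {0..r} (\<lambda>s. F s (X s) (\<theta> s) - F s (Y s) (\<theta> s))"
        unfolding eX[OF r] eY[OF r]
        using integral_diff[OF integrable_on_subinterval[OF iX sub] integrable_on_subinterval[OF iY sub]] by simp
      also have "norm \<dots> \<le> integral {0..r} (\<lambda>s. L\<^sub>F * (1 + M) * ?u s)"
      proof (rule integral_norm_bound_integral)
        show "(\<lambda>s. F s (X s) (\<theta> s) - F s (Y s) (\<theta> s)) integrable_on {0..r}"
          by (intro integrable_diff integrable_on_subinterval[OF iX sub] integrable_on_subinterval[OF iY sub])
        show "(\<lambda>s. L\<^sub>F * (1 + M) * ?u s) integrable_on {0..r}"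
          by (intro integrable_continuous_real continuous_intros continuous_on_subset[OF cX] continuous_on_subset[OF cY] sub)
        fix s assume "s \<in> {0..r}"
        then have s: "s \<in> {0..T}" using r by auto
        have "norm (F s (X s) (\<theta> s) - F s (Y s) (\<theta> s)) \<le> L\<^sub>F * (1 + norm (\<theta> s)) * ?u s" by (rule F_lip[OF s])
        also have "\<dots> \<le> L\<^sub>F * (1 + M) * ?u s"
          using LF \<theta>_bound[OF s] by (intro mult_right_mono mult_left_mono) auto
        finally show "norm (F s (X s) (\<theta> s) - F s (Y s) (\<theta> s)) \<le> L\<^sub>F * (1 + M) * ?u s" .
      qed
      finally show "?u r \<le> 0 + integral {0..r} (\<lambda>s. L\<^sub>F * (1 + M) * ?u s + 0)" by simp
    qed (use T LF M_nonneg in auto)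
    then show "w = fst (\<Psi> 0 T (x, y))" using Y(2) by (simp add: X_def)
  qed
qed

end

context controlled_system
begin

text \<open>The bound M is taken from compactness and depends on the solution. This is enough,
  because the representation by characteristics contains no constants; the uniform bound is derived
  from it later.\<close>

lemma solution_representation:
  assumes sol: "solution T F \<psi>\<^sub>T C\<^sub>\<Gamma> lam \<mu>\<^sub>0 \<mu> \<theta> \<psi>"
    and conf: "confining_radius T F R R\<^sub>T" and supp: "measure_supp \<mu>\<^sub>0 \<subseteq> cball 0 R"
  shows "\<exists>M. admissible_control T C\<^sub>F L\<^sub>F F \<theta> M" and "\<mu>\<^sub>0 \<in> P_c"
    and "\<And>t. t \<in> {0..T} \<Longrightarrow> measure_supp (\<mu> t) \<subseteq> cball 0 R\<^sub>T"
    and "\<And>t. t \<in> {0..T} \<Longrightarrow> \<mu> t = distr \<mu>\<^sub>0 borel (ode_flow (control_field T F \<theta>) 0 t)"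
    and "\<And>t z. t \<in> {0..T} \<Longrightarrow> \<psi> t z = \<psi>\<^sub>T (ode_flow (control_field T F \<theta>) t T z)"
proof -
  have curve: "P_c_curve T \<mu>" and lip: "\<exists>L. L-lipschitz_on {0..T} \<theta>" and ball: "\<theta> \<in> control_ball T C\<^sub>\<Gamma>"
    and C1: "C1_C2c T \<psi>" and 0: "\<mu> 0 = \<mu>\<^sub>0" and ce: "continuity_equation T F \<theta> \<mu>"
    and be: "backward_equation T F \<theta> \<psi>\<^sub>T \<psi>"
    using sol by (auto simp: solution_def)
  have "continuous_on {0..T} \<theta>" using lip lipschitz_on_continuous_on by blast
  then have "bounded (\<theta> ` {0..T})" by (intro compact_imp_bounded compact_continuous_image) auto
  then obtain M where M: "\<forall>y\<in>\<theta> ` {0..T}. norm y \<le> M" unfolding bounded_iff by (elim exE)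
  have adm: "admissible_control T C\<^sub>F L\<^sub>F F \<theta> M"
    by unfold_locales (use lip M in auto)
  then show "\<exists>M. admissible_control T C\<^sub>F L\<^sub>F F \<theta> M" ..
  interpret admissible_control T C\<^sub>F L\<^sub>F F \<theta> M by (rule adm)
  show "\<mu>\<^sub>0 \<in> P_c" using curve T 0 by (auto simp: P_c_curve_def)
  show supp': "measure_supp (\<mu> t) \<subseteq> cball 0 R\<^sub>T" if "t \<in> {0..T}" for t
    using conf curve ce supp ball that unfolding confining_radius_def control_ball_def 0[symmetric] by blast
  interpret W: weak_transport v "L\<^sub>F * (1 + M)" T R\<^sub>T \<mu>
  proof
    show "T > 0" by (rule T)
    show "P_c_curve T \<mu>" by (rule curve)
    show "measure_supp (\<mu> t) \<subseteq> cball 0 R\<^sub>T" if "t \<in> {0..T}" for t by (rule supp'[OF that])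
    show "\<exists>A\<ge>0. \<forall>t t' z. norm z \<le> R\<^sub>T + 1 \<longrightarrow> norm (v t z - v t' z) \<le> A * \<bar>t - t'\<bar>" by (rule v_time)
    fix \<phi> :: "real \<times> (real ^ 'd) \<times> (real ^ 'd) \<Rightarrow> real" assume test: "test_fun T \<phi>"
    have d: "\<phi> differentiable at p" for p
      using test C_k_differentiable[of 0 \<phi> p] unfolding test_fun_def by blast
    \<comment> \<open>Splits the direction (1, v) into its time and space parts, so that the two
      terms of the continuity equation become one directional derivative.\<close>
    have eq: "deriv (\<lambda>s. \<phi> (s, z)) t + grad_x (\<lambda>z'. \<phi> (t, z')) z \<bullet> F t (fst z) (\<theta> t)
      = frechet_derivative \<phi> (at (t, z)) (1, v t z)" if t: "t \<in> {0..T}" for t z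
    proof -
      let ?D = "frechet_derivative \<phi> (at (t, z))"
      have D: "(\<phi> has_derivative ?D) (at (t, z))" using d by (simp add: frechet_derivative_works)
      have "((\<lambda>s. (s, z)) has_vector_derivative (1, 0)) (at t)"
        by (auto intro!: derivative_eq_intros simp: has_vector_derivative_def)
      from vector_derivative_diff_chain_within[OF this has_derivative_at_withinI[OF D]]
      have "((\<lambda>s. \<phi> (s, z)) has_real_derivative ?D (1, 0)) (at t)"
        by (simp add: o_def has_real_derivative_iff_has_vector_derivative)
      then have 1: "deriv (\<lambda>s. \<phi> (s, z)) t = ?D (1, 0)" by (rule DERIV_imp_deriv)
      have "((\<lambda>z'. (t, z')) has_derivative (\<lambda>h. (0, h))) (at z)" by (auto intro!: derivative_eq_intros)
      from has_derivative_compose[OF this D]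
      have D2: "((\<lambda>z'. \<phi> (t, z')) has_derivative (\<lambda>h. ?D (0, h))) (at z)" .
      then have "(\<lambda>z'. \<phi> (t, z')) differentiable at z" by (auto simp: differentiable_def)
      from grad_x_inner[OF this] frechet_derivative_at[OF D2]
      have 2: "grad_x (\<lambda>z'. \<phi> (t, z')) z \<bullet> w = ?D (0, (w, 0))" for w by metis
      have "?D (1, v t z) = ?D (1, 0) + ?D (0, v t z)"
        using linear_add[OF linear_frechet_derivative[OF d], of "(t, z)" "(1, 0)" "(0, v t z)"] by simp
      then show ?thesis using t by (simp add: 1 2 control_field_def clamp_id)
    qed
    have "(LINT t:{0..T}|lborel. (LINT z|\<mu> t. frechet_derivative \<phi> (at (t, z)) (1, v t z)))
      = (LINT t:{0..T}|lborel. (LINT z|\<mu> t. deriv (\<lambda>s. \<phi> (s, z)) t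
            + grad_x (\<lambda>z'. \<phi> (t, z')) z \<bullet> F t (fst z) (\<theta> t)))"
      by (rule set_lebesgue_integral_cong) (simp_all add: eq)
    also have "\<dots> = 0" using ce test unfolding continuity_equation_def by blast
    finally show "(LINT t:{0..T}|lborel. (LINT z|\<mu> t. frechet_derivative \<phi> (at (t, z)) (1, v t z))) = 0" .
  qed
  show "\<mu> t = distr \<mu>\<^sub>0 borel (ode_flow (control_field T F \<theta>) 0 t)" if "t \<in> {0..T}" for t
    using W.mu_eq_distr_flow[OF that] by (simp add: 0)
  obtain \<psi>' where ul: "\<And>t. t \<in> {0..T} \<Longrightarrow>
      uniform_limit UNIV (\<lambda>s z. (\<psi> s z - \<psi> t z) / (s - t)) (\<psi>' t) (at t within {0..T})"
    using C1 unfolding C1_C2c_def by blast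
  have Ck: "C_k (Suc (Suc 0)) (\<psi> t)" if "t \<in> {0..T}" for t
    using C1 that by (simp add: C1_C2c_def C2c_def numeral_2_eq_2)
  have "\<psi> t z = \<psi> T (\<Psi> t T z)" if t: "t \<in> {0..T}" for t z
  proof (rule transport_along_flow[OF T _ ul _ t])
    fix t assume t: "t \<in> {0..T}"
    show "C_k (Suc 0) (\<psi> t)" by (rule C_k_Suc_imp[OF Ck[OF t]])
    fix z
    have "grad_x (\<psi> t) z \<bullet> F t (fst z) (\<theta> t) = frechet_derivative (\<psi> t) (at z) (v t z)"
      using grad_x_inner[OF C_k_differentiable[OF Ck[OF t]]] t by (simp add: control_field_def clamp_id)
    then show "((\<lambda>s. \<psi> s z) has_real_derivative - frechet_derivative (\<psi> t) (at z) (v t z)) (at t within {0..T})"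
      using be t unfolding backward_equation_def by metis
  qed
  then show "\<psi> t z = \<psi>\<^sub>T (ode_flow (control_field T F \<theta>) t T z)" if "t \<in> {0..T}" for t z
    using be that by (simp add: backward_equation_def)
qed

end

section \<open>Stability of two controlled flows\<close>

lemma (in controlled_system) radius_mono: "a \<le> b \<Longrightarrow> radius a \<le> radius b"
  by (simp add: radius_def)

text \<open>One constant A dominates all bounds. They are required on the ball that characteristics
  starting within \<open>radius R + R\<^sub>T + 1\<close> cannot leave: \<open>radius R\<close>
  covers the points reached from the initial data, \<open>R\<^sub>T\<close> the region where \<psi>
  is compared, and 1 is room for difference quotients.\<close>

locale mean_field_control = controlled_system T C\<^sub>F L\<^sub>F F
  for T C\<^sub>F L\<^sub>F :: real and F :: "real \<Rightarrow> real ^ 'd \<Rightarrow> real ^ 'm \<Rightarrow> real ^ 'd" +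
  fixes R R\<^sub>T M A :: real and \<psi>\<^sub>T :: "(real ^ 'd) \<times> (real ^ 'd) \<Rightarrow> real"
  assumes R: "R > 0" and R\<^sub>T: "R\<^sub>T > 0" and A: "A \<ge> 1" and LM: "L\<^sub>F * (1 + M) \<le> A"
    and F_control: "\<And>t x \<theta> \<theta>'. t \<in> {0..T} \<Longrightarrow> norm x \<le> radius (radius R + R\<^sub>T + 1) \<Longrightarrow>
      norm (F t x \<theta> - F t x \<theta>') \<le> A * norm (\<theta> - \<theta>')"
    and F_quad: "\<And>t x1 x2 x3 x4 \<theta> \<theta>'. t \<in> {0..T} \<Longrightarrow> norm x1 \<le> radius (radius R + R\<^sub>T + 1) \<Longrightarrow>
      norm x2 \<le> radius (radius R + R\<^sub>T + 1) \<Longrightarrow> norm x3 \<le> radius (radius R + R\<^sub>T + 1) \<Longrightarrow>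
      norm x4 \<le> radius (radius R + R\<^sub>T + 1) \<Longrightarrow> norm \<theta> \<le> M \<Longrightarrow> norm \<theta>' \<le> M \<Longrightarrow>
      norm (F t x1 \<theta> - F t x2 \<theta> - F t x3 \<theta>' + F t x4 \<theta>')
        \<le> A * norm (x1 - x2 - x3 + x4) + A * (norm (x1 - x3) + norm (x2 - x4) + norm (\<theta> - \<theta>')) * norm (x3 - x4)"
    and F_diff: "\<And>t x \<theta>. t \<in> {0..T} \<Longrightarrow> F t x differentiable at \<theta>"
    and DF_cont: "\<And>t \<theta>. t \<in> {0..T} \<Longrightarrow> continuous_on UNIV (\<lambda>x. bderiv (F t x) \<theta>)"
    and DF_bound: "\<And>t x \<theta>. t \<in> {0..T} \<Longrightarrow> norm x \<le> radius (radius R + R\<^sub>T + 1) \<Longrightarrow> norm (bderiv (F t x) \<theta>) \<le> A"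
    and DF_lip: "\<And>t x x' \<theta> \<theta>'. t \<in> {0..T} \<Longrightarrow> norm x \<le> radius (radius R + R\<^sub>T + 1) \<Longrightarrow>
      norm x' \<le> radius (radius R + R\<^sub>T + 1) \<Longrightarrow> norm \<theta> \<le> M \<Longrightarrow> norm \<theta>' \<le> M \<Longrightarrow>
      norm (bderiv (F t x) \<theta> - bderiv (F t x') \<theta>') \<le> A * (norm (x - x') + norm (\<theta> - \<theta>'))"
    and \<psi>\<^sub>T_lip: "\<And>z z'. \<bar>\<psi>\<^sub>T z - \<psi>\<^sub>T z'\<bar> \<le> A * norm (z - z')"
    and \<psi>\<^sub>T_quad: "\<And>z1 z2 z3 z4. \<bar>\<psi>\<^sub>T z1 - \<psi>\<^sub>T z2 - \<psi>\<^sub>T z3 + \<psi>\<^sub>T z4\<bar>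
        \<le> A * norm (z1 - z2 - z3 + z4) + A * (norm (z1 - z3) + norm (z2 - z4)) * norm (z3 - z4)"
begin

definition R\<^sub>0 :: real where "R\<^sub>0 = radius R + R\<^sub>T + 1"
text \<open>Each constant is the outcome of one estimate: \<open>E\<close> is the Gronwall factor,
  \<open>D\<^sub>1\<close> belongs to the flow as a function of starting point and control,
  \<open>D\<^sub>2\<close> to its second differences, \<open>D\<^sub>3\<close> to the gradient of
  the cost, \<open>D\<^sub>4\<close> to the integrand of the control equation along
  characteristics.\<close>

definition E :: real where "E = exp (A * T)"
definition D\<^sub>1 :: real where "D\<^sub>1 = E * (1 + A * T)"
definition D\<^sub>2 :: real where "D\<^sub>2 = A * (2 * D\<^sub>1 + 1) * D\<^sub>1 * T * E"
definition D\<^sub>3 :: real where "D\<^sub>3 = A * D\<^sub>2 + 2 * A * D\<^sub>1 * D\<^sub>1"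
definition D\<^sub>4 :: real where "D\<^sub>4 = (D\<^sub>3 * A + A * D\<^sub>1 * A) * (D\<^sub>1 + 1)"

lemma E_ge: "E \<ge> 1" using A T by (simp add: E_def)

lemma D1_ge: "D\<^sub>1 \<ge> 1" "D\<^sub>1 \<ge> E"
proof -
  have "E * 1 \<le> E * (1 + A * T)" using E_ge A T by (intro mult_left_mono) auto
  then show "D\<^sub>1 \<ge> E" by (simp add: D\<^sub>1_def)
  then show "D\<^sub>1 \<ge> 1" using E_ge by simp
qed

lemma D2_ge: "D\<^sub>2 \<ge> 0" using A D1_ge E_ge T by (simp add: D\<^sub>2_def)
lemma D3_ge: "D\<^sub>3 \<ge> 0" using A D1_ge D2_ge by (simp add: D\<^sub>3_def)

lemma D4_pos: "D\<^sub>4 > 0"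
proof -
  have "0 < A * D\<^sub>1 * A" using A D1_ge by simp
  moreover have "0 \<le> D\<^sub>3 * A" using D3_ge A by simp
  ultimately show ?thesis using D1_ge by (simp add: D\<^sub>4_def)
qed

lemma exp_le_E: "0 \<le> s \<Longrightarrow> s \<le> T \<Longrightarrow> exp (A * s) \<le> E"
  using A by (simp add: E_def)

end

locale two_controls = mean_field_control T C\<^sub>F L\<^sub>F F R R\<^sub>T M A \<psi>\<^sub>T +
  C: admissible_control T C\<^sub>F L\<^sub>F F \<theta> M + C': admissible_control T C\<^sub>F L\<^sub>F F \<theta>' M
  for T C\<^sub>F L\<^sub>F R R\<^sub>T M A :: real and F :: "real \<Rightarrow> real ^ 'd \<Rightarrow> real ^ 'm \<Rightarrow> real ^ 'd"
    and \<psi>\<^sub>T :: "(real ^ 'd) \<times> (real ^ 'd) \<Rightarrow> real" and \<theta> \<theta>' :: "real \<Rightarrow> real ^ 'm" +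
  fixes \<delta> :: real
  assumes \<delta>: "\<And>t. t \<in> {0..T} \<Longrightarrow> norm (\<theta> t - \<theta>' t) \<le> \<delta>"
begin

lemma \<delta>_nonneg: "\<delta> \<ge> 0"
  using order_trans[OF norm_ge_zero \<delta>[of 0]] T by simp

lemma flow_lipschitz:
  assumes "0 \<le> t" "t \<le> r" "r \<le> T"
  shows "norm (C.\<Psi> t r x - C.\<Psi> t r y) \<le> D\<^sub>1 * norm (x - y)" and "norm (C'.\<Psi> t r x - C'.\<Psi> t r y) \<le> D\<^sub>1 * norm (x - y)"
proof -
  have "L\<^sub>F * (1 + M) * (r - t) \<le> A * T" using assms LM A by (intro mult_mono) auto
  then have "exp (L\<^sub>F * (1 + M) * (r - t)) \<le> D\<^sub>1" using D1_ge(2) exp_le_cancel_iff order_trans unfolding E_def by blast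
  then have "exp (L\<^sub>F * (1 + M) * (r - t)) * norm (x - y) \<le> D\<^sub>1 * norm (x - y)" by (rule mult_right_mono) simp
  then show "norm (C.\<Psi> t r x - C.\<Psi> t r y) \<le> D\<^sub>1 * norm (x - y)" "norm (C'.\<Psi> t r x - C'.\<Psi> t r y) \<le> D\<^sub>1 * norm (x - y)"
    using C.ode_flow_lipschitz[OF assms(2), of x y] C'.ode_flow_lipschitz[OF assms(2), of x y] by linarith+
qed

lemma flow_in_ball:
  assumes "0 \<le> t" "t \<le> r" "r \<le> T" "norm z \<le> R\<^sub>0"
  shows "norm (fst (C.\<Psi> t r z)) \<le> radius (radius R + R\<^sub>T + 1)" "norm (fst (C'.\<Psi> t r z)) \<le> radius (radius R + R\<^sub>T + 1)"
proof -
  have r: "radius (norm z) \<le> radius (radius R + R\<^sub>T + 1)" using assms by (intro radius_mono) (simp add: R\<^sub>0_def)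
  have f: "norm (fst w) \<le> norm w" for w :: "(real ^ 'd) \<times> (real ^ 'd)" using norm_fst_le[of "fst w" "snd w"] by simp
  show "norm (fst (C.\<Psi> t r z)) \<le> radius (radius R + R\<^sub>T + 1)"
    using order_trans[OF f order_trans[OF C.flow_bound[OF assms(1-3)] r]] .
  show "norm (fst (C'.\<Psi> t r z)) \<le> radius (radius R + R\<^sub>T + 1)"
    using order_trans[OF f order_trans[OF C'.flow_bound[OF assms(1-3)] r]] .
qed

lemma flow_diff:
  assumes tr: "0 \<le> t" "t \<le> r" "r \<le> T" and z: "norm z \<le> R\<^sub>0" "norm z' \<le> R\<^sub>0"
  shows "norm (C.\<Psi> t r z - C'.\<Psi> t r z') \<le> D\<^sub>1 * (norm (z - z') + \<delta>)"
proof -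
  have "norm (C.\<Psi> t r z - C'.\<Psi> t r z') \<le> (norm (C.\<Psi> t t z - C'.\<Psi> t t z') + A * \<delta> * (r - t)) * exp (A * (r - t))"
  proof (rule gronwall_const[where X = "\<lambda>s. C.\<Psi> t s z - C'.\<Psi> t s z'"])
    fix s assume s: "s \<in> {t..r}"
    then have s0: "s \<in> {0..T}" "0 \<le> t" "t \<le> s" "s \<le> T" using tr by auto
    show "((\<lambda>s. C.\<Psi> t s z - C'.\<Psi> t s z') has_vector_derivative C.v s (C.\<Psi> t s z) - C'.v s (C'.\<Psi> t s z')) (at s within {t..r})"
      by (intro has_vector_derivative_diff C.ode_flow_has_vector_derivative C'.ode_flow_has_vector_derivative s)
    have "norm (C.v s (C.\<Psi> t s z) - C'.v s (C'.\<Psi> t s z'))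
      \<le> norm (C.v s (C.\<Psi> t s z) - C.v s (C'.\<Psi> t s z')) + norm (C.v s (C'.\<Psi> t s z') - C'.v s (C'.\<Psi> t s z'))"
      using norm_triangle_ineq[of "C.v s (C.\<Psi> t s z) - C.v s (C'.\<Psi> t s z')" "C.v s (C'.\<Psi> t s z') - C'.v s (C'.\<Psi> t s z')"] by simp
    also have "norm (C.v s (C.\<Psi> t s z) - C.v s (C'.\<Psi> t s z')) \<le> A * norm (C.\<Psi> t s z - C'.\<Psi> t s z')"
      by (rule order_trans[OF C.v_lip mult_right_mono[OF LM]]) simp
    also have "norm (C.v s (C'.\<Psi> t s z') - C'.v s (C'.\<Psi> t s z')) \<le> A * \<delta>"
    proof -
      have "norm (C.v s (C'.\<Psi> t s z') - C'.v s (C'.\<Psi> t s z')) \<le> A * norm (\<theta> s - \<theta>' s)"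
        using F_control[OF s0(1) flow_in_ball(2)[OF s0(2-4) z(2)]] s0(1) by (simp add: control_field_def clamp_id)
      also have "\<dots> \<le> A * \<delta>" using A \<delta>[OF s0(1)] by (intro mult_left_mono) auto
      finally show ?thesis .
    qed
    finally show "norm (C.v s (C.\<Psi> t s z) - C'.v s (C'.\<Psi> t s z')) \<le> A * norm (C.\<Psi> t s z - C'.\<Psi> t s z') + A * \<delta>" by simp
  qed (use tr A \<delta>_nonneg in auto)
  also have "\<dots> \<le> (norm (z - z') + A * \<delta> * T) * E"
    using tr A \<delta>_nonneg by (intro mult_mono add_mono exp_le_E) (auto intro!: mult_left_mono)
  also have "\<dots> \<le> D\<^sub>1 * (norm (z - z') + \<delta>)"
  proof -
    have "norm (z - z') + A * \<delta> * T \<le> (1 + A * T) * (norm (z - z') + \<delta>)"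
      using A T \<delta>_nonneg by (simp add: algebra_simps)
    then have "(norm (z - z') + A * \<delta> * T) * E \<le> (1 + A * T) * (norm (z - z') + \<delta>) * E"
      using E_ge by (intro mult_right_mono) auto
    then show ?thesis by (simp add: D\<^sub>1_def mult_ac)
  qed
  finally show ?thesis .
qed

text \<open>Both starting points are shifted by the same w, so the second difference is 0 at the
  initial time and Gronwall sees only the forcing. That is proportional to |w| times the distance of
  data and controls, as a difference of gradients requires after division by |w|.\<close>

lemma flow_quad:
  assumes tr: "0 \<le> t" "t \<le> r" "r \<le> T"
    and z: "norm z \<le> R\<^sub>0" "norm z' \<le> R\<^sub>0" "norm (z + w) \<le> R\<^sub>0" "norm (z' + w) \<le> R\<^sub>0"
  shows "norm (C.\<Psi> t r (z + w) - C.\<Psi> t r z - C'.\<Psi> t r (z' + w) + C'.\<Psi> t r z') \<le> D\<^sub>2 * norm w * (norm (z - z') + \<delta>)"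
proof -
  let ?X1 = "\<lambda>s. C.\<Psi> t s (z + w)" and ?X2 = "\<lambda>s. C.\<Psi> t s z" and ?X3 = "\<lambda>s. C'.\<Psi> t s (z' + w)" and ?X4 = "\<lambda>s. C'.\<Psi> t s z'"
  let ?e = "norm (z - z') + \<delta>"
  define B where "B = A * (2 * D\<^sub>1 + 1) * D\<^sub>1 * norm w * ?e"
  have e0: "?e \<ge> 0" using \<delta>_nonneg by simp
  have B0: "B \<ge> 0" using A D1_ge e0 by (simp add: B_def)
  have "norm (?X1 r - ?X2 r - ?X3 r + ?X4 r) \<le> (norm (?X1 t - ?X2 t - ?X3 t + ?X4 t) + B * (r - t)) * exp (A * (r - t))"
  proof (rule gronwall_const[where X = "\<lambda>s. ?X1 s - ?X2 s - ?X3 s + ?X4 s"])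
    fix s assume s: "s \<in> {t..r}"
    then have s0: "s \<in> {0..T}" "0 \<le> t" "t \<le> s" "s \<le> T" using tr by auto
    show "((\<lambda>s. ?X1 s - ?X2 s - ?X3 s + ?X4 s) has_vector_derivative
      C.v s (?X1 s) - C.v s (?X2 s) - C'.v s (?X3 s) + C'.v s (?X4 s)) (at s within {t..r})"
      by (intro has_vector_derivative_diff has_vector_derivative_add
          C.ode_flow_has_vector_derivative C'.ode_flow_has_vector_derivative s)
    note b = flow_in_ball(1)[OF s0(2-4) z(3)] flow_in_ball(1)[OF s0(2-4) z(1)]
      flow_in_ball(2)[OF s0(2-4) z(4)] flow_in_ball(2)[OF s0(2-4) z(2)]
    have f: "norm (fst q) \<le> norm q" for q :: "(real ^ 'd) \<times> (real ^ 'd)" using norm_fst_le[of "fst q" "snd q"] by simp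
    have "norm (C.v s (?X1 s) - C.v s (?X2 s) - C'.v s (?X3 s) + C'.v s (?X4 s))
      = norm (F s (fst (?X1 s)) (\<theta> s) - F s (fst (?X2 s)) (\<theta> s) - F s (fst (?X3 s)) (\<theta>' s) + F s (fst (?X4 s)) (\<theta>' s))"
      using s0(1) by (simp add: control_field_def clamp_id)
    also have "\<dots> \<le> A * norm (fst (?X1 s) - fst (?X2 s) - fst (?X3 s) + fst (?X4 s))
      + A * (norm (fst (?X1 s) - fst (?X3 s)) + norm (fst (?X2 s) - fst (?X4 s)) + norm (\<theta> s - \<theta>' s)) * norm (fst (?X3 s) - fst (?X4 s))"
      by (rule F_quad[OF s0(1) b C.\<theta>_bound[OF s0(1)] C'.\<theta>_bound[OF s0(1)]])
    also have "\<dots> \<le> A * norm (?X1 s - ?X2 s - ?X3 s + ?X4 s)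
      + A * (D\<^sub>1 * ?e + D\<^sub>1 * ?e + ?e) * (D\<^sub>1 * norm w)"
    proof (intro add_mono mult_mono)
      show "norm (fst (?X1 s) - fst (?X2 s) - fst (?X3 s) + fst (?X4 s)) \<le> norm (?X1 s - ?X2 s - ?X3 s + ?X4 s)"
        using f[of "?X1 s - ?X2 s - ?X3 s + ?X4 s"] by simp
      show "norm (fst (?X1 s) - fst (?X3 s)) \<le> D\<^sub>1 * ?e"
        using order_trans[OF f flow_diff[OF s0(2-4) z(3,4)]] by simp
      show "norm (fst (?X2 s) - fst (?X4 s)) \<le> D\<^sub>1 * ?e"
        using order_trans[OF f flow_diff[OF s0(2-4) z(1,2)]] by simp
      show "norm (\<theta> s - \<theta>' s) \<le> ?e" using \<delta>[OF s0(1)] norm_ge_zero[of "z - z'"] by linarith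
      show "norm (fst (?X3 s) - fst (?X4 s)) \<le> D\<^sub>1 * norm w"
        using order_trans[OF f flow_lipschitz(2)[OF s0(2-4), of "z' + w" z']] by simp
    qed (use A D1_ge e0 in auto)
    also have "A * (D\<^sub>1 * ?e + D\<^sub>1 * ?e + ?e) * (D\<^sub>1 * norm w) = B"
      by (simp add: B_def algebra_simps)
    finally show "norm (C.v s (?X1 s) - C.v s (?X2 s) - C'.v s (?X3 s) + C'.v s (?X4 s))
      \<le> A * norm (?X1 s - ?X2 s - ?X3 s + ?X4 s) + B" .
  qed (use tr A B0 in auto)
  also have "\<dots> = B * (r - t) * exp (A * (r - t))" by simp
  also have "\<dots> \<le> B * T * E"
    using tr A B0 T by (intro mult_mono exp_le_E) auto
  also have "\<dots> = D\<^sub>2 * norm w * ?e" by (simp add: B_def D\<^sub>2_def)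
  finally show ?thesis .
qed

text \<open>The candidate for \<psi> given by characteristics. Its increments are estimated without
  reference to a solution; differentiability is assumed only where a gradient is taken.\<close>

definition cost where "cost t z = \<psi>\<^sub>T (C.\<Psi> t T z)"
definition cost' where "cost' t z = \<psi>\<^sub>T (C'.\<Psi> t T z)"

lemma cost_diff:
  assumes t: "t \<in> {0..T}" and z: "norm z \<le> R\<^sub>0"
  shows "\<bar>cost t z - cost' t z\<bar> \<le> A * D\<^sub>1 * \<delta>"
proof -
  have "\<bar>cost t z - cost' t z\<bar> \<le> A * norm (C.\<Psi> t T z - C'.\<Psi> t T z)"
    unfolding cost_def cost'_def by (rule \<psi>\<^sub>T_lip)
  also have "\<dots> \<le> A * (D\<^sub>1 * (norm (z - z) + \<delta>))"
    using t A by (intro mult_left_mono flow_diff z) auto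
  finally show ?thesis by simp
qed

lemma cost_quad:
  assumes t: "t \<in> {0..T}"
    and z: "norm z \<le> R\<^sub>0" "norm z' \<le> R\<^sub>0" "norm (z + w) \<le> R\<^sub>0" "norm (z' + w) \<le> R\<^sub>0"
  shows "\<bar>cost t (z + w) - cost t z - cost' t (z' + w) + cost' t z'\<bar> \<le> D\<^sub>3 * norm w * (norm (z - z') + \<delta>)"
proof -
  let ?e = "norm (z - z') + \<delta>"
  have tr: "0 \<le> t" "t \<le> T" "T \<le> T" using t by auto
  have e0: "?e \<ge> 0" using \<delta>_nonneg by simp
  have "\<bar>cost t (z + w) - cost t z - cost' t (z' + w) + cost' t z'\<bar>
    \<le> A * norm (C.\<Psi> t T (z + w) - C.\<Psi> t T z - C'.\<Psi> t T (z' + w) + C'.\<Psi> t T z')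
      + A * (norm (C.\<Psi> t T (z + w) - C'.\<Psi> t T (z' + w)) + norm (C.\<Psi> t T z - C'.\<Psi> t T z')) * norm (C'.\<Psi> t T (z' + w) - C'.\<Psi> t T z')"
    unfolding cost_def cost'_def by (rule \<psi>\<^sub>T_quad)
  also have "\<dots> \<le> A * (D\<^sub>2 * norm w * ?e) + A * (D\<^sub>1 * ?e + D\<^sub>1 * ?e) * (D\<^sub>1 * norm w)"
  proof (intro add_mono mult_mono)
    show "norm (C.\<Psi> t T (z + w) - C.\<Psi> t T z - C'.\<Psi> t T (z' + w) + C'.\<Psi> t T z') \<le> D\<^sub>2 * norm w * ?e"
      by (rule flow_quad[OF tr z])
    show "norm (C.\<Psi> t T (z + w) - C'.\<Psi> t T (z' + w)) \<le> D\<^sub>1 * ?e" using flow_diff[OF tr z(3,4)] by simp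
    show "norm (C.\<Psi> t T z - C'.\<Psi> t T z') \<le> D\<^sub>1 * ?e" by (rule flow_diff[OF tr z(1,2)])
    show "norm (C'.\<Psi> t T (z' + w) - C'.\<Psi> t T z') \<le> D\<^sub>1 * norm w"
      using flow_lipschitz(2)[OF tr, of "z' + w" z'] by simp
  qed (use A D1_ge e0 in auto)
  also have "\<dots> = D\<^sub>3 * norm w * ?e" by (simp add: D\<^sub>3_def algebra_simps)
  finally show ?thesis .
qed

lemma grad_cost_bound:
  assumes t: "t \<in> {0..T}" and d: "cost' t differentiable at z"
  shows "norm (grad_x (cost' t) z) \<le> A * D\<^sub>1"
proof (rule norm_grad_x_le[OF d])
  show "A * D\<^sub>1 \<ge> 0" using A D1_ge by simp
  show "\<bar>cost' t x - cost' t y\<bar> \<le> A * D\<^sub>1 * norm (x - y)" for x y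
  proof -
    have "\<bar>cost' t x - cost' t y\<bar> \<le> A * norm (C'.\<Psi> t T x - C'.\<Psi> t T y)"
      unfolding cost'_def by (rule \<psi>\<^sub>T_lip)
    also have "\<dots> \<le> A * (D\<^sub>1 * norm (x - y))"
      using t A by (intro mult_left_mono flow_lipschitz) auto
    finally show ?thesis by simp
  qed
qed

text \<open>With u the difference of the two gradients, the directional derivatives in direction w =
  (u, 0) differ by |u|^2. They are limits of difference quotients with the common shift h w, which
  \<open>cost_quad\<close> controls.\<close>

lemma grad_cost_diff:
  assumes t: "t \<in> {0..T}" and d: "cost t differentiable at z" "cost' t differentiable at z'"
    and z: "norm z \<le> R\<^sub>0 - 1" "norm z' \<le> R\<^sub>0 - 1"
  shows "norm (grad_x (cost t) z - grad_x (cost' t) z') \<le> D\<^sub>3 * (norm (z - z') + \<delta>)"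
proof -
  define u where "u = grad_x (cost t) z - grad_x (cost' t) z'"
  define w where "w = (u, 0 :: real ^ 'd)"
  let ?e = "norm (z - z') + \<delta>"
  let ?q = "\<lambda>h. (cost t (z + h *\<^sub>R w) - cost t z) / h - (cost' t (z' + h *\<^sub>R w) - cost' t z') / h"
  have w: "norm w = norm u" by (simp add: w_def)
  have e0: "?e \<ge> 0" using \<delta>_nonneg by simp
  have "(?q \<longlongrightarrow> frechet_derivative (cost t) (at z) w - frechet_derivative (cost' t) (at z') w) (at 0)"
    by (intro tendsto_diff directional_derivative_tendsto d)
  then have "((\<lambda>h. \<bar>?q h\<bar>) \<longlongrightarrow> \<bar>frechet_derivative (cost t) (at z) w - frechet_derivative (cost' t) (at z') w\<bar>) (at 0)"
    by (rule tendsto_rabs)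
  moreover have "\<forall>\<^sub>F h in at 0. \<bar>?q h\<bar> \<le> D\<^sub>3 * norm w * ?e"
  proof -
    have "\<forall>\<^sub>F h in at 0. h \<noteq> 0 \<and> \<bar>h\<bar> < 1 / (1 + norm w)"
      unfolding eventually_at by (rule exI[of _ "1 / (1 + norm w)"]) (simp add: add_pos_nonneg)
    then show ?thesis
    proof eventually_elim
      case (elim h)
      have "\<bar>h\<bar> * norm w \<le> 1 / (1 + norm w) * (1 + norm w)"
        using elim by (intro mult_mono) (auto simp: add_nonneg_nonneg)
      also have "\<dots> = 1" by (simp add: add_nonneg_eq_0_iff)
      \<comment> \<open>A step this short keeps both shifted points in the ball of radius
        \<open>R\<^sub>0\<close>; the distance 1 kept by z and z' from its boundary was reserved for
        this.\<close>
      finally have hw: "norm (h *\<^sub>R w) \<le> 1" by simp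
      have "norm (z + h *\<^sub>R w) \<le> R\<^sub>0" "norm (z' + h *\<^sub>R w) \<le> R\<^sub>0"
        using hw z norm_triangle_ineq[of z "h *\<^sub>R w"] norm_triangle_ineq[of z' "h *\<^sub>R w"] by linarith+
      then have "\<bar>cost t (z + h *\<^sub>R w) - cost t z - cost' t (z' + h *\<^sub>R w) + cost' t z'\<bar> \<le> D\<^sub>3 * norm (h *\<^sub>R w) * ?e"
        using z by (intro cost_quad[OF t]) auto
      then have "\<bar>cost t (z + h *\<^sub>R w) - cost t z - cost' t (z' + h *\<^sub>R w) + cost' t z'\<bar> / \<bar>h\<bar> \<le> D\<^sub>3 * norm w * ?e"
        using elim by (simp add: divide_le_eq mult_ac)
      moreover have "?q h = (cost t (z + h *\<^sub>R w) - cost t z - cost' t (z' + h *\<^sub>R w) + cost' t z') / h"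
        by (simp add: diff_divide_distrib add_divide_distrib)
      ultimately show ?case by (simp only: abs_divide)
    qed
  qed
  ultimately have "\<bar>frechet_derivative (cost t) (at z) w - frechet_derivative (cost' t) (at z') w\<bar> \<le> D\<^sub>3 * norm w * ?e"
    by (rule tendsto_upperbound) simp
  moreover have "frechet_derivative (cost t) (at z) w - frechet_derivative (cost' t) (at z') w = u \<bullet> u"
    unfolding w_def grad_x_inner[OF d(1), symmetric] grad_x_inner[OF d(2), symmetric] by (simp add: u_def inner_diff_left)
  ultimately have "norm u * norm u \<le> (D\<^sub>3 * ?e) * norm u"
    by (simp add: w dot_square_norm power2_eq_square mult_ac)
  moreover have "0 \<le> D\<^sub>3 * ?e" using D3_ge e0 by simp
  ultimately show ?thesis unfolding u_def[symmetric] by (cases "norm u = 0") auto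
qed

definition K where "K t z = row_grad_theta F (grad_x (cost t) z) t (fst z) (\<theta> t)"
definition K' where "K' t z = row_grad_theta F (grad_x (cost' t) z) t (fst z) (\<theta>' t)"

text \<open>The integrands are evaluated along characteristics, so that the estimate is in terms of
  initial points, where the coupling lives.\<close>

lemma K_diff:
  assumes t: "t \<in> {0..T}" and d: "\<And>z. cost t differentiable at z" "\<And>z. cost' t differentiable at z"
    and z: "norm z \<le> R" "norm z' \<le> R"
  shows "norm (K t (C.\<Psi> 0 t z) - K' t (C'.\<Psi> 0 t z')) \<le> D\<^sub>4 * (norm (z - z') + \<delta>)"
proof -
  let ?X = "C.\<Psi> 0 t z" and ?X' = "C'.\<Psi> 0 t z'"
  have tr: "0 \<le> (0::real)" "0 \<le> t" "t \<le> T" using t by auto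
  have RR: "R \<le> R\<^sub>0" using radius_ge[of R] R R\<^sub>T by (simp add: R\<^sub>0_def)
  have X: "norm ?X \<le> R\<^sub>0 - 1" "norm ?X' \<le> R\<^sub>0 - 1"
    using order_trans[OF C.flow_bound[OF tr] radius_mono[OF z(1)]] order_trans[OF C'.flow_bound[OF tr] radius_mono[OF z(2)]] R\<^sub>T
    by (simp_all add: R\<^sub>0_def)
  have zR: "norm z \<le> R\<^sub>0" "norm z' \<le> R\<^sub>0" using z RR by auto
  note b = flow_in_ball(1)[OF tr zR(1)] flow_in_ball(2)[OF tr zR(2)]
  define e where "e = norm (?X - ?X') + \<delta>"
  have e0: "0 \<le> e" using \<delta>_nonneg by (simp add: e_def)
  have f: "norm (fst q) \<le> norm q" for q :: "(real ^ 'd) \<times> (real ^ 'd)" using norm_fst_le[of "fst q" "snd q"] by simp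
  have "norm (K t ?X - K' t ?X') \<le> norm (grad_x (cost t) ?X - grad_x (cost' t) ?X') * A + norm (grad_x (cost' t) ?X') * (A * e)"
    unfolding K_def K'_def
  proof (rule norm_row_grad_theta_diff_le)
    show "F t (fst ?X) differentiable at (\<theta> t)" "F t (fst ?X') differentiable at (\<theta>' t)" by (rule F_diff[OF t])+
    show "norm (bderiv (F t (fst ?X)) (\<theta> t)) \<le> A" by (rule DF_bound[OF t b(1)])
    have "norm (bderiv (F t (fst ?X)) (\<theta> t) - bderiv (F t (fst ?X')) (\<theta>' t)) \<le> A * (norm (fst ?X - fst ?X') + norm (\<theta> t - \<theta>' t))"
      by (rule DF_lip[OF t b C.\<theta>_bound[OF t] C'.\<theta>_bound[OF t]])
    also have "\<dots> \<le> A * e"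
      using A \<delta>[OF t] f[of "?X - ?X'"] unfolding e_def by (intro mult_left_mono add_mono) auto
    finally show "norm (bderiv (F t (fst ?X)) (\<theta> t) - bderiv (F t (fst ?X')) (\<theta>' t)) \<le> A * e" .
  qed
  also have "\<dots> \<le> (D\<^sub>3 * e) * A + (A * D\<^sub>1) * (A * e)"
    using grad_cost_diff[OF t d X] grad_cost_bound[OF t d(2)] A e0
    by (intro add_mono mult_right_mono) (auto simp: e_def)
  also have "\<dots> = (D\<^sub>3 * A + A * D\<^sub>1 * A) * e" by (simp add: algebra_simps)
  \<comment> \<open>The distance of the characteristics at time t is at most
    \<open>D\<^sub>1\<close> times the initial distance plus \<delta>; the additional 1 accounts for
    the distance of the controls at time t.\<close>
  also have "\<dots> \<le> (D\<^sub>3 * A + A * D\<^sub>1 * A) * ((D\<^sub>1 + 1) * (norm (z - z') + \<delta>))"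
  proof (rule mult_left_mono)
    have "e \<le> D\<^sub>1 * (norm (z - z') + \<delta>) + \<delta>" using flow_diff[OF tr zR] by (simp add: e_def)
    moreover have "(D\<^sub>1 + 1) * (norm (z - z') + \<delta>) = D\<^sub>1 * (norm (z - z') + \<delta>) + (norm (z - z') + \<delta>)"
      by (simp add: algebra_simps)
    ultimately show "e \<le> (D\<^sub>1 + 1) * (norm (z - z') + \<delta>)" using norm_ge_zero[of "z - z'"] by linarith
    show "0 \<le> D\<^sub>3 * A + A * D\<^sub>1 * A" using A D1_ge D3_ge by simp
  qed
  finally show ?thesis by (simp add: D\<^sub>4_def mult.assoc)
qed

end

section \<open>Stability of solutions\<close>

lemma continuous_on_grad_x:
  fixes g :: "(real ^ 'd) \<times> (real ^ 'd) \<Rightarrow> real"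
  assumes C: "C_k (Suc k) g"
  shows "continuous_on UNIV (grad_x g)"
proof -
  have "continuous_on UNIV (\<lambda>z. grad_x g z $ i)" for i
  proof -
    have "grad_x g z $ i = blinfun_apply (bderiv g z) (axis i 1, 0)" for z
      using grad_x_inner[OF C_k_differentiable[OF C], of z "axis i 1"]
      by (simp add: inner_axis bderiv_apply[OF C_k_differentiable[OF C]])
    moreover have "continuous_on UNIV (\<lambda>z. blinfun_apply (bderiv g z) (axis i 1, 0))"
      by (intro continuous_intros C_k_continuous_bderiv[OF C])
    ultimately show ?thesis by simp
  qed
  then show ?thesis by (rule continuous_on_vec_lambda[of _ "\<lambda>i z. grad_x g z $ i", simplified])
qed

lemma continuous_on_row_grad_theta:
  fixes F :: "real \<Rightarrow> real ^ 'd \<Rightarrow> real ^ 'm \<Rightarrow> real ^ 'd" and x :: "'a::topological_space \<Rightarrow> real ^ 'd"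
  assumes v: "continuous_on UNIV v" and x: "continuous_on UNIV x"
    and d: "\<And>x. F t x differentiable at \<theta>" and c: "continuous_on UNIV (\<lambda>x. bderiv (F t x) \<theta>)"
  shows "continuous_on UNIV (\<lambda>z. row_grad_theta F (v z) t (x z) \<theta>)"
proof -
  have "continuous_on UNIV (\<lambda>z. row_grad_theta F (v z) t (x z) \<theta> $ j)" for j
  proof -
    have "row_grad_theta F (v z) t (x z) \<theta> $ j = v z \<bullet> blinfun_apply (bderiv (F t (x z)) \<theta>) (axis j 1)" for z
      using row_grad_theta_inner[where F = F and t = t and x = "x z", OF d, of "v z" "axis j 1"] by (simp add: inner_axis)
    moreover have "continuous_on UNIV (\<lambda>z. v z \<bullet> blinfun_apply (bderiv (F t (x z)) \<theta>) (axis j 1))"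
      by (intro continuous_intros v continuous_on_compose2[OF c x]) auto
    ultimately show ?thesis by simp
  qed
  then show ?thesis by (rule continuous_on_vec_lambda[of _ "\<lambda>j z. row_grad_theta F (v z) t (x z) \<theta> $ j", simplified])
qed

text \<open>The image of a coupling under the pair of maps couples the images, and its cost bounds
  their distance.\<close>

lemma W1_distr_le:
  fixes f g :: "'a::euclidean_space \<Rightarrow> 'b::euclidean_space"
  assumes g: "\<gamma> \<in> couplings \<mu> \<nu>" and mu: "sets \<mu> = sets borel" "prob_space \<mu>" and nu: "sets \<nu> = sets borel"
    and m: "f \<in> borel_measurable borel" "g \<in> borel_measurable borel"
    and A: "AE x in \<mu>. x \<in> A" "AE x in \<nu>. x \<in> A" and e: "0 \<le> e" "0 \<le> C"
    and le: "\<And>x y. x \<in> A \<Longrightarrow> y \<in> A \<Longrightarrow> dist (f x) (g y) \<le> e + C * dist x y"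
  shows "W1 (distr \<mu> borel f) (distr \<nu> borel g)
    \<le> ennreal e + ennreal C * (\<integral>\<^sup>+z. ennreal (dist (fst z) (snd z)) \<partial>\<gamma>)"
proof -
  note c = couplingsD[OF g mu nu]
  interpret prob_space \<gamma> by (rule c(1))
  have d: "distr \<gamma> borel fst = \<mu>" "distr \<gamma> borel snd = \<nu>"
    using g by (auto simp: couplings_def)
  let ?h = "\<lambda>p. (f (fst p), g (snd p))"
  have h: "?h \<in> borel_measurable \<gamma>"
    using c(2,3) m by (intro borel_measurable_Pair) (auto intro: measurable_compose)
  have fs: "(fst :: 'b \<times> 'b \<Rightarrow> 'b) \<in> borel_measurable borel" "(snd :: 'b \<times> 'b \<Rightarrow> 'b) \<in> borel_measurable borel"
    by (auto intro!: borel_measurable_continuous_onI continuous_intros)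
  have "distr \<gamma> borel ?h \<in> couplings (distr \<mu> borel f) (distr \<nu> borel g)"
    unfolding couplings_def d[symmetric]
    by (simp add: distr_distr[OF fs(1) h] distr_distr[OF fs(2) h] distr_distr[OF m(1) c(2)] distr_distr[OF m(2) c(3)] o_def)
  then have "W1 (distr \<mu> borel f) (distr \<nu> borel g) \<le> (\<integral>\<^sup>+z. ennreal (dist (fst z) (snd z)) \<partial>distr \<gamma> borel ?h)"
    unfolding W1_def by (rule INF_lower)
  also have "\<dots> = (\<integral>\<^sup>+p. ennreal (dist (f (fst p)) (g (snd p))) \<partial>\<gamma>)"
    using fs by (subst nn_integral_distr[OF h]) auto
  also have "\<dots> \<le> (\<integral>\<^sup>+p. ennreal e + ennreal C * ennreal (dist (fst p) (snd p)) \<partial>\<gamma>)"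
  proof (rule nn_integral_mono_AE)
    show "AE p in \<gamma>. ennreal (dist (f (fst p)) (g (snd p))) \<le> ennreal e + ennreal C * ennreal (dist (fst p) (snd p))"
      using c(4)[OF A(1)] c(5)[OF A(2)]
    proof eventually_elim
      case (elim p)
      have "ennreal (dist (f (fst p)) (g (snd p))) \<le> ennreal (e + C * dist (fst p) (snd p))"
        using le[OF elim] by (intro ennreal_leI)
      then show ?case using e by (simp add: ennreal_plus ennreal_mult)
    qed
  qed
  also have "\<dots> = ennreal e + ennreal C * (\<integral>\<^sup>+z. ennreal (dist (fst z) (snd z)) \<partial>\<gamma>)"
    using c(2,3) by (subst nn_integral_add) (auto simp: nn_integral_cmult emeasure_space_1)
  finally show ?thesis .
qed

text \<open>Bounded supports give every coupling finite cost, so the estimate for a fixed coupling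
  can be done with a real number J.\<close>

lemma coupling_cost_finite:
  fixes \<gamma> :: "('a::euclidean_space \<times> 'a) measure"
  assumes g: "\<gamma> \<in> couplings \<mu> \<nu>" and mu: "sets \<mu> = sets borel" "prob_space \<mu>" and nu: "sets \<nu> = sets borel"
    and A: "AE x in \<mu>. norm x \<le> R" "AE x in \<nu>. norm x \<le> R"
  obtains J where "J \<ge> 0" "(\<integral>\<^sup>+z. ennreal (dist (fst z) (snd z)) \<partial>\<gamma>) = ennreal J"
proof -
  note c = couplingsD[OF g mu nu]
  interpret prob_space \<gamma> by (rule c(1))
  have "(\<integral>\<^sup>+z. ennreal (dist (fst z) (snd z)) \<partial>\<gamma>) \<le> (\<integral>\<^sup>+z. ennreal (2 * R) \<partial>\<gamma>)"
  proof (rule nn_integral_mono_AE)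
    show "AE z in \<gamma>. ennreal (dist (fst z) (snd z)) \<le> ennreal (2 * R)"
      using c(4)[OF A(1)] c(5)[OF A(2)]
    proof eventually_elim
      case (elim p)
      then show ?case
        using norm_triangle_ineq4[of "fst p" "snd p"] by (intro ennreal_leI) (simp add: dist_norm)
    qed
  qed
  also have "\<dots> = ennreal (2 * R)" by (simp add: emeasure_space_1)
  also have "\<dots> < \<infinity>" by simp
  finally have "(\<integral>\<^sup>+z. ennreal (dist (fst z) (snd z)) \<partial>\<gamma>) \<noteq> \<infinity>" by simp
  then show thesis using that by (metis ennreal_cases infinity_ennreal_def)
qed

lemma W1_self: 
  fixes \<mu> :: "'a::euclidean_space measure"
  assumes s: "sets \<mu> = sets borel"
  shows "W1 \<mu> \<mu> = 0"
proof -
  let ?h = "\<lambda>x::'a. (x, x)"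
  have h: "?h \<in> borel_measurable \<mu>"
    unfolding measurable_cong_sets[OF s refl] by (intro borel_measurable_continuous_onI continuous_intros)
  have fs: "(fst :: 'a \<times> 'a \<Rightarrow> 'a) \<in> borel_measurable borel" "(snd :: 'a \<times> 'a \<Rightarrow> 'a) \<in> borel_measurable borel"
    by (auto intro!: borel_measurable_continuous_onI continuous_intros)
  have i: "distr \<mu> borel (\<lambda>x. x) = \<mu>" by (rule distr_id2) (simp add: s)
  have "distr \<mu> borel ?h \<in> couplings \<mu> \<mu>"
    unfolding couplings_def by (simp add: distr_distr[OF fs(1) h] distr_distr[OF fs(2) h] o_def i)
  then have "W1 \<mu> \<mu> \<le> (\<integral>\<^sup>+z. ennreal (dist (fst z) (snd z)) \<partial>distr \<mu> borel ?h)"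
    unfolding W1_def by (rule INF_lower)
  also have "\<dots> = 0" using fs by (subst nn_integral_distr[OF h]) auto
  finally show ?thesis by simp
qed

text \<open>Chains the L1 bound of the control, the Lipschitz bound of the flow, the gradient bound
  of \<psi> and the control equation, whose factor 1/(2 lam) is dropped for lam at least 1. The M
  used inside the proof depends on the solution, the resulting bound does not.\<close>

lemma (in controlled_system) control_sup_bound:
  assumes sol: "solution T F \<psi>\<^sub>T C\<^sub>\<Gamma> lam \<mu>\<^sub>0 \<mu> \<theta> \<psi>" and CG: "C\<^sub>\<Gamma> > 0" and lam: "lam \<ge> 1"
    and conf: "confining_radius T F R R\<^sub>T" and supp: "measure_supp \<mu>\<^sub>0 \<subseteq> cball 0 R"
    and psi: "B\<^sub>\<psi> \<ge> 0" "\<And>z z'. \<bar>\<psi>\<^sub>T z - \<psi>\<^sub>T z'\<bar> \<le> B\<^sub>\<psi> * norm (z - z')"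
    and F: "\<And>t x \<theta>. t \<in> {0..T} \<Longrightarrow> F t x differentiable at \<theta>"
    and B: "B \<ge> 0" "\<And>t x \<theta>. t \<in> {0..T} \<Longrightarrow> norm x \<le> R\<^sub>T \<Longrightarrow> norm (bderiv (F t x) \<theta>) \<le> B"
    and t: "t \<in> {0..T}"
  shows "norm (\<theta> t) \<le> B\<^sub>\<psi> * exp (L\<^sub>F * (T + (T + C\<^sub>\<Gamma>\<^sup>2 * T))) * B"
proof -
  note rep = solution_representation[OF sol conf supp]
  obtain M where "admissible_control T C\<^sub>F L\<^sub>F F \<theta> M" using rep(1) by blast
  then interpret admissible_control T C\<^sub>F L\<^sub>F F \<theta> M .
  define e where "e = exp (L\<^sub>F * (T + (T + C\<^sub>\<Gamma>\<^sup>2 * T)))"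
  have I: "integral {0..T} (\<lambda>s. norm (\<theta> s)) \<le> T + C\<^sub>\<Gamma>\<^sup>2 * T"
    by (rule control_ball_L1[OF T CG _ \<theta>_cont]) (use sol in \<open>simp add: solution_def\<close>)
  have C2: "C_k (Suc (Suc 0)) (\<psi> t)"
    using sol t by (simp add: solution_def C1_C2c_def C2c_def numeral_2_eq_2)
  have mu: "\<mu> t \<in> P_c" using sol t by (simp add: solution_def P_c_curve_def)
  have g: "norm (grad_x (\<psi> t) z) \<le> B\<^sub>\<psi> * e" for z
  proof (rule norm_grad_x_le[OF C_k_differentiable[OF C2]])
    show "B\<^sub>\<psi> * e \<ge> 0" using psi by (simp add: e_def)
    show "\<bar>\<psi> t x - \<psi> t y\<bar> \<le> B\<^sub>\<psi> * e * norm (x - y)" for x y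
    proof -
      have "\<bar>\<psi> t x - \<psi> t y\<bar> \<le> B\<^sub>\<psi> * norm (\<Psi> t T x - \<Psi> t T y)"
        unfolding rep(5)[OF t] by (rule psi)
      also have "\<dots> \<le> B\<^sub>\<psi> * (e * norm (x - y))"
        unfolding e_def using t psi by (intro mult_left_mono flow_lipschitz_L1 I) auto
      finally show ?thesis by simp
    qed
  qed
  have e0: "0 \<le> B\<^sub>\<psi> * e * B" using psi B by (simp add: e_def)
  have bd: "norm (LINT z|\<mu> t. row_grad_theta F (grad_x (\<psi> t) z) t (fst z) (\<theta> t)) \<le> B\<^sub>\<psi> * e * B"
  proof (rule prob_integral_norm_le[OF P_cD(2)[OF mu] _ e0])
    show "AE z in \<mu> t. norm (row_grad_theta F (grad_x (\<psi> t) z) t (fst z) (\<theta> t)) \<le> B\<^sub>\<psi> * e * B"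
      using AE_measure_supp[OF P_cD(1)[OF mu]]
    proof eventually_elim
      case (elim z)
      then have "norm z \<le> R\<^sub>T" using rep(3)[OF t] by auto
      then have "norm (fst z) \<le> R\<^sub>T" using norm_fst_le[of "fst z" "snd z"] by simp
      then have b: "norm (bderiv (F t (fst z)) (\<theta> t)) \<le> B" by (rule B(2)[OF t])
      have "norm (row_grad_theta F (grad_x (\<psi> t) z) t (fst z) (\<theta> t)) \<le> norm (grad_x (\<psi> t) z) * B"
        by (rule norm_row_grad_theta_le[where F = F and t = t and x = "fst z", OF F[OF t] b])
      also have "\<dots> \<le> B\<^sub>\<psi> * e * B" by (rule mult_right_mono[OF g B(1)])
      finally show ?case .
    qed
  qed
  define X where "X = (LINT z|\<mu> t. row_grad_theta F (grad_x (\<psi> t) z) t (fst z) (\<theta> t))"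
  have "\<theta> t = - (1 / (2 * lam)) *\<^sub>R X"
    using sol t unfolding solution_def control_equation_def X_def by blast
  from arg_cong[OF this, of norm] have "norm (\<theta> t) = 1 / (2 * lam) * norm X" using lam by simp
  also have "\<dots> \<le> 1 * norm X" using lam by (intro mult_right_mono) auto
  finally show ?thesis using bd unfolding X_def[symmetric] e_def by simp
qed

context two_controls
begin

lemma control_contraction:
  assumes g: "\<gamma> \<in> couplings \<mu>\<^sub>0 \<mu>\<^sub>0'" and mu: "\<mu>\<^sub>0 \<in> P_c" "\<mu>\<^sub>0' \<in> P_c"
    and supp: "measure_supp \<mu>\<^sub>0 \<subseteq> cball 0 R" "measure_supp \<mu>\<^sub>0' \<subseteq> cball 0 R"
    and J: "J \<ge> 0" "(\<integral>\<^sup>+z. ennreal (dist (fst z) (snd z)) \<partial>\<gamma>) = ennreal J"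
    and t: "t \<in> {0..T}" and Ck: "C_k (Suc 0) (cost t)" "C_k (Suc 0) (cost' t)" and lam: "lam > 0"
    and eq: "\<theta> t = - (1 / (2 * lam)) *\<^sub>R (LINT z|distr \<mu>\<^sub>0 borel (C.\<Psi> 0 t). K t z)"
      "\<theta>' t = - (1 / (2 * lam)) *\<^sub>R (LINT z|distr \<mu>\<^sub>0' borel (C'.\<Psi> 0 t). K' t z)"
  shows "norm (\<theta> t - \<theta>' t) \<le> D\<^sub>4 / (2 * lam) * (J + \<delta>)"
proof -
  have d: "cost t differentiable at z" "cost' t differentiable at z" for z
    using C_k_differentiable[OF Ck(1)] C_k_differentiable[OF Ck(2)] by auto
  have cK: "continuous_on UNIV (K t)" "continuous_on UNIV (K' t)"
    unfolding K_def[abs_def] K'_def[abs_def]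
    by (intro continuous_on_row_grad_theta continuous_on_grad_x[OF Ck(1)] continuous_on_grad_x[OF Ck(2)]
        continuous_on_fst continuous_on_id F_diff[OF t] DF_cont[OF t])+
  have cf: "continuous_on UNIV (C.\<Psi> 0 t)" "continuous_on UNIV (C'.\<Psi> 0 t)"
    using t by (auto intro: C.continuous_on_ode_flow C'.continuous_on_ode_flow)
  have cKf: "continuous_on UNIV (\<lambda>z. K t (C.\<Psi> 0 t z))" "continuous_on UNIV (\<lambda>z. K' t (C'.\<Psi> 0 t z))"
    by (rule continuous_on_compose2[OF cK(1) cf(1)], simp, rule continuous_on_compose2[OF cK(2) cf(2)], simp)
  have ae: "AE z in \<mu>\<^sub>0. z \<in> cball 0 R" "AE z in \<mu>\<^sub>0'. z \<in> cball 0 R"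
    using AE_measure_supp[OF P_cD(1)[OF mu(1)]] AE_measure_supp[OF P_cD(1)[OF mu(2)]] supp
    by (auto elim!: eventually_mono)
  have int: "integrable \<nu> f" if "\<nu> \<in> P_c" "AE z in \<nu>. z \<in> cball 0 R" "continuous_on UNIV f"
    for \<nu> and f :: "(real ^ 'd) \<times> (real ^ 'd) \<Rightarrow> real ^ 'm"
  proof -
    interpret prob_space \<nu> by (rule P_cD(2)[OF that(1)])
    have "bounded (f ` cball 0 R)"
      by (intro compact_imp_bounded compact_continuous_image continuous_on_subset[OF that(3)]) auto
    then obtain B where B: "\<forall>y\<in>f ` cball 0 R. norm y \<le> B" unfolding bounded_iff by (elim exE)
    have "AE z in \<nu>. norm (f z) \<le> B" using that(2) by eventually_elim (use B in blast)
    moreover have "f \<in> borel_measurable \<nu>"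
      using borel_measurable_continuous_onI[OF that(3)] measurable_cong_sets[OF P_cD(1)[OF that(1)] refl] by blast
    ultimately show ?thesis by (rule integrable_const_bound)
  qed
  have m: "C.\<Psi> 0 t \<in> borel_measurable \<mu>\<^sub>0" "C'.\<Psi> 0 t \<in> borel_measurable \<mu>\<^sub>0'"
    using borel_measurable_continuous_onI[OF cf(1)] borel_measurable_continuous_onI[OF cf(2)]
    by (simp_all add: measurable_cong_sets[OF P_cD(1)[OF mu(1)] refl] measurable_cong_sets[OF P_cD(1)[OF mu(2)] refl])
  define I where "I = (LINT z|\<mu>\<^sub>0. K t (C.\<Psi> 0 t z))"
  define I' where "I' = (LINT z|\<mu>\<^sub>0'. K' t (C'.\<Psi> 0 t z))"
  have I: "(LINT z|distr \<mu>\<^sub>0 borel (C.\<Psi> 0 t). K t z) = I" "(LINT z|distr \<mu>\<^sub>0' borel (C'.\<Psi> 0 t). K' t z) = I'"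
    unfolding I_def I'_def
    using integral_distr[OF m(1) borel_measurable_continuous_onI[OF cK(1)]]
      integral_distr[OF m(2) borel_measurable_continuous_onI[OF cK(2)]] by auto
  have "ennreal (norm (I - I')) \<le> ennreal (D\<^sub>4 * \<delta>) + ennreal D\<^sub>4 * (\<integral>\<^sup>+z. ennreal (dist (fst z) (snd z)) \<partial>\<gamma>)"
    unfolding I_def I'_def
  proof (rule coupling_integral_diff[OF g P_cD(1,2)[OF mu(1)] P_cD(1)[OF mu(2)] int[OF mu(1) ae(1) cKf(1)] int[OF mu(2) ae(2) cKf(2)] ae])
    show "0 \<le> D\<^sub>4 * \<delta>" "0 \<le> D\<^sub>4" using D4_pos \<delta>_nonneg by auto
    show "norm (K t (C.\<Psi> 0 t x) - K' t (C'.\<Psi> 0 t y)) \<le> D\<^sub>4 * \<delta> + D\<^sub>4 * dist x y"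
      if "x \<in> cball 0 R" "y \<in> cball 0 R" for x y
      using K_diff[OF t d, of x y] that by (simp add: dist_norm algebra_simps)
  qed
  also have "\<dots> = ennreal (D\<^sub>4 * \<delta> + D\<^sub>4 * J)"
    using D4_pos \<delta>_nonneg J by (simp add: ennreal_plus ennreal_mult)
  finally have II: "norm (I - I') \<le> D\<^sub>4 * (J + \<delta>)"
    using D4_pos \<delta>_nonneg J by (simp add: ennreal_le_iff algebra_simps del: ennreal_plus)
  have "\<theta> t - \<theta>' t = - (1 / (2 * lam)) *\<^sub>R (I - I')"
    unfolding eq[unfolded I] by (simp add: scaleR_diff_right)
  then have "norm (\<theta> t - \<theta>' t) = 1 / (2 * lam) * norm (I - I')" using lam by simp
  also have "\<dots> \<le> 1 / (2 * lam) * (D\<^sub>4 * (J + \<delta>))" using lam II by (intro mult_left_mono) auto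
  finally show ?thesis by simp
qed

end

context mean_field_control
begin

theorem solutions_stability:
  assumes sol: "solution T F \<psi>\<^sub>T C\<^sub>\<Gamma> lam \<mu>\<^sub>0 \<mu> \<theta> \<psi>" and sol': "solution T F \<psi>\<^sub>T C\<^sub>\<Gamma> lam \<mu>\<^sub>0' \<mu>' \<theta>' \<psi>'"
    and conf: "confining_radius T F R R\<^sub>T"
    and supp: "measure_supp \<mu>\<^sub>0 \<subseteq> cball 0 R" "measure_supp \<mu>\<^sub>0' \<subseteq> cball 0 R"
    and M: "\<And>t. t \<in> {0..T} \<Longrightarrow> norm (\<theta> t) \<le> M" "\<And>t. t \<in> {0..T} \<Longrightarrow> norm (\<theta>' t) \<le> M"
    and lam: "lam \<ge> D\<^sub>4" and t: "t \<in> {0..T}"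
  shows "ennreal (norm (\<theta> t - \<theta>' t)) \<le> W1 \<mu>\<^sub>0 \<mu>\<^sub>0'"
    and "W1 (\<mu> t) (\<mu>' t) \<le> ennreal (2 * D\<^sub>1) * W1 \<mu>\<^sub>0 \<mu>\<^sub>0'"
    and "norm z \<le> R\<^sub>T \<Longrightarrow> ennreal \<bar>\<psi> t z - \<psi>' t z\<bar> \<le> ennreal (A * D\<^sub>1) * W1 \<mu>\<^sub>0 \<mu>\<^sub>0'"
proof -
  note rep = solution_representation[OF sol conf supp(1)] and rep' = solution_representation[OF sol' conf supp(2)]
  have adm: "admissible_control T C\<^sub>F L\<^sub>F F \<theta> M"
    by unfold_locales (use sol M in \<open>auto simp: solution_def\<close>)
  have adm': "admissible_control T C\<^sub>F L\<^sub>F F \<theta>' M"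
    by unfold_locales (use sol' M in \<open>auto simp: solution_def\<close>)
  \<comment> \<open>Everything is proved for one coupling of cost J, with constants independent of
    it; each of the three claims then follows by taking the infimum over couplings.\<close>
  have key: "norm (\<theta> t - \<theta>' t) \<le> J \<and> W1 (\<mu> t) (\<mu>' t) \<le> ennreal (2 * D\<^sub>1) * ennreal J \<and>
      (norm z \<le> R\<^sub>T \<longrightarrow> \<bar>\<psi> t z - \<psi>' t z\<bar> \<le> A * D\<^sub>1 * J)"
    if g: "\<gamma> \<in> couplings \<mu>\<^sub>0 \<mu>\<^sub>0'" and J: "J \<ge> 0" "(\<integral>\<^sup>+z. ennreal (dist (fst z) (snd z)) \<partial>\<gamma>) = ennreal J"
      and t: "t \<in> {0..T}" for \<gamma> J t z
  proof -
    \<comment> \<open>The bound 2 M makes this supremum finite, which is indispensable for absorbing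
      it below.\<close>
    define \<delta> where "\<delta> = (SUP t\<in>{0..T}. norm (\<theta> t - \<theta>' t))"
    have bdd: "bdd_above ((\<lambda>t. norm (\<theta> t - \<theta>' t)) ` {0..T})"
    proof (rule bdd_aboveI2)
      fix t assume "t \<in> {0..T}"
      then show "norm (\<theta> t - \<theta>' t) \<le> 2 * M"
        using M[of t] norm_triangle_ineq4[of "\<theta> t" "\<theta>' t"] by simp
    qed
    have \<delta>: "norm (\<theta> t - \<theta>' t) \<le> \<delta>" if "t \<in> {0..T}" for t
      unfolding \<delta>_def by (rule cSUP_upper[OF that bdd])
    interpret two_controls T C\<^sub>F L\<^sub>F R R\<^sub>T M A F \<psi>\<^sub>T \<theta> \<theta>' \<delta>
      by (intro two_controls.intro two_controls_axioms.intro mean_field_control_axioms adm adm' \<delta>)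
    have psi: "\<psi> t = cost t" "\<psi>' t = cost' t" if "t \<in> {0..T}" for t
      using rep(5)[OF that] rep'(5)[OF that] by (auto simp: cost_def cost'_def)
    have step: "norm (\<theta> t - \<theta>' t) \<le> (J + \<delta>) / 2" if t: "t \<in> {0..T}" for t
    proof -
      have "norm (\<theta> t - \<theta>' t) \<le> D\<^sub>4 / (2 * lam) * (J + \<delta>)"
      proof (rule control_contraction[OF g rep(2) rep'(2) supp J t])
        show "lam > 0" using lam D4_pos by simp
        have C2: "C2c (\<psi> t)" "C2c (\<psi>' t)" using sol sol' t by (simp_all add: solution_def C1_C2c_def)
        show "C_k (Suc 0) (cost t)" "C_k (Suc 0) (cost' t)"
          using C2 unfolding psi[OF t] C2c_def numeral_2_eq_2 by (blast intro: C_k_Suc_imp)+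
        show "\<theta> t = - (1 / (2 * lam)) *\<^sub>R (LINT z|distr \<mu>\<^sub>0 borel (C.\<Psi> 0 t). K t z)"
          using sol t unfolding solution_def control_equation_def K_def rep(4)[OF t, symmetric] psi(1)[OF t, symmetric] by blast
        show "\<theta>' t = - (1 / (2 * lam)) *\<^sub>R (LINT z|distr \<mu>\<^sub>0' borel (C'.\<Psi> 0 t). K' t z)"
          using sol' t unfolding solution_def control_equation_def K'_def rep'(4)[OF t, symmetric] psi(2)[OF t, symmetric] by blast
      qed
      \<comment> \<open>Here lam at least \<open>D\<^sub>4\<close> turns the factor
        \<open>D\<^sub>4 / (2 * lam)\<close> into 1/2, leaving a proper fraction of \<delta> on the
        right.\<close>
      also have "\<dots> \<le> 1 / 2 * (J + \<delta>)"
        using lam D4_pos J \<delta>_nonneg by (intro mult_right_mono) (auto simp: divide_simps)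
      finally show ?thesis by simp
    qed
    \<comment> \<open>Taking the supremum over t on the left makes the inequality self-referential;
      half of \<delta> is moved to the left.\<close>
    have "\<delta> \<le> (J + \<delta>) / 2"
      unfolding \<delta>_def by (rule cSUP_least) (use T step in \<open>auto simp: \<delta>_def\<close>)
    then have \<delta>J: "\<delta> \<le> J" by simp
    have RR: "R \<le> R\<^sub>0" "R\<^sub>T \<le> R\<^sub>0" using radius_ge[of R] R R\<^sub>T by (simp_all add: R\<^sub>0_def)
    have ae: "AE z in \<mu>\<^sub>0. z \<in> cball 0 R" "AE z in \<mu>\<^sub>0'. z \<in> cball 0 R"
      using AE_measure_supp[OF P_cD(1)[OF rep(2)]] AE_measure_supp[OF P_cD(1)[OF rep'(2)]] supp
      by (auto elim!: eventually_mono)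
    have "W1 (\<mu> t) (\<mu>' t) \<le> ennreal (D\<^sub>1 * \<delta>) + ennreal D\<^sub>1 * (\<integral>\<^sup>+z. ennreal (dist (fst z) (snd z)) \<partial>\<gamma>)"
      unfolding rep(4)[OF t] rep'(4)[OF t]
    proof (rule W1_distr_le[OF g P_cD(1,2)[OF rep(2)] P_cD(1)[OF rep'(2)] _ _ ae])
      show "C.\<Psi> 0 t \<in> borel_measurable borel" "C'.\<Psi> 0 t \<in> borel_measurable borel"
        using t by (auto intro!: borel_measurable_continuous_onI C.continuous_on_ode_flow C'.continuous_on_ode_flow)
      show "0 \<le> D\<^sub>1 * \<delta>" "0 \<le> D\<^sub>1" using D1_ge \<delta>_nonneg by auto
      show "dist (C.\<Psi> 0 t x) (C'.\<Psi> 0 t y) \<le> D\<^sub>1 * \<delta> + D\<^sub>1 * dist x y" if "x \<in> cball 0 R" "y \<in> cball 0 R" for x y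
        using flow_diff[of 0 t x y] that t RR by (simp add: dist_norm algebra_simps)
    qed
    also have "\<dots> = ennreal (D\<^sub>1 * \<delta> + D\<^sub>1 * J)"
      using D1_ge \<delta>_nonneg J by (simp add: ennreal_plus ennreal_mult)
    also have "\<dots> \<le> ennreal (2 * D\<^sub>1 * J)"
    proof (rule ennreal_leI)
      have "D\<^sub>1 * \<delta> \<le> D\<^sub>1 * J" using D1_ge \<delta>J by (intro mult_left_mono) auto
      then show "D\<^sub>1 * \<delta> + D\<^sub>1 * J \<le> 2 * D\<^sub>1 * J" by linarith
    qed
    also have "\<dots> = ennreal (2 * D\<^sub>1) * ennreal J" using D1_ge J by (simp add: ennreal_mult)
    finally have 2: "W1 (\<mu> t) (\<mu>' t) \<le> ennreal (2 * D\<^sub>1) * ennreal J" .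
    have 3: "\<bar>\<psi> t z - \<psi>' t z\<bar> \<le> A * D\<^sub>1 * J" if "norm z \<le> R\<^sub>T"
    proof -
      have "\<bar>\<psi> t z - \<psi>' t z\<bar> \<le> A * D\<^sub>1 * \<delta>"
        unfolding psi[OF t] using that RR by (intro cost_diff[OF t]) simp
      also have "\<dots> \<le> A * D\<^sub>1 * J" using A D1_ge \<delta>J by (intro mult_left_mono) auto
      finally show ?thesis .
    qed
    show ?thesis using order_trans[OF \<delta>[OF t] \<delta>J] 2 3 by blast
  qed
  have fin: "\<exists>J\<ge>0. (\<integral>\<^sup>+z. ennreal (dist (fst z) (snd z)) \<partial>\<gamma>) = ennreal J" if g: "\<gamma> \<in> couplings \<mu>\<^sub>0 \<mu>\<^sub>0'" for \<gamma>
  proof -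
    have ae: "AE z in \<mu>\<^sub>0. norm z \<le> R" "AE z in \<mu>\<^sub>0'. norm z \<le> R"
      using AE_measure_supp[OF P_cD(1)[OF rep(2)]] AE_measure_supp[OF P_cD(1)[OF rep'(2)]] supp
      by (auto elim!: eventually_mono)
    obtain J where "J \<ge> 0" "(\<integral>\<^sup>+z. ennreal (dist (fst z) (snd z)) \<partial>\<gamma>) = ennreal J"
      by (rule coupling_cost_finite[OF g P_cD(1,2)[OF rep(2)] P_cD(1)[OF rep'(2)] ae])
    then show ?thesis by blast
  qed
  show "ennreal (norm (\<theta> t - \<theta>' t)) \<le> W1 \<mu>\<^sub>0 \<mu>\<^sub>0'"
    unfolding W1_def
  proof (rule INF_greatest)
    fix \<gamma> assume g: "\<gamma> \<in> couplings \<mu>\<^sub>0 \<mu>\<^sub>0'"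
    then obtain J where J: "J \<ge> 0" "(\<integral>\<^sup>+z. ennreal (dist (fst z) (snd z)) \<partial>\<gamma>) = ennreal J" using fin by blast
    show "ennreal (norm (\<theta> t - \<theta>' t)) \<le> (\<integral>\<^sup>+z. ennreal (dist (fst z) (snd z)) \<partial>\<gamma>)"
      using key[OF g J t] J by (simp add: ennreal_leI)
  qed
  have "W1 (\<mu> t) (\<mu>' t) \<le> ennreal 0 + ennreal (2 * D\<^sub>1) * W1 \<mu>\<^sub>0 \<mu>\<^sub>0'"
    unfolding W1_def[of \<mu>\<^sub>0]
  proof (rule le_affine_INF_ennreal)
    fix \<gamma> assume g: "\<gamma> \<in> couplings \<mu>\<^sub>0 \<mu>\<^sub>0'"
    then obtain J where J: "J \<ge> 0" "(\<integral>\<^sup>+z. ennreal (dist (fst z) (snd z)) \<partial>\<gamma>) = ennreal J" using fin by blast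
    show "W1 (\<mu> t) (\<mu>' t) \<le> ennreal 0 + ennreal (2 * D\<^sub>1) * (\<integral>\<^sup>+z. ennreal (dist (fst z) (snd z)) \<partial>\<gamma>)"
      using key[OF g J t] J by simp
  qed (use D1_ge in simp)
  then show "W1 (\<mu> t) (\<mu>' t) \<le> ennreal (2 * D\<^sub>1) * W1 \<mu>\<^sub>0 \<mu>\<^sub>0'" by simp
  show "ennreal \<bar>\<psi> t z - \<psi>' t z\<bar> \<le> ennreal (A * D\<^sub>1) * W1 \<mu>\<^sub>0 \<mu>\<^sub>0'" if z: "norm z \<le> R\<^sub>T"
  proof -
    have "ennreal \<bar>\<psi> t z - \<psi>' t z\<bar> \<le> ennreal 0 + ennreal (A * D\<^sub>1) * W1 \<mu>\<^sub>0 \<mu>\<^sub>0'"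
      unfolding W1_def[of \<mu>\<^sub>0]
    proof (rule le_affine_INF_ennreal)
      fix \<gamma> assume g: "\<gamma> \<in> couplings \<mu>\<^sub>0 \<mu>\<^sub>0'"
      then obtain J where J: "J \<ge> 0" "(\<integral>\<^sup>+z. ennreal (dist (fst z) (snd z)) \<partial>\<gamma>) = ennreal J" using fin by blast
      have "ennreal \<bar>\<psi> t z - \<psi>' t z\<bar> \<le> ennreal (A * D\<^sub>1 * J)"
        using key[OF g J t] z by (intro ennreal_leI) blast
      also have "\<dots> = ennreal (A * D\<^sub>1) * ennreal J" using A D1_ge J by (simp add: ennreal_mult)
      finally show "ennreal \<bar>\<psi> t z - \<psi>' t z\<bar> \<le> ennreal 0 + ennreal (A * D\<^sub>1) * (\<integral>\<^sup>+z. ennreal (dist (fst z) (snd z)) \<partial>\<gamma>)"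
        using J by simp
    qed (use A D1_ge in simp)
    then show ?thesis by simp
  qed
qed

end

section \<open>Constants\<close>

lemma assumption_A1D:
  fixes F :: "real \<Rightarrow> real ^ 'd \<Rightarrow> real ^ 'm \<Rightarrow> real ^ 'd"
  assumes A1: "assumption_A1 T F"
  shows "\<And>\<theta>. continuous_on ({0..T} \<times> UNIV) (\<lambda>(t, x). F t x \<theta>)"
    and "\<exists>C\<^sub>F>0. \<forall>\<theta>. AE t\<in>{0..T} in lborel. \<forall>x. norm (F t x \<theta>) \<le> C\<^sub>F * (1 + norm x)"
    and "\<exists>L\<^sub>F>0. \<forall>\<theta>. AE t\<in>{0..T} in lborel. \<forall>x\<^sub>1 x\<^sub>2.
        norm (F t x\<^sub>1 \<theta> - F t x\<^sub>2 \<theta>) \<le> L\<^sub>F * (1 + norm \<theta>) * norm (x\<^sub>1 - x\<^sub>2)"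
    and "\<And>t x \<theta>. t \<in> {0..T} \<Longrightarrow> F t x differentiable at \<theta>"
    and "\<And>t x \<theta>. t \<in> {0..T} \<Longrightarrow> bderiv (F t x) differentiable at \<theta>"
    and "\<And>r. r > 0 \<Longrightarrow> \<exists>C>0. \<forall>t\<in>{0..T}. \<forall>x\<in>cball 0 r. \<forall>\<theta>.
           norm (bderiv (F t x) \<theta>) + norm (bderiv (bderiv (F t x)) \<theta>) \<le> C"
proof -
  note c = A1[unfolded assumption_A1_def]
  show "continuous_on ({0..T} \<times> UNIV) (\<lambda>(t, x). F t x \<theta>)" for \<theta> by (rule spec[OF conjunct1[OF c]])
  note c = conjunct2[OF c]
  show "\<exists>C\<^sub>F>0. \<forall>\<theta>. AE t\<in>{0..T} in lborel. \<forall>x. norm (F t x \<theta>) \<le> C\<^sub>F * (1 + norm x)" by (rule conjunct1[OF c])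
  note c = conjunct2[OF c]
  show "\<exists>L\<^sub>F>0. \<forall>\<theta>. AE t\<in>{0..T} in lborel. \<forall>x\<^sub>1 x\<^sub>2.
        norm (F t x\<^sub>1 \<theta> - F t x\<^sub>2 \<theta>) \<le> L\<^sub>F * (1 + norm \<theta>) * norm (x\<^sub>1 - x\<^sub>2)" by (rule conjunct1[OF c])
  note c = conjunct2[OF c]
  show "F t x differentiable at \<theta>" "bderiv (F t x) differentiable at \<theta>" if "t \<in> {0..T}" for t x \<theta>
    using conjunct1[OF c] that by simp_all
  show "\<exists>C>0. \<forall>t\<in>{0..T}. \<forall>x\<in>cball 0 r. \<forall>\<theta>.
           norm (bderiv (F t x) \<theta>) + norm (bderiv (bderiv (F t x)) \<theta>) \<le> C" if "r > 0" for r
    by (rule conjunct2[OF conjunct2[OF mp[OF spec[OF conjunct2[OF c]] that]]])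
qed

lemma assumption_A2D:
  fixes F :: "real \<Rightarrow> real ^ 'd \<Rightarrow> real ^ 'm \<Rightarrow> real ^ 'd"
  assumes A2: "assumption_A2 T F" and r: "r > 0"
  shows "\<And>t \<theta>. t \<in> {0..T} \<Longrightarrow> C_k (Suc (Suc 0)) (\<lambda>x. F t x \<theta>)"
    and "\<And>t \<theta>. t \<in> {0..T} \<Longrightarrow> (\<lambda>x. bderiv (F t x) \<theta>) differentiable_on UNIV"
    and "\<exists>C. mono C \<and> (\<forall>t\<in>{0..T}. \<forall>x\<in>cball 0 r. \<forall>\<theta>.
        norm (bderiv (\<lambda>x'. bderiv (F t x') \<theta>) x) + norm (bderiv (\<lambda>x'. F t x' \<theta>) x)
          + norm (bderiv (bderiv (\<lambda>x'. F t x' \<theta>)) x) \<le> C (norm \<theta>))"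
    and "\<exists>C. \<forall>\<theta>\<^sub>1 \<theta>\<^sub>2. \<forall>s\<in>{0..T}. \<forall>t\<in>{0..T}. \<forall>x\<in>cball 0 r.
        norm (F t x \<theta>\<^sub>1 - F s x \<theta>\<^sub>2) \<le> C * (\<bar>t - s\<bar> + norm (\<theta>\<^sub>1 - \<theta>\<^sub>2))"
    and "\<exists>C. mono C \<and> (\<forall>\<theta>. \<forall>t\<in>{0..T}. \<forall>x\<in>cball 0 r. \<forall>y\<in>cball 0 r.
        norm (bderiv (F t x) \<theta> - bderiv (F t y) \<theta>) \<le> C (norm \<theta>) * norm (x - y))"
proof -
  note c = mp[OF spec[OF A2[unfolded assumption_A2_def numeral_2_eq_2]] r]
  show "C_k (Suc (Suc 0)) (\<lambda>x. F t x \<theta>)" if "t \<in> {0..T}" for t \<theta>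
    by (rule conjunct1[OF spec[OF bspec[OF conjunct1[OF c] that]]])
  show "(\<lambda>x. bderiv (F t x) \<theta>) differentiable_on UNIV" if "t \<in> {0..T}" for t \<theta>
    by (rule conjunct2[OF spec[OF bspec[OF conjunct1[OF c] that]]])
  note c = conjunct2[OF c]
  show "\<exists>C. mono C \<and> (\<forall>t\<in>{0..T}. \<forall>x\<in>cball 0 r. \<forall>\<theta>.
        norm (bderiv (\<lambda>x'. bderiv (F t x') \<theta>) x) + norm (bderiv (\<lambda>x'. F t x' \<theta>) x)
          + norm (bderiv (bderiv (\<lambda>x'. F t x' \<theta>)) x) \<le> C (norm \<theta>))" by (rule conjunct1[OF c])
  note c = conjunct2[OF c]
  show "\<exists>C. \<forall>\<theta>\<^sub>1 \<theta>\<^sub>2. \<forall>s\<in>{0..T}. \<forall>t\<in>{0..T}. \<forall>x\<in>cball 0 r.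
        norm (F t x \<theta>\<^sub>1 - F s x \<theta>\<^sub>2) \<le> C * (\<bar>t - s\<bar> + norm (\<theta>\<^sub>1 - \<theta>\<^sub>2))" by (rule conjunct1[OF c])
  show "\<exists>C. mono C \<and> (\<forall>\<theta>. \<forall>t\<in>{0..T}. \<forall>x\<in>cball 0 r. \<forall>y\<in>cball 0 r.
        norm (bderiv (F t x) \<theta> - bderiv (F t y) \<theta>) \<le> C (norm \<theta>) * norm (x - y))" by (rule conjunct2[OF c])
qed

text \<open>At fixed points and fixed control the quantities are continuous in time, so bounds valid
  for almost every time hold at every time. This removes exceptional null sets that depend on
  \<theta> and could not be followed along a varying control.\<close>

lemma assumption_A1_growth_lipschitz:
  fixes F :: "real \<Rightarrow> real ^ 'd \<Rightarrow> real ^ 'm \<Rightarrow> real ^ 'd"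
  assumes T: "T > 0" and A1: "assumption_A1 T F"
  shows "\<exists>C\<^sub>F>0. \<forall>t\<in>{0..T}. \<forall>x \<theta>. norm (F t x \<theta>) \<le> C\<^sub>F * (1 + norm x)"
    and "\<exists>L\<^sub>F>0. \<forall>t\<in>{0..T}. \<forall>x y \<theta>. norm (F t x \<theta> - F t y \<theta>) \<le> L\<^sub>F * (1 + norm \<theta>) * norm (x - y)"
proof -
  have cF: "continuous_on {0..T} (\<lambda>t. F t x \<theta>)" for x \<theta>
  proof -
    have "continuous_on ({0..T} \<times> UNIV) (\<lambda>(t, x). F t x \<theta>)" by (rule assumption_A1D(1)[OF A1])
    from continuous_on_compose2[OF this, of "{0..T}" "\<lambda>t. (t, x)"] show ?thesis
      by (simp add: continuous_on_Pair image_subset_iff)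
  qed
  obtain C\<^sub>F where C: "C\<^sub>F > 0" "\<And>\<theta>. AE t\<in>{0..T} in lborel. \<forall>x. norm (F t x \<theta>) \<le> C\<^sub>F * (1 + norm x)"
    using assumption_A1D(2)[OF A1] by blast
  obtain L\<^sub>F where L: "L\<^sub>F > 0" "\<And>\<theta>. AE t\<in>{0..T} in lborel. \<forall>x\<^sub>1 x\<^sub>2.
        norm (F t x\<^sub>1 \<theta> - F t x\<^sub>2 \<theta>) \<le> L\<^sub>F * (1 + norm \<theta>) * norm (x\<^sub>1 - x\<^sub>2)"
    using assumption_A1D(3)[OF A1] by blast
  have "norm (F t x \<theta>) \<le> C\<^sub>F * (1 + norm x)" if "t \<in> {0..T}" for t x \<theta>
  proof (rule AE_Icc_le[OF T _ _ that])
    show "continuous_on {0..T} (\<lambda>t. norm (F t x \<theta>))" by (intro continuous_intros cF)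
    show "AE t\<in>{0..T} in lborel. norm (F t x \<theta>) \<le> C\<^sub>F * (1 + norm x)"
      using C(2)[of \<theta>] by (rule eventually_mono) blast
  qed
  then show "\<exists>C\<^sub>F>0. \<forall>t\<in>{0..T}. \<forall>x \<theta>. norm (F t x \<theta>) \<le> C\<^sub>F * (1 + norm x)" using C(1) by blast
  have "norm (F t x \<theta> - F t y \<theta>) \<le> L\<^sub>F * (1 + norm \<theta>) * norm (x - y)" if "t \<in> {0..T}" for t x y \<theta>
  proof (rule AE_Icc_le[OF T _ _ that])
    show "continuous_on {0..T} (\<lambda>t. norm (F t x \<theta> - F t y \<theta>))" by (intro continuous_intros cF)
    show "AE t\<in>{0..T} in lborel. norm (F t x \<theta> - F t y \<theta>) \<le> L\<^sub>F * (1 + norm \<theta>) * norm (x - y)"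
      using L(2)[of \<theta>] by (rule eventually_mono) blast
  qed
  then show "\<exists>L\<^sub>F>0. \<forall>t\<in>{0..T}. \<forall>x y \<theta>. norm (F t x \<theta> - F t y \<theta>) \<le> L\<^sub>F * (1 + norm \<theta>) * norm (x - y)"
    using L(1) by blast
qed

lemma assumption_A1_derivative_bounds:
  fixes F :: "real \<Rightarrow> real ^ 'd \<Rightarrow> real ^ 'm \<Rightarrow> real ^ 'd"
  assumes A1: "assumption_A1 T F" and r: "r > 0"
  shows "\<exists>C>0. \<forall>t\<in>{0..T}. \<forall>x\<in>cball 0 r. \<forall>\<theta> \<theta>'. norm (bderiv (F t x) \<theta>) \<le> C \<and>
      norm (bderiv (F t x) \<theta> - bderiv (F t x) \<theta>') \<le> C * norm (\<theta> - \<theta>')"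
proof -
  obtain C where C: "C > 0" "\<And>t x \<theta>. t \<in> {0..T} \<Longrightarrow> x \<in> cball 0 r \<Longrightarrow>
      norm (bderiv (F t x) \<theta>) + norm (bderiv (bderiv (F t x)) \<theta>) \<le> C"
    using assumption_A1D(6)[OF A1 r] by blast
  have b: "norm (bderiv (F t x) \<theta>) \<le> C" "norm (bderiv (bderiv (F t x)) \<theta>) \<le> C" if "t \<in> {0..T}" "x \<in> cball 0 r" for t x \<theta>
    using C(2)[OF that, of \<theta>] norm_ge_zero[of "bderiv (bderiv (F t x)) \<theta>"] norm_ge_zero[of "bderiv (F t x) \<theta>"] by linarith+
  have "norm (bderiv (F t x) \<theta> - bderiv (F t x) \<theta>') \<le> C * norm (\<theta> - \<theta>')" if "t \<in> {0..T}" "x \<in> cball 0 r" for t x \<theta> \<theta>'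
    by (rule bderiv_bound_lipschitz[OF convex_UNIV assumption_A1D(5)[OF A1 that(1)] b(2)[OF that] UNIV_I UNIV_I])
  then show ?thesis using C(1) b(1) by blast
qed

text \<open>Monotonicity turns a constant depending on |\<theta>| into its value at M, uniformly
  over all controls of norm at most M.\<close>

lemma assumption_A2_bounds:
  fixes F :: "real \<Rightarrow> real ^ 'd \<Rightarrow> real ^ 'm \<Rightarrow> real ^ 'd"
  assumes A2: "assumption_A2 T F" and r: "r > 0"
  shows "\<exists>C\<ge>0. \<forall>t\<in>{0..T}. \<forall>x\<in>cball 0 r. \<forall>y\<in>cball 0 r. \<forall>\<theta>. norm \<theta> \<le> M \<longrightarrow>
      norm (bderiv (\<lambda>x. F t x \<theta>) x) \<le> C \<and>
      norm (bderiv (\<lambda>x. F t x \<theta>) x - bderiv (\<lambda>x. F t x \<theta>) y) \<le> C * norm (x - y) \<and>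
      norm (bderiv (F t x) \<theta> - bderiv (F t y) \<theta>) \<le> C * norm (x - y)"
proof -
  obtain C1 where C1: "mono C1" "\<And>t x \<theta>. t \<in> {0..T} \<Longrightarrow> x \<in> cball 0 r \<Longrightarrow>
        norm (bderiv (\<lambda>x'. bderiv (F t x') \<theta>) x) + norm (bderiv (\<lambda>x'. F t x' \<theta>) x)
          + norm (bderiv (bderiv (\<lambda>x'. F t x' \<theta>)) x) \<le> C1 (norm \<theta>)"
    using assumption_A2D(3)[OF A2 r] by blast
  obtain C3 where C3: "mono C3" "\<And>\<theta> t x y. t \<in> {0..T} \<Longrightarrow> x \<in> cball 0 r \<Longrightarrow> y \<in> cball 0 r \<Longrightarrow>
        norm (bderiv (F t x) \<theta> - bderiv (F t y) \<theta>) \<le> C3 (norm \<theta>) * norm (x - y)"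
    using assumption_A2D(5)[OF A2 r] by blast
  define C where "C = \<bar>C1 M\<bar> + \<bar>C3 M\<bar>"
  have C: "C \<ge> 0" "C1 M \<le> C" "C3 M \<le> C" by (auto simp: C_def)
  have b: "norm (bderiv (\<lambda>x. F t x \<theta>) x) \<le> C" "norm (bderiv (bderiv (\<lambda>x. F t x \<theta>)) x) \<le> C"
    if "t \<in> {0..T}" "x \<in> cball 0 r" "norm \<theta> \<le> M" for t x \<theta>
  proof -
    have "C1 (norm \<theta>) \<le> C" using monoD[OF C1(1) that(3)] C(2) by simp
    moreover have "norm (bderiv (\<lambda>x'. bderiv (F t x') \<theta>) x) + norm (bderiv (\<lambda>x'. F t x' \<theta>) x)
          + norm (bderiv (bderiv (\<lambda>x'. F t x' \<theta>)) x) \<le> C1 (norm \<theta>)" using C1(2) that by simp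
    moreover have "0 \<le> norm (bderiv (\<lambda>x'. bderiv (F t x') \<theta>) x)" "0 \<le> norm (bderiv (\<lambda>x'. F t x' \<theta>) x)"
      "0 \<le> norm (bderiv (bderiv (\<lambda>x'. F t x' \<theta>)) x)" by (rule norm_ge_zero)+
    ultimately show "norm (bderiv (\<lambda>x. F t x \<theta>) x) \<le> C" "norm (bderiv (bderiv (\<lambda>x. F t x \<theta>)) x) \<le> C" by linarith+
  qed
  have 1: "norm (bderiv (\<lambda>x. F t x \<theta>) x - bderiv (\<lambda>x. F t x \<theta>) y) \<le> C * norm (x - y)"
    if t: "t \<in> {0..T}" and x: "x \<in> cball 0 r" "y \<in> cball 0 r" and \<theta>: "norm \<theta> \<le> M" for t x y \<theta>
    by (rule bderiv_bound_lipschitz[OF convex_cball bderiv_differentiable[OF assumption_A2D(1)[OF A2 r t]] b(2)[OF t _ \<theta>] x])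
  have 2: "norm (bderiv (F t x) \<theta> - bderiv (F t y) \<theta>) \<le> C * norm (x - y)"
    if t: "t \<in> {0..T}" and x: "x \<in> cball 0 r" "y \<in> cball 0 r" and \<theta>: "norm \<theta> \<le> M" for t x y \<theta>
  proof -
    have "C3 (norm \<theta>) \<le> C" using monoD[OF C3(1) \<theta>] C(3) by simp
    then have "C3 (norm \<theta>) * norm (x - y) \<le> C * norm (x - y)" by (rule mult_right_mono) simp
    then show ?thesis using C3(2)[OF t x, of \<theta>] by simp
  qed
  show ?thesis using C(1) b(1) 1 2 by blast
qed

lemma assumption_A2_time:
  fixes F :: "real \<Rightarrow> real ^ 'd \<Rightarrow> real ^ 'm \<Rightarrow> real ^ 'd"
  assumes A2: "assumption_A2 T F" and r: "r > 0"
  shows "\<exists>C\<ge>0. \<forall>\<theta>\<^sub>1 \<theta>\<^sub>2. \<forall>s\<in>{0..T}. \<forall>t\<in>{0..T}. \<forall>x\<in>cball 0 r.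
        norm (F t x \<theta>\<^sub>1 - F s x \<theta>\<^sub>2) \<le> C * (\<bar>t - s\<bar> + norm (\<theta>\<^sub>1 - \<theta>\<^sub>2))"
proof -
  obtain C where C: "\<forall>\<theta>\<^sub>1 \<theta>\<^sub>2. \<forall>s\<in>{0..T}. \<forall>t\<in>{0..T}. \<forall>x\<in>cball 0 r.
        norm (F t x \<theta>\<^sub>1 - F s x \<theta>\<^sub>2) \<le> C * (\<bar>t - s\<bar> + norm (\<theta>\<^sub>1 - \<theta>\<^sub>2))"
    using assumption_A2D(4)[OF A2 r] by (elim exE)
  have "C * (\<bar>t - s\<bar> + norm (\<theta>\<^sub>1 - \<theta>\<^sub>2)) \<le> \<bar>C\<bar> * (\<bar>t - s\<bar> + norm (\<theta>\<^sub>1 - \<theta>\<^sub>2))" for s t and \<theta>\<^sub>1 \<theta>\<^sub>2 :: "real ^ 'm"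
    by (intro mult_right_mono) auto
  with C show ?thesis
    by (intro exI[of _ "\<bar>C\<bar>"] conjI abs_ge_zero allI ballI) (meson order_trans)
qed

text \<open>The order of choice avoids circularity: growth and Lipschitz constants come from
  \<open>F\<close> alone, M needs only bounds on the ball of radius \<open>R\<^sub>T\<close> that
  are uniform in \<theta>, and only then are the constants chosen that depend on |\<theta>| through
  M.\<close>

lemma mean_field_control_exists:
  fixes F :: "real \<Rightarrow> real ^ 'd \<Rightarrow> real ^ 'm \<Rightarrow> real ^ 'd" and \<psi>\<^sub>T :: "(real ^ 'd) \<times> (real ^ 'd) \<Rightarrow> real"
  assumes T: "T > 0" and R: "R > 0" and CG: "C\<^sub>\<Gamma> > 0" and A1: "assumption_A1 T F" and A2: "assumption_A2 T F"
    and conf: "confining_radius T F R R\<^sub>T" and \<psi>\<^sub>T: "C2c \<psi>\<^sub>T"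
  obtains C\<^sub>F L\<^sub>F M A where "mean_field_control T C\<^sub>F L\<^sub>F F R R\<^sub>T M A \<psi>\<^sub>T"
    "\<And>lam \<mu>\<^sub>0 \<mu> \<theta> \<psi> t. lam \<ge> 1 \<Longrightarrow> measure_supp \<mu>\<^sub>0 \<subseteq> cball 0 R \<Longrightarrow>
       solution T F \<psi>\<^sub>T C\<^sub>\<Gamma> lam \<mu>\<^sub>0 \<mu> \<theta> \<psi> \<Longrightarrow> t \<in> {0..T} \<Longrightarrow> norm (\<theta> t) \<le> M"
proof -
  have RT: "R\<^sub>T > 0" using conf by (simp add: confining_radius_def)
  obtain C\<^sub>F where CF: "C\<^sub>F > 0" "\<forall>t\<in>{0..T}. \<forall>x \<theta>. norm (F t x \<theta>) \<le> C\<^sub>F * (1 + norm x)"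
    using assumption_A1_growth_lipschitz(1)[OF T A1] by blast
  obtain L\<^sub>F where LF: "L\<^sub>F > 0" "\<forall>t\<in>{0..T}. \<forall>x y \<theta>. norm (F t x \<theta> - F t y \<theta>) \<le> L\<^sub>F * (1 + norm \<theta>) * norm (x - y)"
    using assumption_A1_growth_lipschitz(2)[OF T A1] by blast
  have cs: "controlled_system T C\<^sub>F L\<^sub>F F"
    by unfold_locales (use T CF LF assumption_A2_time[OF A2] in simp_all)
  interpret controlled_system T C\<^sub>F L\<^sub>F F by (rule cs)
  have dF: "F t x differentiable at \<theta>" if "t \<in> {0..T}" for t x \<theta>
    by (rule assumption_A1D(4)[OF A1 that])
  obtain B where B: "B > 0" "\<And>x. norm (bderiv \<psi>\<^sub>T x) \<le> B" "\<And>x y. norm (bderiv \<psi>\<^sub>T x - bderiv \<psi>\<^sub>T y) \<le> B * norm (x - y)"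
    "\<And>x y. \<bar>\<psi>\<^sub>T x - \<psi>\<^sub>T y\<bar> \<le> B * norm (x - y)"
    using C2c_bounds[OF \<psi>\<^sub>T] by metis
  obtain C0 where C00: "C0 > 0" "\<forall>t\<in>{0..T}. \<forall>x\<in>cball 0 R\<^sub>T. \<forall>\<theta> \<theta>'. norm (bderiv (F t x) \<theta>) \<le> C0 \<and>
      norm (bderiv (F t x) \<theta> - bderiv (F t x) \<theta>') \<le> C0 * norm (\<theta> - \<theta>')"
    using assumption_A1_derivative_bounds[OF A1 RT] by (elim exE conjE)
  have C0: "C0 > 0" "\<And>t x \<theta>. t \<in> {0..T} \<Longrightarrow> norm x \<le> R\<^sub>T \<Longrightarrow> norm (bderiv (F t x) \<theta>) \<le> C0"
    using C00 by simp_all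
  \<comment> \<open>The bound of \<open>control_sup_bound\<close>, with \<open>B\<close> the
    Lipschitz constant of the terminal cost and \<open>C0\<close> the bound of the
    \<theta>-derivative.\<close>
  define M where "M = B * exp (L\<^sub>F * (T + (T + C\<^sub>\<Gamma>\<^sup>2 * T))) * C0"
  have M0: "M \<ge> 0" using B C0 by (simp add: M_def)
  define r where "r = radius (radius R + R\<^sub>T + 1)"
  have r: "r > 0"
    using radius_ge[of R] radius_ge[of "radius R + R\<^sub>T + 1"] R RT by (simp add: r_def)
  obtain C1 where C10: "C1 > 0" "\<forall>t\<in>{0..T}. \<forall>x\<in>cball 0 r. \<forall>\<theta> \<theta>'. norm (bderiv (F t x) \<theta>) \<le> C1 \<and>
      norm (bderiv (F t x) \<theta> - bderiv (F t x) \<theta>') \<le> C1 * norm (\<theta> - \<theta>')"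
    using assumption_A1_derivative_bounds[OF A1 r] by (elim exE conjE)
  have C1: "C1 > 0" "\<And>t x \<theta>. t \<in> {0..T} \<Longrightarrow> norm x \<le> r \<Longrightarrow> norm (bderiv (F t x) \<theta>) \<le> C1"
    "\<And>t x \<theta> \<theta>'. t \<in> {0..T} \<Longrightarrow> norm x \<le> r \<Longrightarrow> norm (bderiv (F t x) \<theta> - bderiv (F t x) \<theta>') \<le> C1 * norm (\<theta> - \<theta>')"
    using C10 by simp_all
  obtain C2 where C20: "C2 \<ge> 0" "\<forall>t\<in>{0..T}. \<forall>x\<in>cball 0 r. \<forall>y\<in>cball 0 r. \<forall>\<theta>. norm \<theta> \<le> M \<longrightarrow>
      norm (bderiv (\<lambda>x. F t x \<theta>) x) \<le> C2 \<and>
      norm (bderiv (\<lambda>x. F t x \<theta>) x - bderiv (\<lambda>x. F t x \<theta>) y) \<le> C2 * norm (x - y) \<and>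
      norm (bderiv (F t x) \<theta> - bderiv (F t y) \<theta>) \<le> C2 * norm (x - y)"
    using assumption_A2_bounds[OF A2 r, of M] by (elim exE conjE)
  have C2': "norm (bderiv (\<lambda>x. F t x \<theta>) x) \<le> C2 \<and>
      norm (bderiv (\<lambda>x. F t x \<theta>) x - bderiv (\<lambda>x. F t x \<theta>) y) \<le> C2 * norm (x - y) \<and>
      norm (bderiv (F t x) \<theta> - bderiv (F t y) \<theta>) \<le> C2 * norm (x - y)"
    if "t \<in> {0..T}" "norm x \<le> r" "norm y \<le> r" "norm \<theta> \<le> M" for t x y \<theta>
    using mp[OF spec[OF bspec[OF bspec[OF bspec[OF C20(2) that(1)], of x], of y]] that(4)] that(2,3) by simp
  have C2: "norm (bderiv (\<lambda>x. F t x \<theta>) x) \<le> C2"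
    "norm (bderiv (\<lambda>x. F t x \<theta>) x - bderiv (\<lambda>x. F t x \<theta>) y) \<le> C2 * norm (x - y)"
    "norm (bderiv (F t x) \<theta> - bderiv (F t y) \<theta>) \<le> C2 * norm (x - y)"
    if "t \<in> {0..T}" "norm x \<le> r" "norm y \<le> r" "norm \<theta> \<le> M" for t x y \<theta>
    using C2'[OF that] by blast+
  obtain C3 where C30: "C3 \<ge> 0" "\<forall>\<theta>\<^sub>1 \<theta>\<^sub>2. \<forall>s\<in>{0..T}. \<forall>t\<in>{0..T}. \<forall>x\<in>cball 0 r.
        norm (F t x \<theta>\<^sub>1 - F s x \<theta>\<^sub>2) \<le> C3 * (\<bar>t - s\<bar> + norm (\<theta>\<^sub>1 - \<theta>\<^sub>2))"
    using assumption_A2_time[OF A2 r] by (elim exE conjE)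
  have C3: "norm (F t x \<theta> - F t x \<theta>') \<le> C3 * norm (\<theta> - \<theta>')" if "t \<in> {0..T}" "norm x \<le> r" for t x \<theta> \<theta>'
    using bspec[OF bspec[OF bspec[OF spec[OF spec[OF C30(2), of \<theta>], of \<theta>'] that(1)] that(1)], of x] that(2) by simp
  define A where "A = 1 + L\<^sub>F * (1 + M) + B + C1 + C2 + C3"
  have LM: "0 \<le> L\<^sub>F * (1 + M)" using LF M0 by simp
  have A: "1 \<le> A" "L\<^sub>F * (1 + M) \<le> A" "B \<le> A" "C1 \<le> A" "C2 \<le> A" "C3 \<le> A"
    using LM B(1) C1(1) C20(1) C30(1) by (auto simp: A_def)
  have "mean_field_control T C\<^sub>F L\<^sub>F F R R\<^sub>T M A \<psi>\<^sub>T"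
  proof (unfold_locales, unfold r_def[symmetric])
    show "R > 0" "R\<^sub>T > 0" "A \<ge> 1" "L\<^sub>F * (1 + M) \<le> A" using R RT A by auto
    fix t assume t: "t \<in> {0..T}"
    show "norm (F t x \<theta> - F t x \<theta>') \<le> A * norm (\<theta> - \<theta>')" if "norm x \<le> r" for x \<theta> \<theta>'
    proof -
      have "norm (F t x \<theta> - F t x \<theta>') \<le> C3 * norm (\<theta> - \<theta>')" by (rule C3[OF t that])
      also have "\<dots> \<le> A * norm (\<theta> - \<theta>')" using A by (intro mult_right_mono) auto
      finally show ?thesis .
    qed
    show "F t x differentiable at \<theta>" for x \<theta> by (rule dF[OF t])
    show "continuous_on UNIV (\<lambda>x. bderiv (F t x) \<theta>)" for \<theta>
      by (rule differentiable_imp_continuous_on[OF assumption_A2D(2)[OF A2 r t]])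
    show "norm (bderiv (F t x) \<theta>) \<le> A" if "norm x \<le> r" for x \<theta>
      using C1(2)[OF t that, of \<theta>] A by simp
    show "norm (bderiv (F t x) \<theta> - bderiv (F t x') \<theta>') \<le> A * (norm (x - x') + norm (\<theta> - \<theta>'))"
      if x: "norm x \<le> r" "norm x' \<le> r" and \<theta>: "norm \<theta> \<le> M" "norm \<theta>' \<le> M" for x x' \<theta> \<theta>'
    proof -
      have "norm (bderiv (F t x) \<theta> - bderiv (F t x') \<theta>')
        \<le> norm (bderiv (F t x) \<theta> - bderiv (F t x') \<theta>) + norm (bderiv (F t x') \<theta> - bderiv (F t x') \<theta>')"
        using norm_triangle_ineq[of "bderiv (F t x) \<theta> - bderiv (F t x') \<theta>" "bderiv (F t x') \<theta> - bderiv (F t x') \<theta>'"] by simp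
      also have "\<dots> \<le> C2 * norm (x - x') + C1 * norm (\<theta> - \<theta>')"
        by (intro add_mono C2(3)[OF t x \<theta>(1)] C1(3)[OF t x(2)])
      also have "\<dots> \<le> A * norm (x - x') + A * norm (\<theta> - \<theta>')"
        using A by (intro add_mono mult_right_mono) auto
      finally show ?thesis by (simp add: distrib_left)
    qed
    fix x1 x2 x3 x4 :: "real ^ 'd" and \<theta> \<theta>' :: "real ^ 'm"
    assume x: "norm x1 \<le> r" "norm x2 \<le> r" "norm x3 \<le> r" "norm x4 \<le> r" and \<theta>: "norm \<theta> \<le> M" "norm \<theta>' \<le> M"
    have Ck: "C_k (Suc (Suc 0)) (\<lambda>x. F t x \<theta>)"
      by (rule assumption_A2D(1)[OF A2 r t])
    have 1: "norm (F t x1 \<theta> - F t x2 \<theta> - F t x3 \<theta> + F t x4 \<theta>)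
      \<le> C2 * norm (x1 - x2 - x3 + x4) + C2 * (norm (x1 - x3) + norm (x2 - x4)) * norm (x3 - x4)"
    proof (rule quadruple_bound[where S = "cball 0 r" and f = "\<lambda>x. F t x \<theta>" and f' = "bderiv (\<lambda>x. F t x \<theta>)"])
      show "((\<lambda>x. F t x \<theta>) has_derivative blinfun_apply (bderiv (\<lambda>x. F t x \<theta>) x)) (at x)" for x
        by (rule bderiv_has_derivative[OF C_k_differentiable[OF Ck]])
      show "norm (bderiv (\<lambda>x. F t x \<theta>) x) \<le> C2" if "x \<in> cball 0 r" for x
        using C2(1)[OF t _ _ \<theta>(1), of x x] that by simp
      show "norm (bderiv (\<lambda>x. F t x \<theta>) x - bderiv (\<lambda>x. F t x \<theta>) y) \<le> C2 * norm (x - y)"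
        if "x \<in> cball 0 r" "y \<in> cball 0 r" for x y
        using C2(2)[OF t _ _ \<theta>(1), of x y] that by simp
    qed (use x C20(1) in auto)
    \<comment> \<open>After the second difference at a fixed control, the change of control in the
      terms with x3 and x4 remains. It is a mixed difference, estimated by moving along the segment
      of controls and using that the \<theta>-derivative is Lipschitz in x.\<close>
    let ?p = "\<lambda>\<tau>. \<theta>' + \<tau> *\<^sub>R (\<theta> - \<theta>')"
    let ?h = "\<lambda>\<tau>. F t x3 (?p \<tau>) - F t x4 (?p \<tau>)"
    have 2: "norm (?h 1 - ?h 0) \<le> C2 * norm (x3 - x4) * norm (\<theta> - \<theta>')"
    proof (rule segment_bound)
      fix \<tau> :: real assume \<tau>: "\<tau> \<in> {0..1}"
      show "(?h has_vector_derivative bderiv (F t x3) (?p \<tau>) (\<theta> - \<theta>') - bderiv (F t x4) (?p \<tau>) (\<theta> - \<theta>')) (at \<tau> within {0..1})"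
        by (intro has_vector_derivative_diff segment_derivative[OF convex_UNIV UNIV_I UNIV_I \<tau>] bderiv_has_derivative dF t)
      \<comment> \<open>The constant \<open>C2\<close> is valid for controls of norm at most M only;
        the segment stays there because a ball is convex.\<close>
      have "?p \<tau> = (1 - \<tau>) *\<^sub>R \<theta>' + \<tau> *\<^sub>R \<theta>" by (simp add: algebra_simps)
      moreover have "(1 - \<tau>) *\<^sub>R \<theta>' + \<tau> *\<^sub>R \<theta> \<in> cball 0 M"
        using convexD[OF convex_cball[of 0 M], of \<theta>' \<theta> "1 - \<tau>" \<tau>] \<theta> \<tau> by simp
      ultimately have "norm (?p \<tau>) \<le> M" by simp
      then have "norm (bderiv (F t x3) (?p \<tau>) - bderiv (F t x4) (?p \<tau>)) \<le> C2 * norm (x3 - x4)"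
        by (rule C2(3)[OF t x(3,4)])
      then show "norm (bderiv (F t x3) (?p \<tau>) (\<theta> - \<theta>') - bderiv (F t x4) (?p \<tau>) (\<theta> - \<theta>')) \<le> C2 * norm (x3 - x4) * norm (\<theta> - \<theta>')"
        unfolding blinfun.diff_left[symmetric] by (intro order_trans[OF norm_blinfun mult_right_mono]) auto
    qed
    have "F t x1 \<theta> - F t x2 \<theta> - F t x3 \<theta>' + F t x4 \<theta>' = (F t x1 \<theta> - F t x2 \<theta> - F t x3 \<theta> + F t x4 \<theta>) + (?h 1 - ?h 0)"
      by simp
    also have "norm \<dots> \<le> (C2 * norm (x1 - x2 - x3 + x4) + C2 * (norm (x1 - x3) + norm (x2 - x4)) * norm (x3 - x4))
       + C2 * norm (x3 - x4) * norm (\<theta> - \<theta>')"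
      by (rule order_trans[OF norm_triangle_ineq add_mono[OF 1 2]])
    also have "\<dots> = C2 * (norm (x1 - x2 - x3 + x4) + (norm (x1 - x3) + norm (x2 - x4) + norm (\<theta> - \<theta>')) * norm (x3 - x4))"
      by (simp add: algebra_simps)
    also have "\<dots> \<le> A * (norm (x1 - x2 - x3 + x4) + (norm (x1 - x3) + norm (x2 - x4) + norm (\<theta> - \<theta>')) * norm (x3 - x4))"
      using A by (intro mult_right_mono) auto
    also have "\<dots> = A * norm (x1 - x2 - x3 + x4) + A * (norm (x1 - x3) + norm (x2 - x4) + norm (\<theta> - \<theta>')) * norm (x3 - x4)"
      by (simp add: algebra_simps)
    finally show "norm (F t x1 \<theta> - F t x2 \<theta> - F t x3 \<theta>' + F t x4 \<theta>')
        \<le> A * norm (x1 - x2 - x3 + x4) + A * (norm (x1 - x3) + norm (x2 - x4) + norm (\<theta> - \<theta>')) * norm (x3 - x4)" .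
  next
    show "\<bar>\<psi>\<^sub>T z - \<psi>\<^sub>T z'\<bar> \<le> A * norm (z - z')" for z z'
      using A by (intro order_trans[OF B(4)] mult_right_mono) auto
    fix z1 z2 z3 z4 :: "(real ^ 'd) \<times> (real ^ 'd)"
    have Ck: "C_k (Suc (Suc 0)) \<psi>\<^sub>T" using \<psi>\<^sub>T by (simp add: C2c_def numeral_2_eq_2)
    have "norm (\<psi>\<^sub>T z1 - \<psi>\<^sub>T z2 - \<psi>\<^sub>T z3 + \<psi>\<^sub>T z4)
        \<le> B * norm (z1 - z2 - z3 + z4) + B * (norm (z1 - z3) + norm (z2 - z4)) * norm (z3 - z4)"
      by (rule quadruple_bound[where S = UNIV and f' = "bderiv \<psi>\<^sub>T"])
        (use B in \<open>auto intro: bderiv_has_derivative C_k_differentiable[OF Ck]\<close>)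
    also have "\<dots> \<le> A * norm (z1 - z2 - z3 + z4) + A * (norm (z1 - z3) + norm (z2 - z4)) * norm (z3 - z4)"
      using A by (intro add_mono mult_right_mono) auto
    finally show "\<bar>\<psi>\<^sub>T z1 - \<psi>\<^sub>T z2 - \<psi>\<^sub>T z3 + \<psi>\<^sub>T z4\<bar>
        \<le> A * norm (z1 - z2 - z3 + z4) + A * (norm (z1 - z3) + norm (z2 - z4)) * norm (z3 - z4)" by simp
  qed
  moreover have "norm (\<theta> t) \<le> M" if "lam \<ge> 1" "measure_supp \<mu>\<^sub>0 \<subseteq> cball 0 R"
       "solution T F \<psi>\<^sub>T C\<^sub>\<Gamma> lam \<mu>\<^sub>0 \<mu> \<theta> \<psi>" "t \<in> {0..T}" for lam \<mu>\<^sub>0 \<mu> \<theta> \<psi> t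
    unfolding M_def
    by (rule control_sup_bound[OF that(3) CG that(1) conf that(2) _ B(4) dF _ C0(2) that(4)]) (use B C0 in auto)
  ultimately show thesis using that by blast
qed

text \<open>On an interval of length T a bound w gives at most \<open>T powr (1 / r)\<close> times w
  for finite exponents and w for the infinite one. The factor 1 + T dominates both, so the constant
  is the same for all p.\<close>

lemma Lp_norm_le:
  fixes f :: "real \<Rightarrow> 'a::{real_normed_vector, second_countable_topology}"
  assumes T: "T > 0" and p: "p \<ge> 1" and w: "w \<ge> 0" and f: "continuous_on {0..T} f"
    and le: "\<And>t. t \<in> {0..T} \<Longrightarrow> norm (f t) \<le> w"
  shows "Lp_norm T p f \<le> ennreal ((1 + T) * w)"
proof (cases "p = \<infinity>")
  case True
  have c: "continuous_on {0..T} (\<lambda>t. norm (f t))" by (intro continuous_intros f)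
  have "(\<lambda>t. ennreal (norm (f t))) \<in> borel_measurable (restrict_space lborel {0..T})"
    using borel_measurable_continuous_on_restrict[OF c]
    by (simp add: measurable_cong_sets[OF sets_restrict_space_cong[OF sets_lborel] refl])
  moreover have "AE t in restrict_space lborel {0..T}. ennreal (norm (f t)) \<le> ennreal w"
    by (rule AE_I2) (use le in \<open>auto simp: space_restrict_space intro: ennreal_leI\<close>)
  ultimately have "esssup (restrict_space lborel {0..T}) (\<lambda>t. ennreal (norm (f t))) \<le> ennreal w"
    by (rule esssup_I)
  also have "\<dots> \<le> ennreal ((1 + T) * w)" using T w by (intro ennreal_leI) (simp add: distrib_right)
  finally show ?thesis using True by (simp add: Lp_norm_def)
next
  case False
  define r where "r = enn2real p"
  have r: "r \<ge> 1"
  proof -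
    have "enn2real 1 \<le> enn2real p" using p False by (intro enn2real_mono) (auto simp: less_top)
    then show ?thesis by (simp add: r_def)
  qed
  define I where "I = (\<integral>\<^sup>+t\<in>{0..T}. ennreal (norm (f t) powr r) \<partial>lborel)"
  have "I \<le> (\<integral>\<^sup>+t. ennreal (w powr r) * indicator {0..T} t \<partial>lborel)"
    unfolding I_def
    by (rule nn_integral_mono) (use le r in \<open>auto simp: indicator_def intro!: ennreal_leI powr_mono2\<close>)
  also have "\<dots> = ennreal (w powr r) * ennreal T" using T by (simp add: nn_integral_cmult_indicator)
  also have "\<dots> = ennreal (w powr r * T)" using T by (simp add: ennreal_mult)
  finally have I: "I \<le> ennreal (w powr r * T)" .
  then have "I \<noteq> \<infinity>" by (metis ennreal_neq_top infinity_ennreal_def top.extremum_uniqueI)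
  have "enn2real I \<le> w powr r * T" using enn2real_mono[OF I] T by simp
  then have "enn2real I powr (1 / r) \<le> (w powr r * T) powr (1 / r)"
    using r by (intro powr_mono2) auto
  also have "\<dots> = w * T powr (1 / r)" using T w r by (simp add: powr_mult powr_powr)
  also have "\<dots> \<le> w * (1 + T)"
  proof (rule mult_left_mono[OF _ w])
    have "T powr (1 / r) \<le> (1 + T) powr (1 / r)" using T r by (intro powr_mono2) auto
    also have "\<dots> \<le> (1 + T) powr 1" using T r by (intro powr_mono) auto
    finally show "T powr (1 / r) \<le> 1 + T" using T by simp
  qed
  finally have "ennreal (enn2real I powr (1 / r)) \<le> ennreal ((1 + T) * w)" by (intro ennreal_leI) (simp add: mult.commute)
  then show ?thesis using False \<open>I \<noteq> \<infinity>\<close> by (simp add: Lp_norm_def I_def r_def Let_def)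
qed

section \<open>Mean-field limit\<close>

theorem corollary4p4:
  fixes T R R\<^sub>T C\<^sub>\<Gamma> :: real
    and F :: "real \<Rightarrow> real ^ 'd \<Rightarrow> real ^ 'm \<Rightarrow> real ^ 'd"
    and \<l> \<psi>\<^sub>T :: "(real ^ 'd) \<times> (real ^ 'd) \<Rightarrow> real"
  assumes "T > 0" and "R > 0" and "C\<^sub>\<Gamma> > 0"
    and "assumption_A1 T F" and "assumption_A2 T F"
    and "confining_radius T F R R\<^sub>T"
    and "C_k 2 \<l>"
    and "C2c \<psi>\<^sub>T" and "fun_supp \<psi>\<^sub>T = cball 0 R\<^sub>T" and "\<forall>z\<in>cball 0 R\<^sub>T. \<psi>\<^sub>T z = \<l> z"
  shows "\<exists>lam\<^sub>0>0. \<forall>lam\<ge>lam\<^sub>0.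
    (\<forall>\<mu>\<^sub>0\<in>P_c. measure_supp \<mu>\<^sub>0 \<subseteq> cball 0 R \<longrightarrow>
      (\<forall>\<mu> \<theta> \<psi> \<mu>' \<theta>' \<psi>'.
         solution T F \<psi>\<^sub>T C\<^sub>\<Gamma> lam \<mu>\<^sub>0 \<mu> \<theta> \<psi> \<longrightarrow> solution T F \<psi>\<^sub>T C\<^sub>\<Gamma> lam \<mu>\<^sub>0 \<mu>' \<theta>' \<psi>' \<longrightarrow>
         (\<forall>t\<in>{0..T}. \<mu> t = \<mu>' t \<and> \<theta> t = \<theta>' t \<and> \<psi> t = \<psi>' t))) \<and>
    (\<forall>p\<ge>1. \<exists>C>0.
      \<forall>\<mu>\<^sub>0 X\<^sub>0 Y\<^sub>0 \<mu>\<^sub>0N \<mu>s \<theta>s \<psi>s \<mu>N \<theta>N \<psi>N.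
        \<mu>\<^sub>0 \<in> P_c \<longrightarrow> measure_supp \<mu>\<^sub>0 \<subseteq> cball 0 R \<longrightarrow>
        (\<forall>N\<ge>1. \<forall>i<N. (X\<^sub>0 N i, Y\<^sub>0 N i) \<in> cball 0 R) \<longrightarrow>
        (\<forall>N\<ge>1. \<mu>\<^sub>0N N = empirical N (\<lambda>i. (X\<^sub>0 N i, Y\<^sub>0 N i))) \<longrightarrow>
        (\<lambda>N. W1 (\<mu>\<^sub>0N N) \<mu>\<^sub>0) \<longlonglongrightarrow> 0 \<longrightarrow>
        solution T F \<psi>\<^sub>T C\<^sub>\<Gamma> lam \<mu>\<^sub>0 \<mu>s \<theta>s \<psi>s \<longrightarrow>
        (\<forall>N\<ge>1. solution T F \<psi>\<^sub>T C\<^sub>\<Gamma> lam (\<mu>\<^sub>0N N) (\<mu>N N) (\<theta>N N) (\<psi>N N) \<and>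
                (\<forall>t\<in>{0..T}. \<mu>N N t \<in> P_c_emp N)) \<longrightarrow>
        (\<forall>N\<ge>1.
           Max {Lp_norm T p (\<lambda>t. \<theta>N N t - \<theta>s t),
                SUP t\<in>{0..T}. W1 (\<mu>N N t) (\<mu>s t),
                SUP (t, z)\<in>{0..T} \<times> cball 0 R\<^sub>T. ennreal \<bar>\<psi>N N t z - \<psi>s t z\<bar>}
             \<le> ennreal C * W1 (\<mu>\<^sub>0N N) \<mu>\<^sub>0 \<and>
           \<mu>N N T = empirical N (\<lambda>i. (flow F (\<theta>N N) 0 T (X\<^sub>0 N i), Y\<^sub>0 N i)) \<and>
           ennreal \<bar>(LINT z|\<mu>s T. \<l> z)
                     - 1 / real N * (\<Sum>i<N. \<l> (flow F (\<theta>N N) 0 T (X\<^sub>0 N i), Y\<^sub>0 N i))\<bar>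
             \<le> ennreal C * W1 (\<mu>\<^sub>0N N) \<mu>\<^sub>0))"
proof -
  note T = assms(1) and conf = assms(6)
  obtain C\<^sub>F L\<^sub>F M A where mfc: "mean_field_control T C\<^sub>F L\<^sub>F F R R\<^sub>T M A \<psi>\<^sub>T"
    and M: "\<And>lam \<mu>\<^sub>0 \<mu> \<theta> \<psi> t. lam \<ge> 1 \<Longrightarrow> measure_supp \<mu>\<^sub>0 \<subseteq> cball 0 R \<Longrightarrow>
       solution T F \<psi>\<^sub>T C\<^sub>\<Gamma> lam \<mu>\<^sub>0 \<mu> \<theta> \<psi> \<Longrightarrow> t \<in> {0..T} \<Longrightarrow> norm (\<theta> t) \<le> M"
    using mean_field_control_exists[OF assms(1-6,8)] by metis
  interpret mean_field_control T C\<^sub>F L\<^sub>F F R R\<^sub>T M A \<psi>\<^sub>T by (rule mfc)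
  \<comment> \<open>One summand for each estimate: the L^p norm of the controls, the distance of the
    measures, the values of \<psi>, and the loss at time T, where the Lipschitz constant A of the
    terminal cost meets the factor 2 \<open>D\<^sub>1\<close> of the measures.\<close>
  define C where "C = 1 + T + 2 * D\<^sub>1 + A * D\<^sub>1 + A * (2 * D\<^sub>1)"
  have D: "D\<^sub>1 > 0" "A > 0" "A * D\<^sub>1 > 0" using D1_ge A by auto
  have C: "C > 0" "1 + T \<le> C" "2 * D\<^sub>1 \<le> C" "A * D\<^sub>1 \<le> C" "A * (2 * D\<^sub>1) \<le> C"
    using T D by (auto simp: C_def add_pos_pos)
  have unique: "\<mu> t = \<mu>' t \<and> \<theta> t = \<theta>' t \<and> \<psi> t = \<psi>' t"
    if lam: "lam \<ge> max 1 D\<^sub>4" and mu: "\<mu>\<^sub>0 \<in> P_c" "measure_supp \<mu>\<^sub>0 \<subseteq> cball 0 R"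
      and sol: "solution T F \<psi>\<^sub>T C\<^sub>\<Gamma> lam \<mu>\<^sub>0 \<mu> \<theta> \<psi>" "solution T F \<psi>\<^sub>T C\<^sub>\<Gamma> lam \<mu>\<^sub>0 \<mu>' \<theta>' \<psi>'" and t: "t \<in> {0..T}"
    for lam \<mu>\<^sub>0 \<mu> \<theta> \<psi> \<mu>' \<theta>' \<psi>' t
  proof -
    have lam1: "lam \<ge> 1" and lamD: "lam \<ge> D\<^sub>4" using lam by auto
    have \<theta>: "\<theta> s = \<theta>' s" if s: "s \<in> {0..T}" for s
      using solutions_stability(1)[OF sol conf mu(2) mu(2) M[OF lam1 mu(2) sol(1)] M[OF lam1 mu(2) sol(2)] lamD s]
      by (simp add: W1_self[OF P_cD(1)[OF mu(1)]])
    \<comment> \<open>The fields agree at all times, not only on [0, T], because the control is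
      evaluated at clamped times. So they have the same flow, which determines the measures and
      \<psi>.\<close>
    have eq: "control_field T F \<theta> = control_field T F \<theta>'"
      by (intro ext) (simp add: control_field_def \<theta>[OF clamp_mem[OF T]])
    note rep = solution_representation(4,5)[OF sol(1) conf mu(2) t] and rep' = solution_representation(4,5)[OF sol(2) conf mu(2) t]
    have "\<psi> t = \<psi>' t" by (rule ext) (simp add: rep(2) rep'(2) eq)
    then show ?thesis using \<theta>[OF t] by (simp add: rep(1) rep'(1) eq)
  qed
  have rate: "Max {Lp_norm T p (\<lambda>t. \<theta>N t - \<theta>s t), SUP t\<in>{0..T}. W1 (\<mu>N t) (\<mu>s t),
                SUP (t, z)\<in>{0..T} \<times> cball 0 R\<^sub>T. ennreal \<bar>\<psi>N t z - \<psi>s t z\<bar>} \<le> ennreal C * W1 \<nu> \<mu>\<^sub>0 \<and>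
           \<mu>N T = empirical N (\<lambda>i. (flow F \<theta>N 0 T (X\<^sub>0 i), Y\<^sub>0 i)) \<and>
           ennreal \<bar>(LINT z|\<mu>s T. \<l> z) - 1 / real N * (\<Sum>i<N. \<l> (flow F \<theta>N 0 T (X\<^sub>0 i), Y\<^sub>0 i))\<bar>
             \<le> ennreal C * W1 \<nu> \<mu>\<^sub>0"
    if lam: "lam \<ge> max 1 D\<^sub>4" and p: "p \<ge> 1" and mu: "\<mu>\<^sub>0 \<in> P_c" "measure_supp \<mu>\<^sub>0 \<subseteq> cball 0 R"
      and N: "N \<ge> 1" and XY: "\<And>i. i < N \<Longrightarrow> (X\<^sub>0 i, Y\<^sub>0 i) \<in> cball 0 R" and nu: "\<nu> = empirical N (\<lambda>i. (X\<^sub>0 i, Y\<^sub>0 i))"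
      and sol: "solution T F \<psi>\<^sub>T C\<^sub>\<Gamma> lam \<nu> \<mu>N \<theta>N \<psi>N" "solution T F \<psi>\<^sub>T C\<^sub>\<Gamma> lam \<mu>\<^sub>0 \<mu>s \<theta>s \<psi>s"
    for lam p \<mu>\<^sub>0 N X\<^sub>0 Y\<^sub>0 \<nu> \<mu>N \<theta>N \<psi>N \<mu>s \<theta>s \<psi>s
  proof -
    have lam1: "lam \<ge> 1" and lamD: "lam \<ge> D\<^sub>4" using lam by auto
    have supp: "measure_supp \<nu> \<subseteq> cball 0 R" unfolding nu by (rule measure_supp_empirical) (use XY in auto)
    note repN = solution_representation[OF sol(1) conf supp] and rep = solution_representation[OF sol(2) conf mu(2)]
    have T0: "T \<in> {0..T}" using T by simp
    let ?W = "W1 \<nu> \<mu>\<^sub>0"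
    have stab: "ennreal (norm (\<theta>N t - \<theta>s t)) \<le> ?W" "W1 (\<mu>N t) (\<mu>s t) \<le> ennreal (2 * D\<^sub>1) * ?W"
      if t: "t \<in> {0..T}" for t
      by (rule solutions_stability[OF sol conf supp mu(2) M[OF lam1 supp sol(1)] M[OF lam1 mu(2) sol(2)] lamD t]; assumption)+
    have stab_\<psi>: "ennreal \<bar>\<psi>N t z - \<psi>s t z\<bar> \<le> ennreal (A * D\<^sub>1) * ?W" if t: "t \<in> {0..T}" and z: "norm z \<le> R\<^sub>T" for t z
      by (rule solutions_stability(3)[OF sol conf supp mu(2) M[OF lam1 supp sol(1)] M[OF lam1 mu(2) sol(2)] lamD t z])
    have mono: "ennreal c * ?W \<le> ennreal C * ?W" if "c \<le> C" for c
      by (intro mult_right_mono ennreal_leI that) simp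
    \<comment> \<open>The L^p estimate wants a real bound w; for an infinite distance there is
      nothing to prove because C is positive.\<close>
    have Lp: "Lp_norm T p (\<lambda>t. \<theta>N t - \<theta>s t) \<le> ennreal C * ?W"
    proof (cases "?W = \<infinity>")
      case True
      then show ?thesis using C by (simp add: ennreal_mult_top)
    next
      case False
      then obtain w where w: "w \<ge> 0" "?W = ennreal w" by (cases ?W) auto
      have "continuous_on {0..T} \<theta>N" "continuous_on {0..T} \<theta>s"
        using sol lipschitz_on_continuous_on unfolding solution_def by blast+
      then have "Lp_norm T p (\<lambda>t. \<theta>N t - \<theta>s t) \<le> ennreal ((1 + T) * w)"
        using stab(1) w by (intro Lp_norm_le T p continuous_on_diff) (auto simp: ennreal_le_iff)
      also have "\<dots> = ennreal (1 + T) * ?W" using w T by (simp add: ennreal_mult)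
      also have "\<dots> \<le> ennreal C * ?W" by (rule mono[OF C(2)])
      finally show ?thesis .
    qed
    have W: "(SUP t\<in>{0..T}. W1 (\<mu>N t) (\<mu>s t)) \<le> ennreal C * ?W"
      by (rule SUP_least) (rule order_trans[OF stab(2) mono[OF C(3)]])
    have V: "(SUP (t, z)\<in>{0..T} \<times> cball 0 R\<^sub>T. ennreal \<bar>\<psi>N t z - \<psi>s t z\<bar>) \<le> ennreal C * ?W"
    proof (rule SUP_least)
      fix q assume q: "q \<in> {0..T} \<times> cball (0 :: (real ^ 'd) \<times> (real ^ 'd)) R\<^sub>T"
      obtain t z where q': "q = (t, z)" by (cases q)
      have "ennreal \<bar>\<psi>N t z - \<psi>s t z\<bar> \<le> ennreal C * ?W"
        by (rule order_trans[OF stab_\<psi> mono[OF C(4)]]) (use q q' in auto)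
      then show "(case q of (t, z) \<Rightarrow> ennreal \<bar>\<psi>N t z - \<psi>s t z\<bar>) \<le> ennreal C * ?W" by (simp add: q')
    qed
    obtain MN where "admissible_control T C\<^sub>F L\<^sub>F F \<theta>N MN" using repN(1) by blast
    then interpret CN: admissible_control T C\<^sub>F L\<^sub>F F \<theta>N MN .
    have flow: "CN.\<Psi> 0 T (x, y) = (flow F \<theta>N 0 T x, y)" for x y
      using CN.fst_flow_eq[of x y] CN.snd_flow[of 0 T "(x, y)"] T by (metis prod.collapse snd_conv less_imp_le)
    have emp: "\<mu>N T = empirical N (\<lambda>i. (flow F \<theta>N 0 T (X\<^sub>0 i), Y\<^sub>0 i))"
      unfolding repN(4)[OF T0] nu
      by (subst distr_empirical[OF _ N])
        (use T in \<open>auto intro!: borel_measurable_continuous_onI CN.continuous_on_ode_flow simp: flow\<close>)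
    have PcN: "\<mu>N T \<in> P_c" and Pcs: "\<mu>s T \<in> P_c" using sol T0 by (auto simp: solution_def P_c_curve_def)
    have aeN: "AE z in \<mu>N T. z \<in> cball 0 R\<^sub>T" and aes: "AE z in \<mu>s T. z \<in> cball 0 R\<^sub>T"
      using AE_measure_supp[OF P_cD(1)[OF PcN]] AE_measure_supp[OF P_cD(1)[OF Pcs]] repN(3)[OF T0] rep(3)[OF T0]
      by (auto elim!: eventually_mono)
    have "continuous_on UNIV \<psi>\<^sub>T" "continuous_on UNIV \<l>"
      using assms(7,8) by (auto simp: C2c_def intro: C_k_continuous)
    then have meas: "\<psi>\<^sub>T \<in> borel_measurable borel" "\<l> \<in> borel_measurable borel"
      by (auto intro: borel_measurable_continuous_onI)
    have int: "integrable \<rho> \<psi>\<^sub>T" if "\<rho> \<in> P_c" "AE z in \<rho>. z \<in> cball 0 R\<^sub>T" for \<rho>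
    proof -
      interpret prob_space \<rho> by (rule P_cD(2)[OF that(1)])
      have "AE z in \<rho>. norm (\<psi>\<^sub>T z) \<le> \<bar>\<psi>\<^sub>T 0\<bar> + A * R\<^sub>T"
        using that(2)
      proof eventually_elim
        case (elim z)
        then have "A * norm (z - 0) \<le> A * R\<^sub>T" using D by (intro mult_left_mono) auto
        then show ?case using \<psi>\<^sub>T_lip[of z 0] by simp
      qed
      then show ?thesis
        by (rule integrable_const_bound) (simp add: measurable_cong_sets[OF P_cD(1)[OF that(1)] refl] meas)
    qed
    \<comment> \<open>The measure at time T lives in the ball of radius \<open>R\<^sub>T\<close>,
      where \<l> and the terminal cost coincide. The terminal cost is known to be globally
      Lipschitz, so it is the one compared in W1.\<close>
    have ls: "(LINT z|\<mu>s T. \<l> z) = (LINT z|\<mu>s T. \<psi>\<^sub>T z)"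
    proof (rule integral_cong_AE)
      show "\<l> \<in> borel_measurable (\<mu>s T)" "\<psi>\<^sub>T \<in> borel_measurable (\<mu>s T)"
        by (simp_all add: measurable_cong_sets[OF P_cD(1)[OF Pcs] refl] meas)
      show "AE z in \<mu>s T. \<l> z = \<psi>\<^sub>T z" using aes by eventually_elim (use assms(10) in simp)
    qed
    \<comment> \<open>For the finite sum the two functions must agree at every atom; each atom
      belongs to the support and thus to the same ball.\<close>
    have "1 / real N * (\<Sum>i<N. \<l> (flow F \<theta>N 0 T (X\<^sub>0 i), Y\<^sub>0 i)) = 1 / real N * (\<Sum>i<N. \<psi>\<^sub>T (flow F \<theta>N 0 T (X\<^sub>0 i), Y\<^sub>0 i))"
    proof (intro arg_cong[where f = "(*) _"] sum.cong refl)
      fix i assume "i \<in> {..<N}"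
      then have "(flow F \<theta>N 0 T (X\<^sub>0 i), Y\<^sub>0 i) \<in> measure_supp (\<mu>N T)"
        unfolding emp using atom_in_measure_supp[of i N "\<lambda>i. (flow F \<theta>N 0 T (X\<^sub>0 i), Y\<^sub>0 i)"] by simp
      then show "\<l> (flow F \<theta>N 0 T (X\<^sub>0 i), Y\<^sub>0 i) = \<psi>\<^sub>T (flow F \<theta>N 0 T (X\<^sub>0 i), Y\<^sub>0 i)"
        using repN(3)[OF T0] assms(10) by (metis subsetD)
    qed
    also have "\<dots> = (LINT z|\<mu>N T. \<psi>\<^sub>T z)"
      unfolding emp by (rule integral_empirical[OF N meas(1), symmetric])
    finally have lN: "1 / real N * (\<Sum>i<N. \<l> (flow F \<theta>N 0 T (X\<^sub>0 i), Y\<^sub>0 i)) = (LINT z|\<mu>N T. \<psi>\<^sub>T z)" .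
    have "ennreal \<bar>(LINT z|\<mu>N T. \<psi>\<^sub>T z) - (LINT z|\<mu>s T. \<psi>\<^sub>T z)\<bar> \<le> ennreal 0 + ennreal A * W1 (\<mu>N T) (\<mu>s T)"
      by (rule W1_integral_diff[OF P_cD(1,2)[OF PcN] P_cD(1)[OF Pcs] int[OF PcN aeN] int[OF Pcs aes] aeN aes])
        (use D \<psi>\<^sub>T_lip in \<open>auto simp: dist_norm\<close>)
    also have "\<dots> = ennreal A * W1 (\<mu>N T) (\<mu>s T)" by simp
    also have "\<dots> \<le> ennreal A * (ennreal (2 * D\<^sub>1) * ?W)" by (intro mult_left_mono stab(2)[OF T0]) simp
    also have "\<dots> = ennreal (A * (2 * D\<^sub>1)) * ?W" using D by (simp add: ennreal_mult mult.assoc)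
    also have "\<dots> \<le> ennreal C * ?W" by (rule mono[OF C(5)])
    finally have L: "ennreal \<bar>(LINT z|\<mu>s T. \<l> z) - 1 / real N * (\<Sum>i<N. \<l> (flow F \<theta>N 0 T (X\<^sub>0 i), Y\<^sub>0 i))\<bar> \<le> ennreal C * ?W"
      unfolding ls lN by (simp only: abs_minus_commute)
    show ?thesis using Lp W V emp L by simp
  qed
  show ?thesis
  \<comment> \<open>The entry 1 serves the uniform bound of the controls, the entry
    \<open>D\<^sub>4\<close> the absorption of \<delta>.\<close>
  proof (rule exI[of _ "max 1 D\<^sub>4"], intro conjI allI impI ballI)
    show "max 1 D\<^sub>4 > 0" by simp
    fix lam assume lam: "max 1 D\<^sub>4 \<le> lam"
    show "\<mu> t = \<mu>' t" "\<theta> t = \<theta>' t" "\<psi> t = \<psi>' t"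
      if "\<mu>\<^sub>0 \<in> P_c" "measure_supp \<mu>\<^sub>0 \<subseteq> cball 0 R" "solution T F \<psi>\<^sub>T C\<^sub>\<Gamma> lam \<mu>\<^sub>0 \<mu> \<theta> \<psi>"
        "solution T F \<psi>\<^sub>T C\<^sub>\<Gamma> lam \<mu>\<^sub>0 \<mu>' \<theta>' \<psi>'" "t \<in> {0..T}" for \<mu>\<^sub>0 \<mu> \<theta> \<psi> \<mu>' \<theta>' \<psi>' t
      using unique[OF lam that] by auto
    fix p :: ennreal assume p: "1 \<le> p"
    show "\<exists>C>0.
      \<forall>\<mu>\<^sub>0 X\<^sub>0 Y\<^sub>0 \<mu>\<^sub>0N \<mu>s \<theta>s \<psi>s \<mu>N \<theta>N \<psi>N.
        \<mu>\<^sub>0 \<in> P_c \<longrightarrow> measure_supp \<mu>\<^sub>0 \<subseteq> cball 0 R \<longrightarrow>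
        (\<forall>N\<ge>1. \<forall>i<N. (X\<^sub>0 N i, Y\<^sub>0 N i) \<in> cball 0 R) \<longrightarrow>
        (\<forall>N\<ge>1. \<mu>\<^sub>0N N = empirical N (\<lambda>i. (X\<^sub>0 N i, Y\<^sub>0 N i))) \<longrightarrow>
        (\<lambda>N. W1 (\<mu>\<^sub>0N N) \<mu>\<^sub>0) \<longlonglongrightarrow> 0 \<longrightarrow>
        solution T F \<psi>\<^sub>T C\<^sub>\<Gamma> lam \<mu>\<^sub>0 \<mu>s \<theta>s \<psi>s \<longrightarrow>
        (\<forall>N\<ge>1. solution T F \<psi>\<^sub>T C\<^sub>\<Gamma> lam (\<mu>\<^sub>0N N) (\<mu>N N) (\<theta>N N) (\<psi>N N) \<and>
                (\<forall>t\<in>{0..T}. \<mu>N N t \<in> P_c_emp N)) \<longrightarrow>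
        (\<forall>N\<ge>1.
           Max {Lp_norm T p (\<lambda>t. \<theta>N N t - \<theta>s t),
                SUP t\<in>{0..T}. W1 (\<mu>N N t) (\<mu>s t),
                SUP (t, z)\<in>{0..T} \<times> cball 0 R\<^sub>T. ennreal \<bar>\<psi>N N t z - \<psi>s t z\<bar>}
             \<le> ennreal C * W1 (\<mu>\<^sub>0N N) \<mu>\<^sub>0 \<and>
           \<mu>N N T = empirical N (\<lambda>i. (flow F (\<theta>N N) 0 T (X\<^sub>0 N i), Y\<^sub>0 N i)) \<and>
           ennreal \<bar>(LINT z|\<mu>s T. \<l> z)
                     - 1 / real N * (\<Sum>i<N. \<l> (flow F (\<theta>N N) 0 T (X\<^sub>0 N i), Y\<^sub>0 N i))\<bar>
             \<le> ennreal C * W1 (\<mu>\<^sub>0N N) \<mu>\<^sub>0)"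
      by (intro exI[of _ C] conjI[OF C(1)] allI impI, rule rate[OF lam p]) simp_all
  qed
qed

end
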